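(* Let $p > 3$ be a prime, let $V$ be a finitely generated free $\mathbb{Z}_p$-module, $W = V \wedge V$, and let $L \leq W$ be a $\mathbb{Z}_p$-submodule such that $W/L$ is torsion-free. Let $\mathcal{L} = V \oplus W/L$ be the associated $\mathbb{Z}_p$-Lie algebra of nilpotency class at most $2$. Then $SK_1(\mathcal{L})$ is finite if and only if $SK_1(\mathcal{L} \otimes \mathbb{Q}_p) = 0$.
   Context: With $\pi \colon W \to W/L$ the projection, the Lie bracket on $\mathcal{L} = V \oplus W/L$ is $[v_1 + w_1, v_2 + w_2] = \pi(v_1 \wedge v_2)$ for $v_i \in V$, $w_i \in W/L$. For a Lie algebra $\mathcal{M}$ over a ring $R$ with bracket map $\kappa_{\mathcal{M}} \colon \mathcal{M} \wedge \mathcal{M} \to \mathcal{M}$, $x \wedge y \mapsto [x,y]$, Jacobi map $\theta_{\mathcal{M}} \colon x\wedge y \wedge z \mapsto [x,y]\wedge z + [y,z]\wedge x + [z,x] \wedge y$, and set of decomposable wedges $D\mathcal{M} = \{x \wedge y \mid x,y \in \mathcal{M}\}$, one defines $SK_1(\mathcal{M}) = \ker \kappa_{\mathcal{M}} / (\mathrm{im}\, \theta_{\mathcal{M}} + \langle D\mathcal{M} \cap \ker \kappa_{\mathcal{M}}\rangle)$. For the Lie algebras above this is $$SK_1(\mathcal{L}) = \frac{L}{\langle v \wedge w \mid v,w \in V,\ v \wedge w \in L\rangle_{\mathbb{Z}_p}},$$ $$SK_1(\mathcal{L}\otimes \mathbb{Q}_p) = \frac{L \otimes \mathbb{Q}_p}{\langle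 v \wedge w \mid v,w \in V\otimes \mathbb{Q}_p,\ v \wedge w \in L\otimes \mathbb{Q}_p\rangle_{\mathbb{Q}_p}}.$$ *)

theory Defs
  imports "HOL-Algebra.AbelCoset" "HOL-Algebra.Module" "HOL-Computational_Algebra.Primes"
begin

section \<open>The rings of p-adic integers and p-adic numbers\<close>

text \<open>The p-adic integers are the inverse limit of the rings of integers modulo \<open>p ^ n\<close>,
  with residues represented in \<open>{0..<p ^ n}\<close>.\<close>

definition Zp :: "nat \<Rightarrow> (nat \<Rightarrow> int) ring" where
  "Zp p = \<lparr>carrier = {f. \<forall>n. f n \<in> {0..<int p ^ n} \<and> f (Suc n) mod int p ^ n = f n},
           monoid.mult = (\<lambda>f g n. (f n * g n) mod int p ^ n),
           one = (\<lambda>n. 1 mod int p ^ n),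
           zero = (\<lambda>n. 0),
           add = (\<lambda>f g n. (f n + g n) mod int p ^ n)\<rparr>"

definition fraction :: "('a, 'm) ring_scheme \<Rightarrow> 'a \<Rightarrow> 'a \<Rightarrow> ('a \<times> 'a) set" where
  "fraction R a b = {(c, d). c \<in> carrier R \<and> d \<in> carrier R - {\<zero>\<^bsub>R\<^esub>} \<and> a \<otimes>\<^bsub>R\<^esub> d = c \<otimes>\<^bsub>R\<^esub> b}"

text \<open>The field of fractions of an integral domain \<open>R\<close>.\<close>

definition frac_field :: "('a, 'm) ring_scheme \<Rightarrow> ('a \<times> 'a) set ring" where
  "frac_field R =
    \<lparr>carrier = {fraction R a b | a b. a \<in> carrier R \<and> b \<in> carrier R - {\<zero>\<^bsub>R\<^esub>}},
     monoid.mult = (\<lambda>X Y. \<Union>(a, b)\<in>X. \<Union>(c, d)\<in>Y. fraction R (a \<otimes>\<^bsub>R\<^esub> c) (b \<otimes>\<^bsub>R\<^esub> d)),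
     one = fraction R \<one>\<^bsub>R\<^esub> \<one>\<^bsub>R\<^esub>,
     zero = fraction R \<zero>\<^bsub>R\<^esub> \<one>\<^bsub>R\<^esub>,
     add = (\<lambda>X Y. \<Union>(a, b)\<in>X. \<Union>(c, d)\<in>Y.
              fraction R (a \<otimes>\<^bsub>R\<^esub> d \<oplus>\<^bsub>R\<^esub> c \<otimes>\<^bsub>R\<^esub> b) (b \<otimes>\<^bsub>R\<^esub> d))\<rparr>"

definition frac_incl :: "('a, 'm) ring_scheme \<Rightarrow> 'a \<Rightarrow> ('a \<times> 'a) set" where
  "frac_incl R a = fraction R a \<one>\<^bsub>R\<^esub>"

definition Qp :: "nat \<Rightarrow> ((nat \<Rightarrow> int) \<times> (nat \<Rightarrow> int)) set ring" where
  "Qp p = frac_field (Zp p)"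


section \<open>Modules\<close>

text \<open>The record type \<^typ>\<open>('a, 'b) module\<close> of HOL-Algebra extends the one of rings; its
  fields \<open>mult\<close> and \<open>one\<close> play no role for modules and are left undefined below.\<close>

definition mspan ::
    "('a, 'm) ring_scheme \<Rightarrow> ('a, 'b, 'n) module_scheme \<Rightarrow> 'b set \<Rightarrow> 'b set" where
  "mspan R M S = \<Inter>{H. submodule H R M \<and> S \<subseteq> H}"

definition quot_module :: "('a, 'b, 'n) module_scheme \<Rightarrow> 'b set \<Rightarrow> ('a, 'b set) module" where
  "quot_module M N =
    \<lparr>carrier = a_rcosets\<^bsub>M\<^esub> N,
     monoid.mult = undefined, one = undefined,
     zero = N,
     add = set_add M,
     smult = (\<lambda>r X. \<Union>x\<in>X. N +>\<^bsub>M\<^esub> (r \<odot>\<^bsub>M\<^esub> x))\<rparr>"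

definition fg_free_module :: "('a, 'm) ring_scheme \<Rightarrow> ('a, 'b, 'n) module_scheme \<Rightarrow> bool" where
  "fg_free_module R M \<longleftrightarrow> module R M \<and>
    (\<exists>B. finite B \<and> B \<subseteq> carrier M \<and>
      (\<forall>x\<in>carrier M. \<exists>!c. c \<in> B \<rightarrow>\<^sub>E carrier R \<and> x = (\<Oplus>\<^bsub>M\<^esub>b\<in>B. c b \<odot>\<^bsub>M\<^esub> b)))"

definition torsion_free :: "('a, 'm) ring_scheme \<Rightarrow> ('a, 'b, 'n) module_scheme \<Rightarrow> bool" where
  "torsion_free R M \<longleftrightarrow>
    (\<forall>r\<in>carrier R. \<forall>x\<in>carrier M. r \<odot>\<^bsub>M\<^esub> x = \<zero>\<^bsub>M\<^esub> \<longrightarrow> r = \<zero>\<^bsub>R\<^esub> \<or> x = \<zero>\<^bsub>M\<^esub>)"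

definition free_module :: "('a, 'm) ring_scheme \<Rightarrow> 'x set \<Rightarrow> ('a, 'x \<Rightarrow> 'a) module" where
  "free_module R X =
    \<lparr>carrier = {f. f \<in> X \<rightarrow> carrier R \<and> (\<forall>x. x \<notin> X \<longrightarrow> f x = \<zero>\<^bsub>R\<^esub>) \<and> finite {x. f x \<noteq> \<zero>\<^bsub>R\<^esub>}},
     monoid.mult = undefined, one = undefined,
     zero = (\<lambda>x. \<zero>\<^bsub>R\<^esub>),
     add = (\<lambda>f g x. f x \<oplus>\<^bsub>R\<^esub> g x),
     smult = (\<lambda>r f x. r \<otimes>\<^bsub>R\<^esub> f x)\<rparr>"

definition free_gen :: "('a, 'm) ring_scheme \<Rightarrow> 'x \<Rightarrow> 'x \<Rightarrow> 'a" where
  "free_gen R x = (\<lambda>y. if y = x then \<one>\<^bsub>R\<^esub> else \<zero>\<^bsub>R\<^esub>)"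

text \<open>The module with generators \<open>X\<close> and relations \<open>E\<close>, the class of a generator, and the
  linear map to \<open>N\<close> determined by the images \<open>\<phi> x\<close> of the generators (meaningful whenever
  \<open>\<phi>\<close> respects the relations).\<close>

definition pres_module ::
    "('a, 'm) ring_scheme \<Rightarrow> 'x set \<Rightarrow> ('x \<Rightarrow> 'a) set \<Rightarrow> ('a, ('x \<Rightarrow> 'a) set) module" where
  "pres_module R X E = quot_module (free_module R X) (mspan R (free_module R X) E)"

definition pres_gen ::
    "('a, 'm) ring_scheme \<Rightarrow> 'x set \<Rightarrow> ('x \<Rightarrow> 'a) set \<Rightarrow> 'x \<Rightarrow> ('x \<Rightarrow> 'a) set" where
  "pres_gen R X E x = mspan R (free_module R X) E +>\<^bsub>free_module R X\<^esub> free_gen R x"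

definition pres_lift ::
    "('a, 'm) ring_scheme \<Rightarrow> ('a, 'b, 'n) module_scheme \<Rightarrow> ('x \<Rightarrow> 'b) \<Rightarrow> ('x \<Rightarrow> 'a) set \<Rightarrow> 'b" where
  "pres_lift R N \<phi> \<xi> =
    (THE y. \<exists>f\<in>\<xi>. y = (\<Oplus>\<^bsub>N\<^esub>x\<in>{x. f x \<noteq> \<zero>\<^bsub>R\<^esub>}. f x \<odot>\<^bsub>N\<^esub> \<phi> x))"


subsection \<open>Exterior powers\<close>

definition tuples :: "nat \<Rightarrow> ('b, 'm) partial_object_scheme \<Rightarrow> 'b list set" where
  "tuples k M = {xs. length xs = k \<and> set xs \<subseteq> carrier M}"

text \<open>Multilinearity in each argument, and vanishing on tuples with two equal entries.\<close>

definition ext_rels ::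
    "('a, 'm) ring_scheme \<Rightarrow> nat \<Rightarrow> ('a, 'b, 'n) module_scheme \<Rightarrow> ('b list \<Rightarrow> 'a) set" where
  "ext_rels R k M = (let F = free_module R (tuples k M); e = free_gen R in
     {e (xs[i := x \<oplus>\<^bsub>M\<^esub> y]) \<ominus>\<^bsub>F\<^esub> (e (xs[i := x]) \<oplus>\<^bsub>F\<^esub> e (xs[i := y])) | xs i x y.
        xs \<in> tuples k M \<and> i < k \<and> x \<in> carrier M \<and> y \<in> carrier M} \<union>
     {e (xs[i := r \<odot>\<^bsub>M\<^esub> x]) \<ominus>\<^bsub>F\<^esub> r \<odot>\<^bsub>F\<^esub> e (xs[i := x]) | xs i r x.
        xs \<in> tuples k M \<and> i < k \<and> r \<in> carrier R \<and> x \<in> carrier M} \<union>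
     {e xs | xs i j. xs \<in> tuples k M \<and> i < j \<and> j < k \<and> xs ! i = xs ! j})"

definition ext_power ::
    "('a, 'm) ring_scheme \<Rightarrow> nat \<Rightarrow> ('a, 'b, 'n) module_scheme \<Rightarrow> ('a, ('b list \<Rightarrow> 'a) set) module"
  where "ext_power R k M = pres_module R (tuples k M) (ext_rels R k M)"

text \<open>\<open>wedge R M [x\<^sub>1, \<dots>, x\<^sub>k]\<close> is \<open>x\<^sub>1 \<and> \<dots> \<and> x\<^sub>k\<close>.\<close>

definition wedge ::
    "('a, 'm) ring_scheme \<Rightarrow> ('a, 'b, 'n) module_scheme \<Rightarrow> 'b list \<Rightarrow> ('b list \<Rightarrow> 'a) set" where
  "wedge R M xs = pres_gen R (tuples (length xs) M) (ext_rels R (length xs) M) xs"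


subsection \<open>Tensor products\<close>

definition tensor_rels ::
    "('a, 'm) ring_scheme \<Rightarrow> ('a, 'b, 'n) module_scheme \<Rightarrow> ('a, 'c, 'k) module_scheme \<Rightarrow>
     ('b \<times> 'c \<Rightarrow> 'a) set" where
  "tensor_rels R M N = (let F = free_module R (carrier M \<times> carrier N); e = free_gen R in
     {e (x \<oplus>\<^bsub>M\<^esub> x', y) \<ominus>\<^bsub>F\<^esub> (e (x, y) \<oplus>\<^bsub>F\<^esub> e (x', y)) | x x' y.
        x \<in> carrier M \<and> x' \<in> carrier M \<and> y \<in> carrier N} \<union>
     {e (x, y \<oplus>\<^bsub>N\<^esub> y') \<ominus>\<^bsub>F\<^esub> (e (x, y) \<oplus>\<^bsub>F\<^esub> e (x, y')) | x y y'.
        x \<in> carrier M \<and> y \<in> carrier N \<and> y' \<in> carrier N} \<union>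
     {e (r \<odot>\<^bsub>M\<^esub> x, y) \<ominus>\<^bsub>F\<^esub> r \<odot>\<^bsub>F\<^esub> e (x, y) | r x y.
        r \<in> carrier R \<and> x \<in> carrier M \<and> y \<in> carrier N} \<union>
     {e (x, r \<odot>\<^bsub>N\<^esub> y) \<ominus>\<^bsub>F\<^esub> r \<odot>\<^bsub>F\<^esub> e (x, y) | r x y.
        r \<in> carrier R \<and> x \<in> carrier M \<and> y \<in> carrier N})"

definition tensor_module ::
    "('a, 'm) ring_scheme \<Rightarrow> ('a, 'b, 'n) module_scheme \<Rightarrow> ('a, 'c, 'k) module_scheme \<Rightarrow>
     ('a, ('b \<times> 'c \<Rightarrow> 'a) set) module" where
  "tensor_module R M N = pres_module R (carrier M \<times> carrier N) (tensor_rels R M N)"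

definition tensor ::
    "('a, 'm) ring_scheme \<Rightarrow> ('a, 'b, 'n) module_scheme \<Rightarrow> ('a, 'c, 'k) module_scheme \<Rightarrow>
     'b \<Rightarrow> 'c \<Rightarrow> ('b \<times> 'c \<Rightarrow> 'a) set" where
  "tensor R M N x y = pres_gen R (carrier M \<times> carrier N) (tensor_rels R M N) (x, y)"

text \<open>A ring \<open>S\<close> regarded as a module over \<open>R\<close> along a homomorphism \<open>h\<close> from \<open>R\<close> to \<open>S\<close>.\<close>

definition ring_as_module :: "('c, 'k) ring_scheme \<Rightarrow> ('a \<Rightarrow> 'c) \<Rightarrow> ('a, 'c) module" where
  "ring_as_module S h =
    \<lparr>carrier = carrier S, monoid.mult = monoid.mult S, one = \<one>\<^bsub>S\<^esub>, zero = \<zero>\<^bsub>S\<^esub>, add = add S,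
     smult = (\<lambda>r s. h r \<otimes>\<^bsub>S\<^esub> s)\<rparr>"


section \<open>Lie algebras\<close>

record ('a, 'b) lie_alg = "('a, 'b) module" +
  bracket :: "'b \<Rightarrow> 'b \<Rightarrow> 'b"

text \<open>Extension of scalars: \<open>s (x \<otimes> t) = x \<otimes> s t\<close> and \<open>[x \<otimes> s, y \<otimes> t] = [x, y] \<otimes> s t\<close>.\<close>

definition base_change ::
    "('a, 'm) ring_scheme \<Rightarrow> ('c, 'k) ring_scheme \<Rightarrow> ('a \<Rightarrow> 'c) \<Rightarrow> ('a, 'b, 'n) lie_alg_scheme \<Rightarrow>
     ('c, ('b \<times> 'c \<Rightarrow> 'a) set) lie_alg" where
  "base_change R S h M =
    (let S' = ring_as_module S h; T = tensor_module R M S'; tens = tensor R M S' in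
     \<lparr>carrier = carrier T,
      monoid.mult = undefined, one = undefined,
      zero = \<zero>\<^bsub>T\<^esub>,
      add = add T,
      smult = (\<lambda>s. pres_lift R T (\<lambda>(x, t). tens x (s \<otimes>\<^bsub>S\<^esub> t))),
      bracket = (\<lambda>\<xi> \<eta>. pres_lift R T
        (\<lambda>(x, s). pres_lift R T (\<lambda>(y, t). tens (bracket M x y) (s \<otimes>\<^bsub>S\<^esub> t)) \<eta>) \<xi>)\<rparr>)"

text \<open>The linear maps on the second and third exterior powers given by
  \<open>x \<and> y \<mapsto> [x, y]\<close> and \<open>x \<and> y \<and> z \<mapsto> [x, y] \<and> z + [y, z] \<and> x + [z, x] \<and> y\<close>.\<close>

definition bracket_map ::
    "('a, 'm) ring_scheme \<Rightarrow> ('a, 'b, 'n) lie_alg_scheme \<Rightarrow> ('b list \<Rightarrow> 'a) set \<Rightarrow> 'b" where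
  "bracket_map R M = pres_lift R M (\<lambda>xs. bracket M (xs ! 0) (xs ! 1))"

definition jacobi_map ::
    "('a, 'm) ring_scheme \<Rightarrow> ('a, 'b, 'n) lie_alg_scheme \<Rightarrow>
     ('b list \<Rightarrow> 'a) set \<Rightarrow> ('b list \<Rightarrow> 'a) set" where
  "jacobi_map R M = pres_lift R (ext_power R 2 M)
    (\<lambda>xs. wedge R M [bracket M (xs ! 0) (xs ! 1), xs ! 2] \<oplus>\<^bsub>ext_power R 2 M\<^esub>
          wedge R M [bracket M (xs ! 1) (xs ! 2), xs ! 0] \<oplus>\<^bsub>ext_power R 2 M\<^esub>
          wedge R M [bracket M (xs ! 2) (xs ! 0), xs ! 1])"

definition decomposables ::
    "('a, 'm) ring_scheme \<Rightarrow> ('a, 'b, 'n) module_scheme \<Rightarrow> ('b list \<Rightarrow> 'a) set set" where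
  "decomposables R M = {wedge R M [x, y] | x y. x \<in> carrier M \<and> y \<in> carrier M}"

definition SK1 ::
    "('a, 'm) ring_scheme \<Rightarrow> ('a, 'b, 'n) lie_alg_scheme \<Rightarrow> ('a, ('b list \<Rightarrow> 'a) set set) module"
  where
  "SK1 R M =
    (let W = ext_power R 2 M; K = a_kernel W M (bracket_map R M) in
     quot_module (W\<lparr>carrier := K\<rparr>)
       (jacobi_map R M ` carrier (ext_power R 3 M) <+>\<^bsub>W\<^esub> mspan R W (decomposables R M \<inter> K)))"

text \<open>The Lie algebra \<open>V \<oplus> W/L\<close>, where \<open>W\<close> is the exterior square of \<open>V\<close>, with bracket
  \<open>[v\<^sub>1 + w\<^sub>1, v\<^sub>2 + w\<^sub>2] = \<pi> (v\<^sub>1 \<and> v\<^sub>2)\<close> for the projection \<open>\<pi>\<close> from \<open>W\<close> to \<open>W/L\<close>.\<close>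

definition class2_lie_alg ::
    "('a, 'm) ring_scheme \<Rightarrow> ('a, 'b, 'n) module_scheme \<Rightarrow> ('b list \<Rightarrow> 'a) set set \<Rightarrow>
     ('a, 'b \<times> ('b list \<Rightarrow> 'a) set set) lie_alg" where
  "class2_lie_alg R V L =
    (let W = ext_power R 2 V; U = quot_module W L in
     \<lparr>carrier = carrier V \<times> carrier U,
      monoid.mult = undefined, one = undefined,
      zero = (\<zero>\<^bsub>V\<^esub>, \<zero>\<^bsub>U\<^esub>),
      add = (\<lambda>(v\<^sub>1, w\<^sub>1) (v\<^sub>2, w\<^sub>2). (v\<^sub>1 \<oplus>\<^bsub>V\<^esub> v\<^sub>2, w\<^sub>1 \<oplus>\<^bsub>U\<^esub> w\<^sub>2)),
      smult = (\<lambda>r (v, w). (r \<odot>\<^bsub>V\<^esub> v, r \<odot>\<^bsub>U\<^esub> w)),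
      bracket = (\<lambda>(v\<^sub>1, w\<^sub>1) (v\<^sub>2, w\<^sub>2). (\<zero>\<^bsub>V\<^esub>, L +>\<^bsub>W\<^esub> wedge R V [v\<^sub>1, v\<^sub>2]))\<rparr>)"

end

theory Submission
  imports Defs "HOL-Number_Theory.Cong"
begin

text \<open>Let \<open>M\<close> be the Lie algebra \<open>\<L>\<close> over \<open>R = \<int>\<^sub>p\<close>, let \<open>S = \<rat>\<^sub>p\<close>, and write \<open>SK\<^sub>1 = K/J\<close>, where \<open>K\<close> is the
kernel of the bracket map on the exterior square of \<open>M\<close> and \<open>J\<close> is spanned by the Jacobi
elements and by the wedges \<open>x \<and> y\<close> with \<open>[x, y] = 0\<close>. The theorem follows from two facts, linked
by the condition that \<open>K/J\<close> is a torsion module.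

First, \<open>SK\<^sub>1\<close> commutes with localization, hence \<open>SK\<^sub>1\<close> of \<open>M \<otimes> S\<close> vanishes if and only if \<open>K/J\<close> is
torsion (\<open>SK1_localized_trivial_iff\<close>). The reason is that every element of \<open>M \<otimes> S\<close> is of the
form \<open>x \<otimes> 1/r\<close> (\<open>simple_tensor\<close>), so that the bracket map, the Jacobi elements and the
decomposable wedges over \<open>S\<close> agree with those over \<open>R\<close> up to nonzero scalars. To transfer
equations back from \<open>S\<close> to \<open>R\<close> one has to know that the map from the exterior square of \<open>M\<close> to
that of \<open>M \<otimes> S\<close> kills only torsion (\<open>\<iota>_kernel\<close>). This is derived from the corresponding fact
about \<open>x \<mapsto> x \<otimes> 1\<close> (\<open>tens_one_eq_zero\<close>), applied to the exterior square.

Second, \<open>M\<close> and therefore its exterior square are finitely generated, and for submodules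
\<open>J\<close> and \<open>K\<close> of a finitely generated module over \<open>\<int>\<^sub>p\<close> the image of \<open>K\<close> in the quotient by \<open>J\<close> is finite
if and only if it is torsion (\<open>finite_quotient_iff_torsion\<close>). This rests on \<open>\<int>\<^sub>p\<close> being an
infinite domain whose quotients \<open>\<int>\<^sub>p/r\<close> with \<open>r \<noteq> 0\<close> are finite
(\<open>Zp_finite_residue_domain\<close>).\<close>

section \<open>Linear maps, submodules and spans\<close>

definition linear_map ::
    "('a, 'm) ring_scheme \<Rightarrow> ('a, 'b, 'n) module_scheme \<Rightarrow> ('a, 'c, 'k) module_scheme \<Rightarrow> ('b \<Rightarrow> 'c) \<Rightarrow> bool" where
  "linear_map R M N f \<longleftrightarrow> f \<in> carrier M \<rightarrow> carrier N \<and>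
     (\<forall>x\<in>carrier M. \<forall>y\<in>carrier M. f (x \<oplus>\<^bsub>M\<^esub> y) = f x \<oplus>\<^bsub>N\<^esub> f y) \<and>
     (\<forall>r\<in>carrier R. \<forall>x\<in>carrier M. f (r \<odot>\<^bsub>M\<^esub> x) = r \<odot>\<^bsub>N\<^esub> f x)"

lemma linear_mapI:
  assumes "\<And>x. x \<in> carrier M \<Longrightarrow> f x \<in> carrier N"
    and "\<And>x y. x \<in> carrier M \<Longrightarrow> y \<in> carrier M \<Longrightarrow> f (x \<oplus>\<^bsub>M\<^esub> y) = f x \<oplus>\<^bsub>N\<^esub> f y"
    and "\<And>r x. r \<in> carrier R \<Longrightarrow> x \<in> carrier M \<Longrightarrow> f (r \<odot>\<^bsub>M\<^esub> x) = r \<odot>\<^bsub>N\<^esub> f x"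
  shows "linear_map R M N f"
  using assms by (auto simp: linear_map_def)

lemma linear_mapD:
  assumes "linear_map R M N f"
  shows "x \<in> carrier M \<Longrightarrow> f x \<in> carrier N"
    and "x \<in> carrier M \<Longrightarrow> y \<in> carrier M \<Longrightarrow> f (x \<oplus>\<^bsub>M\<^esub> y) = f x \<oplus>\<^bsub>N\<^esub> f y"
    and "r \<in> carrier R \<Longrightarrow> x \<in> carrier M \<Longrightarrow> f (r \<odot>\<^bsub>M\<^esub> x) = r \<odot>\<^bsub>N\<^esub> f x"
  using assms by (auto simp: linear_map_def)

lemma linear_map_zero:
  assumes "module R M" "module R N" "linear_map R M N f"
  shows "f \<zero>\<^bsub>M\<^esub> = \<zero>\<^bsub>N\<^esub>"
proof -
  interpret M: module R M by fact
  interpret N: module R N by fact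
  have "f (\<zero>\<^bsub>R\<^esub> \<odot>\<^bsub>M\<^esub> \<zero>\<^bsub>M\<^esub>) = \<zero>\<^bsub>R\<^esub> \<odot>\<^bsub>N\<^esub> f \<zero>\<^bsub>M\<^esub>"
    by (rule linear_mapD(3)[OF assms(3)]) auto
  then show ?thesis using linear_mapD(1)[OF assms(3)] by simp
qed

lemma linear_map_minus:
  assumes "module R M" "module R N" "linear_map R M N f" "x \<in> carrier M" "y \<in> carrier M"
  shows "f (x \<ominus>\<^bsub>M\<^esub> y) = f x \<ominus>\<^bsub>N\<^esub> f y"
proof -
  interpret M: module R M by fact
  interpret N: module R N by fact
  have neg: "\<ominus>\<^bsub>M\<^esub> y = (\<ominus>\<^bsub>R\<^esub> \<one>\<^bsub>R\<^esub>) \<odot>\<^bsub>M\<^esub> y" using assms by (simp add: M.smult_l_minus)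
  have "f (\<ominus>\<^bsub>M\<^esub> y) = \<ominus>\<^bsub>N\<^esub> f y"
    unfolding neg using assms linear_mapD[OF assms(3)] by (simp add: N.smult_l_minus)
  then show ?thesis using assms linear_mapD[OF assms(3)] by (simp add: a_minus_def)
qed

lemma (in module) submoduleI':
  assumes "H \<subseteq> carrier M" "\<zero>\<^bsub>M\<^esub> \<in> H"
    and "\<And>x y. x \<in> H \<Longrightarrow> y \<in> H \<Longrightarrow> x \<oplus>\<^bsub>M\<^esub> y \<in> H"
    and "\<And>r x. r \<in> carrier R \<Longrightarrow> x \<in> H \<Longrightarrow> r \<odot>\<^bsub>M\<^esub> x \<in> H"
  shows "submodule H R M"
proof (rule submoduleI)
  fix a assume "a \<in> H"
  moreover have "\<ominus>\<^bsub>M\<^esub> a = (\<ominus>\<^bsub>R\<^esub> \<one>\<^bsub>R\<^esub>) \<odot>\<^bsub>M\<^esub> a"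
    using calculation assms(1) by (auto simp: smult_l_minus)
  ultimately show "\<ominus>\<^bsub>M\<^esub> a \<in> H" using assms(4) by simp
qed (use assms in auto)

lemma (in module) submoduleD:
  assumes "submodule H R M"
  shows "x \<in> H \<Longrightarrow> x \<in> carrier M" "\<zero>\<^bsub>M\<^esub> \<in> H"
    and "x \<in> H \<Longrightarrow> y \<in> H \<Longrightarrow> x \<oplus>\<^bsub>M\<^esub> y \<in> H"
    and "r \<in> carrier R \<Longrightarrow> x \<in> H \<Longrightarrow> r \<odot>\<^bsub>M\<^esub> x \<in> H"
    and "x \<in> H \<Longrightarrow> y \<in> H \<Longrightarrow> x \<ominus>\<^bsub>M\<^esub> y \<in> H"
  using submoduleE[OF assms] subgroup.one_closed[OF submodule.axioms(1)[OF assms]]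
  by (auto simp: a_minus_def)

lemma (in module) submodule_vimage:
  assumes "module R N" "linear_map R M N f" "submodule H R N"
  shows "submodule {x \<in> carrier M. f x \<in> H} R M"
proof -
  interpret N: module R N by fact
  show ?thesis
    by (rule submoduleI')
      (use N.submoduleD[OF assms(3)] linear_mapD[OF assms(2)] linear_map_zero[OF module_axioms assms(1,2)] in auto)
qed

lemma (in module) submodule_image:
  assumes "module R N" "linear_map R N M f"
  shows "submodule (f ` carrier N) R M"
proof -
  interpret N: module R N by fact
  note f = linear_mapD[OF assms(2)]
  show ?thesis
  proof (rule submoduleI')
    show "f ` carrier N \<subseteq> carrier M" using f by auto
    show "\<zero>\<^bsub>M\<^esub> \<in> f ` carrier N"
      using linear_map_zero[OF assms(1) module_axioms assms(2)] by (metis N.zero_closed imageI)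
    show "x \<oplus>\<^bsub>M\<^esub> y \<in> f ` carrier N" if "x \<in> f ` carrier N" "y \<in> f ` carrier N" for x y
      using that f(2) by (auto simp flip: f(2))
    show "r \<odot>\<^bsub>M\<^esub> x \<in> f ` carrier N" if "r \<in> carrier R" "x \<in> f ` carrier N" for r x
      using that by (auto simp flip: f(3))
  qed
qed

lemma (in module) mspan_submodule:
  assumes "S \<subseteq> carrier M"
  shows "submodule (mspan R M S) R M"
proof (rule submoduleI')
  show "mspan R M S \<subseteq> carrier M"
    using assms carrier_is_submodule by (auto simp: mspan_def)
qed (auto simp: mspan_def submoduleD)

lemma mspan_superset: "S \<subseteq> mspan R M S"
  by (auto simp: mspan_def)

lemma mspan_least: "submodule H R M \<Longrightarrow> S \<subseteq> H \<Longrightarrow> mspan R M S \<subseteq> H"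
  by (auto simp: mspan_def)

lemma (in module) submodule_set_add:
  assumes "submodule H R M" "submodule K R M"
  shows "submodule (H <+>\<^bsub>M\<^esub> K) R M"
proof -
  note H = submoduleD[OF assms(1)] and K = submoduleD[OF assms(2)]
  have iff: "z \<in> H <+>\<^bsub>M\<^esub> K \<longleftrightarrow> (\<exists>x\<in>H. \<exists>y\<in>K. z = x \<oplus>\<^bsub>M\<^esub> y)" for z
    by (auto simp: set_add_def')
  show ?thesis
  proof (rule submoduleI')
    show "H <+>\<^bsub>M\<^esub> K \<subseteq> carrier M" using H(1) K(1) by (auto simp: iff)
    show "\<zero>\<^bsub>M\<^esub> \<in> H <+>\<^bsub>M\<^esub> K" unfolding iff using H(2) K(2) by force
    fix x y assume "x \<in> H <+>\<^bsub>M\<^esub> K" "y \<in> H <+>\<^bsub>M\<^esub> K"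
    then obtain a b c d where *: "a \<in> H" "b \<in> K" "c \<in> H" "d \<in> K" "x = a \<oplus>\<^bsub>M\<^esub> b" "y = c \<oplus>\<^bsub>M\<^esub> d"
      unfolding iff by blast
    then have "x \<oplus>\<^bsub>M\<^esub> y = (a \<oplus>\<^bsub>M\<^esub> c) \<oplus>\<^bsub>M\<^esub> (b \<oplus>\<^bsub>M\<^esub> d)" using H(1) K(1) by (simp add: M.add.m_ac)
    then show "x \<oplus>\<^bsub>M\<^esub> y \<in> H <+>\<^bsub>M\<^esub> K" unfolding iff using * H(3) K(3) by blast
  next
    fix r x assume r: "r \<in> carrier R" "x \<in> H <+>\<^bsub>M\<^esub> K"
    then obtain a b where *: "a \<in> H" "b \<in> K" "x = a \<oplus>\<^bsub>M\<^esub> b" unfolding iff by blast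
    then have "r \<odot>\<^bsub>M\<^esub> x = r \<odot>\<^bsub>M\<^esub> a \<oplus>\<^bsub>M\<^esub> r \<odot>\<^bsub>M\<^esub> b" using H(1) K(1) r by (simp add: smult_r_distr)
    then show "r \<odot>\<^bsub>M\<^esub> x \<in> H <+>\<^bsub>M\<^esub> K" unfolding iff using * r H(4) K(4) by blast
  qed
qed

lemma (in module) set_add_superset:
  assumes "submodule H R M" "submodule K R M"
  shows "H \<subseteq> H <+>\<^bsub>M\<^esub> K" "K \<subseteq> H <+>\<^bsub>M\<^esub> K"
proof -
  note H = submoduleD[OF assms(1)] and K = submoduleD[OF assms(2)]
  have "x \<in> H <+>\<^bsub>M\<^esub> K" if "x \<in> H" for x
    using that H(1)[OF that] K(2) unfolding set_add_def' by force
  then show "H \<subseteq> H <+>\<^bsub>M\<^esub> K" by blast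
  have "x \<in> H <+>\<^bsub>M\<^esub> K" if "x \<in> K" for x
    using that K(1)[OF that] H(2) unfolding set_add_def' by force
  then show "K \<subseteq> H <+>\<^bsub>M\<^esub> K" by blast
qed

lemma (in module) set_add_least:
  assumes "submodule H R M" "A \<subseteq> H" "B \<subseteq> H"
  shows "A <+>\<^bsub>M\<^esub> B \<subseteq> H"
  using submoduleD(3)[OF assms(1)] assms(2,3) by (auto simp: set_add_def')


section \<open>Quotients and presentations\<close>

text \<open>Cosets of a submodule behave like elements of the quotient once equality of cosets is
reduced to membership of a difference; all facts about \<open>quot_module\<close> go through this.\<close>

lemma (in module) coset_eq_iff:
  assumes "submodule N R M" "x \<in> carrier M" "y \<in> carrier M"
  shows "N +>\<^bsub>M\<^esub> x = N +>\<^bsub>M\<^esub> y \<longleftrightarrow> x \<ominus>\<^bsub>M\<^esub> y \<in> N"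
proof
  note N = submoduleD[OF assms(1)]
  assume "N +>\<^bsub>M\<^esub> x = N +>\<^bsub>M\<^esub> y"
  moreover have "x \<in> N +>\<^bsub>M\<^esub> x" using N(2) assms by (auto simp: a_r_coset_def' intro!: bexI[of _ "\<zero>\<^bsub>M\<^esub>"])
  ultimately obtain n where "n \<in> N" "x = n \<oplus>\<^bsub>M\<^esub> y" by (auto simp: a_r_coset_def')
  then show "x \<ominus>\<^bsub>M\<^esub> y \<in> N" using N(1) assms by (simp add: a_minus_def M.add.m_assoc M.r_neg)
next
  note N = submoduleD[OF assms(1)]
  have *: "N +>\<^bsub>M\<^esub> a \<subseteq> N +>\<^bsub>M\<^esub> b" if ab: "a \<ominus>\<^bsub>M\<^esub> b \<in> N" "a \<in> carrier M" "b \<in> carrier M" for a b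
  proof
    fix z assume "z \<in> N +>\<^bsub>M\<^esub> a"
    then obtain n where n: "n \<in> N" "z = n \<oplus>\<^bsub>M\<^esub> a" by (auto simp: a_r_coset_def')
    then have "z = (n \<oplus>\<^bsub>M\<^esub> (a \<ominus>\<^bsub>M\<^esub> b)) \<oplus>\<^bsub>M\<^esub> b" using ab N(1) by (simp add: a_minus_def M.add.m_assoc M.l_neg)
    moreover have "n \<oplus>\<^bsub>M\<^esub> (a \<ominus>\<^bsub>M\<^esub> b) \<in> N" using n ab N(3) by blast
    ultimately show "z \<in> N +>\<^bsub>M\<^esub> b" by (auto simp: a_r_coset_def')
  qed
  assume xy: "x \<ominus>\<^bsub>M\<^esub> y \<in> N"
  have "y \<ominus>\<^bsub>M\<^esub> x = \<ominus>\<^bsub>M\<^esub> (x \<ominus>\<^bsub>M\<^esub> y)" using assms by (simp add: a_minus_def M.minus_add M.add.m_comm)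
  then have "y \<ominus>\<^bsub>M\<^esub> x \<in> N" using submoduleE(3)[OF assms(1) xy] by simp
  with xy * assms show "N +>\<^bsub>M\<^esub> x = N +>\<^bsub>M\<^esub> y" by blast
qed

lemma quot_module_carrier: "carrier (quot_module M N) = (\<lambda>x. N +>\<^bsub>M\<^esub> x) ` carrier M"
  by (auto simp: quot_module_def A_RCOSETS_def' image_def)

lemma (in module) quot_ops:
  assumes N: "submodule N R M" and x: "x \<in> carrier M"
  shows "y \<in> carrier M \<Longrightarrow> (N +>\<^bsub>M\<^esub> x) \<oplus>\<^bsub>quot_module M N\<^esub> (N +>\<^bsub>M\<^esub> y) = N +>\<^bsub>M\<^esub> (x \<oplus>\<^bsub>M\<^esub> y)"
    and "r \<in> carrier R \<Longrightarrow> r \<odot>\<^bsub>quot_module M N\<^esub> (N +>\<^bsub>M\<^esub> x) = N +>\<^bsub>M\<^esub> (r \<odot>\<^bsub>M\<^esub> x)"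
    and "\<zero>\<^bsub>quot_module M N\<^esub> = N +>\<^bsub>M\<^esub> \<zero>\<^bsub>M\<^esub>"
proof -
  note ND = submoduleD[OF N]
  have sub: "abelian_subgroup N M"
    by (rule abelian_subgroupI3)
      (use submodule.axioms(1)[OF N] M.abelian_group_axioms in \<open>auto intro: additive_subgroup.intro\<close>)
  show "(N +>\<^bsub>M\<^esub> x) \<oplus>\<^bsub>quot_module M N\<^esub> (N +>\<^bsub>M\<^esub> y) = N +>\<^bsub>M\<^esub> (x \<oplus>\<^bsub>M\<^esub> y)" if "y \<in> carrier M"
    using abelian_subgroup.a_rcos_sum[OF sub x that] by (simp add: quot_module_def)
  show "\<zero>\<^bsub>quot_module M N\<^esub> = N +>\<^bsub>M\<^esub> \<zero>\<^bsub>M\<^esub>"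
    using ND(1) by (auto simp: quot_module_def subset_eq)
  show "r \<odot>\<^bsub>quot_module M N\<^esub> (N +>\<^bsub>M\<^esub> x) = N +>\<^bsub>M\<^esub> (r \<odot>\<^bsub>M\<^esub> x)" if r: "r \<in> carrier R"
  proof -
    have "N +>\<^bsub>M\<^esub> (r \<odot>\<^bsub>M\<^esub> z) = N +>\<^bsub>M\<^esub> (r \<odot>\<^bsub>M\<^esub> x)" if z: "z \<in> N +>\<^bsub>M\<^esub> x" for z
    proof -
      obtain n where n: "n \<in> N" "z = n \<oplus>\<^bsub>M\<^esub> x" using z by (auto simp: a_r_coset_def')
      then have "r \<odot>\<^bsub>M\<^esub> z \<ominus>\<^bsub>M\<^esub> r \<odot>\<^bsub>M\<^esub> x = r \<odot>\<^bsub>M\<^esub> n"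
        using r x ND(1) by (simp add: smult_r_distr a_minus_def M.add.m_assoc M.r_neg)
      then have "r \<odot>\<^bsub>M\<^esub> z \<ominus>\<^bsub>M\<^esub> r \<odot>\<^bsub>M\<^esub> x \<in> N" using ND(4) r n by simp
      then show ?thesis using coset_eq_iff[OF N] r x n ND(1) by simp
    qed
    moreover have "x \<in> N +>\<^bsub>M\<^esub> x" using ND(2) x by (auto simp: a_r_coset_def' intro!: bexI[of _ "\<zero>\<^bsub>M\<^esub>"])
    ultimately have "(\<Union>z\<in>N +>\<^bsub>M\<^esub> x. N +>\<^bsub>M\<^esub> (r \<odot>\<^bsub>M\<^esub> z)) = N +>\<^bsub>M\<^esub> (r \<odot>\<^bsub>M\<^esub> x)" by blast
    then show ?thesis by (simp add: quot_module_def)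
  qed
qed

lemma (in module) quot_module_module:
  assumes N: "submodule N R M"
  shows "module R (quot_module M N)"
proof -
  note ops = quot_ops[OF N] and car = quot_module_carrier[of M N]
  have ops': "x \<in> carrier M \<Longrightarrow> y \<in> carrier M \<Longrightarrow>
      (N +>\<^bsub>M\<^esub> x) \<oplus>\<^bsub>quot_module M N\<^esub> (N +>\<^bsub>M\<^esub> y) = N +>\<^bsub>M\<^esub> (x \<oplus>\<^bsub>M\<^esub> y)"
    "x \<in> carrier M \<Longrightarrow> r \<in> carrier R \<Longrightarrow> r \<odot>\<^bsub>quot_module M N\<^esub> (N +>\<^bsub>M\<^esub> x) = N +>\<^bsub>M\<^esub> (r \<odot>\<^bsub>M\<^esub> x)"
    "\<zero>\<^bsub>quot_module M N\<^esub> = N +>\<^bsub>M\<^esub> \<zero>\<^bsub>M\<^esub>" for x y r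
    using ops ops(3)[OF M.zero_closed] by auto
  show ?thesis
  proof (rule moduleI)
    show "abelian_group (quot_module M N)"
    proof (rule abelian_groupI)
      fix X assume "X \<in> carrier (quot_module M N)"
      then obtain x where "x \<in> carrier M" "X = N +>\<^bsub>M\<^esub> x" by (auto simp: car)
      then show "\<exists>Y\<in>carrier (quot_module M N). Y \<oplus>\<^bsub>quot_module M N\<^esub> X = \<zero>\<^bsub>quot_module M N\<^esub>"
        by (auto simp: car ops' M.l_neg intro!: bexI[of _ "\<ominus>\<^bsub>M\<^esub> x"])
    qed (auto simp: car ops' M.a_ac)
  qed (auto simp: car ops' R.is_cring smult_l_distr smult_r_distr smult_assoc1)
qed

lemma (in module) quot_map_linear:
  assumes N: "submodule N R M"
  shows "linear_map R M (quot_module M N) (\<lambda>x. N +>\<^bsub>M\<^esub> x)"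
  by (rule linear_mapI) (auto simp: quot_module_carrier quot_ops[OF N])

lemma (in module) quot_map_eq_zero_iff:
  assumes N: "submodule N R M" and x: "x \<in> carrier M"
  shows "N +>\<^bsub>M\<^esub> x = \<zero>\<^bsub>quot_module M N\<^esub> \<longleftrightarrow> x \<in> N"
proof -
  have "\<ominus>\<^bsub>M\<^esub> \<zero>\<^bsub>M\<^esub> = \<zero>\<^bsub>M\<^esub>" by (rule M.minus_equality) auto
  then have "x \<ominus>\<^bsub>M\<^esub> \<zero>\<^bsub>M\<^esub> = x" unfolding a_minus_def using M.r_zero[OF x] by metis
  then show ?thesis using coset_eq_iff[OF N x M.zero_closed] unfolding quot_ops(3)[OF N x] by metis
qed

text \<open>The linear extension of \<open>\<phi>\<close> from the basis to the free module, written with the same sum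
as in \<open>pres_lift\<close>, so that \<open>pres_lift\<close> is the map that it induces on a presented module.\<close>

definition evaluation ::
    "('a, 'm) ring_scheme \<Rightarrow> ('a, 'b, 'n) module_scheme \<Rightarrow> ('x \<Rightarrow> 'b) \<Rightarrow> ('x \<Rightarrow> 'a) \<Rightarrow> 'b" where
  "evaluation R N \<phi> f = (\<Oplus>\<^bsub>N\<^esub>x\<in>{x. f x \<noteq> \<zero>\<^bsub>R\<^esub>}. f x \<odot>\<^bsub>N\<^esub> \<phi> x)"

lemma (in cring) free_module_module: "module R (free_module R X)" (is "module R ?F")
proof -
  have car: "f \<in> carrier ?F \<longleftrightarrow> (\<forall>x. f x \<in> carrier R) \<and> (\<forall>x. x \<notin> X \<longrightarrow> f x = \<zero>) \<and> finite {x. f x \<noteq> \<zero>}" for f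
    by (auto simp: free_module_def Pi_iff)
  have ops: "f \<oplus>\<^bsub>?F\<^esub> g = (\<lambda>x. f x \<oplus> g x)" "r \<odot>\<^bsub>?F\<^esub> f = (\<lambda>x. r \<otimes> f x)" "\<zero>\<^bsub>?F\<^esub> = (\<lambda>x. \<zero>)" for f g r
    by (simp_all add: free_module_def)
  have fin: "finite {x. f x \<oplus> g x \<noteq> \<zero>}" if "finite {x. f x \<noteq> \<zero>}" "finite {x. g x \<noteq> \<zero>}"
    for f g :: "_ \<Rightarrow> 'a"
    by (rule finite_subset[OF _ finite_UnI[OF that]]) auto
  have fin': "finite {x. a (f x) \<noteq> \<zero>}" if "finite {x. f x \<noteq> \<zero>}" "a \<zero> = \<zero>" for a and f :: "_ \<Rightarrow> 'a"
    by (rule finite_subset[OF _ that(1)]) (use that(2) in auto)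
  have "abelian_group ?F"
  proof (rule abelian_groupI)
    fix f assume f: "f \<in> carrier ?F"
    have "finite {x. \<ominus> f x \<noteq> \<zero>}" by (rule fin') (use f car in auto)
    then show "\<exists>g\<in>carrier ?F. g \<oplus>\<^bsub>?F\<^esub> f = \<zero>\<^bsub>?F\<^esub>"
      using f by (intro bexI[of _ "\<lambda>x. \<ominus> f x"]) (auto simp: car ops l_neg)
  qed (auto simp: car ops fin a_ac)
  moreover have "finite {x. r \<otimes> f x \<noteq> \<zero>}" if "r \<in> carrier R" "f \<in> carrier ?F" for r f
    by (rule fin') (use that car in auto)
  ultimately show ?thesis
    by (intro moduleI is_cring) (auto simp: car ops l_distr r_distr m_assoc)
qed

lemma (in cring) free_gen_closed: "x \<in> X \<Longrightarrow> free_gen R x \<in> carrier (free_module R X)"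
proof -
  have "finite {y. free_gen R x y \<noteq> \<zero>}" by (rule finite_subset[of _ "{x}"]) (auto simp: free_gen_def)
  then show "x \<in> X \<Longrightarrow> free_gen R x \<in> carrier (free_module R X)"
    by (auto simp: free_module_def free_gen_def)
qed

lemma (in module) evaluation_eq_sum:
  assumes "f \<in> carrier (free_module R X)" "\<phi> \<in> X \<rightarrow> carrier M" "finite A" "A \<subseteq> X" "{x. f x \<noteq> \<zero>\<^bsub>R\<^esub>} \<subseteq> A"
  shows "evaluation R M \<phi> f = (\<Oplus>\<^bsub>M\<^esub>x\<in>A. f x \<odot>\<^bsub>M\<^esub> \<phi> x)"
  unfolding evaluation_def
  by (rule M.add.finprod_mono_neutral_cong_left) (use assms in \<open>auto simp: free_module_def Pi_def\<close>)

lemma (in module) evaluation_linear: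
  assumes \<phi>: "\<phi> \<in> X \<rightarrow> carrier M"
  shows "linear_map R (free_module R X) M (evaluation R M \<phi>)"
proof (rule linear_mapI)
  let ?F = "free_module R X"
  have car: "{x. f x \<noteq> \<zero>\<^bsub>R\<^esub>} \<subseteq> X" "finite {x. f x \<noteq> \<zero>\<^bsub>R\<^esub>}" "x \<in> X \<Longrightarrow> f x \<in> carrier R" if "f \<in> carrier ?F" for f x
    using that by (auto simp: free_module_def)
  interpret F: module R ?F by (rule R.free_module_module)
  fix f assume f: "f \<in> carrier ?F"
  show "evaluation R M \<phi> f \<in> carrier M"
    unfolding evaluation_def by (rule M.finsum_closed) (use f \<phi> in \<open>auto simp: free_module_def Pi_def\<close>)
  {
    fix g assume g: "g \<in> carrier ?F"
    let ?A = "{x. f x \<noteq> \<zero>\<^bsub>R\<^esub>} \<union> {x. g x \<noteq> \<zero>\<^bsub>R\<^esub>}"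
    have A: "finite ?A" "?A \<subseteq> X" using car[OF f] car[OF g] by auto
    have "{x. (f \<oplus>\<^bsub>?F\<^esub> g) x \<noteq> \<zero>\<^bsub>R\<^esub>} \<subseteq> ?A" by (auto simp: free_module_def)
    then have "evaluation R M \<phi> (f \<oplus>\<^bsub>?F\<^esub> g) = (\<Oplus>\<^bsub>M\<^esub>x\<in>?A. (f \<oplus>\<^bsub>?F\<^esub> g) x \<odot>\<^bsub>M\<^esub> \<phi> x)"
      using evaluation_eq_sum[OF _ \<phi> A] f g by simp
    also have "\<dots> = (\<Oplus>\<^bsub>M\<^esub>x\<in>?A. f x \<odot>\<^bsub>M\<^esub> \<phi> x \<oplus>\<^bsub>M\<^esub> g x \<odot>\<^bsub>M\<^esub> \<phi> x)"
    proof (rule M.add.finprod_cong')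
      fix x assume "x \<in> ?A"
      then have "x \<in> X" using A(2) by auto
      then show "(f \<oplus>\<^bsub>?F\<^esub> g) x \<odot>\<^bsub>M\<^esub> \<phi> x = f x \<odot>\<^bsub>M\<^esub> \<phi> x \<oplus>\<^bsub>M\<^esub> g x \<odot>\<^bsub>M\<^esub> \<phi> x"
        using car(3)[OF f] car(3)[OF g] \<phi> by (auto simp: free_module_def smult_l_distr Pi_iff)
    qed (use A(2) car[OF f] car[OF g] \<phi> in \<open>auto simp: Pi_def subset_eq\<close>)
    also have "\<dots> = (\<Oplus>\<^bsub>M\<^esub>x\<in>?A. f x \<odot>\<^bsub>M\<^esub> \<phi> x) \<oplus>\<^bsub>M\<^esub> (\<Oplus>\<^bsub>M\<^esub>x\<in>?A. g x \<odot>\<^bsub>M\<^esub> \<phi> x)"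
      by (rule M.finsum_addf) (use A(2) car[OF f] car[OF g] \<phi> in \<open>auto simp: Pi_def subset_eq\<close>)
    also have "\<dots> = evaluation R M \<phi> f \<oplus>\<^bsub>M\<^esub> evaluation R M \<phi> g"
      using evaluation_eq_sum[OF f \<phi> A] evaluation_eq_sum[OF g \<phi> A] by auto
    finally show "evaluation R M \<phi> (f \<oplus>\<^bsub>?F\<^esub> g) = evaluation R M \<phi> f \<oplus>\<^bsub>M\<^esub> evaluation R M \<phi> g" .
  }
  fix r assume r: "r \<in> carrier R"
  let ?A = "{x. f x \<noteq> \<zero>\<^bsub>R\<^esub>}"
  have "{x. (r \<odot>\<^bsub>?F\<^esub> f) x \<noteq> \<zero>\<^bsub>R\<^esub>} \<subseteq> ?A" using r by (auto simp: free_module_def)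
  then have "evaluation R M \<phi> (r \<odot>\<^bsub>?F\<^esub> f) = (\<Oplus>\<^bsub>M\<^esub>x\<in>?A. (r \<odot>\<^bsub>?F\<^esub> f) x \<odot>\<^bsub>M\<^esub> \<phi> x)"
    using evaluation_eq_sum[OF _ \<phi>] f r car[OF f] by simp
  also have "\<dots> = (\<Oplus>\<^bsub>M\<^esub>x\<in>?A. r \<odot>\<^bsub>M\<^esub> (f x \<odot>\<^bsub>M\<^esub> \<phi> x))"
  proof (rule M.add.finprod_cong')
    fix x assume "x \<in> ?A"
    then have "x \<in> X" using car(1)[OF f] by auto
    then show "(r \<odot>\<^bsub>?F\<^esub> f) x \<odot>\<^bsub>M\<^esub> \<phi> x = r \<odot>\<^bsub>M\<^esub> (f x \<odot>\<^bsub>M\<^esub> \<phi> x)"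
      using car(3)[OF f] \<phi> r by (auto simp: free_module_def smult_assoc1 Pi_iff)
  qed (use car[OF f] \<phi> r in \<open>auto simp: Pi_def subset_eq\<close>)
  also have "\<dots> = r \<odot>\<^bsub>M\<^esub> evaluation R M \<phi> f"
    unfolding evaluation_def
    by (rule finsum_smult_ldistr[symmetric]) (use car[OF f] \<phi> r in \<open>auto simp: Pi_def subset_eq\<close>)
  finally show "evaluation R M \<phi> (r \<odot>\<^bsub>?F\<^esub> f) = r \<odot>\<^bsub>M\<^esub> evaluation R M \<phi> f" .
qed

lemma (in module) evaluation_free_gen:
  assumes "\<phi> \<in> X \<rightarrow> carrier M" "x \<in> X"
  shows "evaluation R M \<phi> (free_gen R x) = \<phi> x"
proof -
  have "evaluation R M \<phi> (free_gen R x) = (\<Oplus>\<^bsub>M\<^esub>y\<in>{x}. free_gen R x y \<odot>\<^bsub>M\<^esub> \<phi> y)"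
    by (rule evaluation_eq_sum[OF R.free_gen_closed assms(1)]) (use assms in \<open>auto simp: free_gen_def\<close>)
  also have "\<dots> = \<phi> x" using assms by (simp add: M.finsum_insert free_gen_def Pi_iff)
  finally show ?thesis .
qed

text \<open>Subtracting \<open>f a\<close> times the generator at \<open>a\<close> removes \<open>a\<close> from the support of \<open>f\<close>, so
induction over a finite set containing the support reaches every element.\<close>

lemma (in cring) free_module_generated:
  assumes H: "submodule H R (free_module R X)" and gen: "\<And>x. x \<in> X \<Longrightarrow> free_gen R x \<in> H"
  shows "H = carrier (free_module R X)"
proof
  let ?F = "free_module R X"
  interpret F: module R ?F by (rule free_module_module)
  note HD = F.submoduleD[OF H]
  show "H \<subseteq> carrier ?F" using HD by auto
  have "f \<in> H" if "finite A" "f \<in> carrier ?F" "{x. f x \<noteq> \<zero>} \<subseteq> A" for A f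
    using that
  proof (induction A arbitrary: f rule: finite_induct)
    case empty
    then have "f = \<zero>\<^bsub>?F\<^esub>" by (auto simp: free_module_def)
    then show ?case using HD(2) by simp
  next
    case (insert a A)
    show ?case
    proof (cases "a \<in> X")
      case True
      then have fa: "f a \<in> carrier R" using insert.prems by (auto simp: free_module_def)
      have fx: "f x \<in> carrier R" for x using insert.prems by (cases "x \<in> X") (auto simp: free_module_def)
      define g where "g = f \<ominus>\<^bsub>?F\<^esub> f a \<odot>\<^bsub>?F\<^esub> free_gen R a"
      have gc: "g \<in> carrier ?F" unfolding g_def using insert.prems fa free_gen_closed[OF True] by auto
      have fg: "f = g \<oplus>\<^bsub>?F\<^esub> f a \<odot>\<^bsub>?F\<^esub> free_gen R a"
        unfolding g_def using insert.prems fa free_gen_closed[OF True]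
        by (simp add: a_minus_def F.M.add.m_assoc F.M.l_neg)
      have "f x = g x \<oplus> f a \<otimes> free_gen R a x" for x
        using arg_cong[OF fg, of "\<lambda>h. h x"] by (simp add: free_module_def)
      note fgx = this
      have gx: "g x \<in> carrier R" for x using gc by (cases "x \<in> X") (auto simp: free_module_def)
      have "g a = \<zero>" using fgx[of a] fa gx[of a] by (simp add: free_gen_def)
      moreover have "g x = f x" if "x \<noteq> a" for x
        using fgx[of x] fa gx[of x] \<open>x \<noteq> a\<close> by (simp add: free_gen_def)
      ultimately have "{x. g x \<noteq> \<zero>} \<subseteq> A" using insert.prems(2) by force
      then have "g \<in> H" using insert.IH gc by blast
      then show ?thesis using fg HD(3,4) gen[OF True] fa by metis
    next
      case False
      then have "{x. f x \<noteq> \<zero>} \<subseteq> A" using insert.prems by (auto simp: free_module_def)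
      then show ?thesis using insert.IH insert.prems by blast
    qed
  qed
  then show "carrier ?F \<subseteq> H" by (auto simp: free_module_def)
qed

text \<open>The universal property of a module given by generators and relations. It is proved once and
used for tensor products and for exterior powers.\<close>

locale presentation = cring R for R (structure) +
  fixes X :: "'x set" and E :: "('x \<Rightarrow> 'a) set"
  assumes E: "E \<subseteq> carrier (free_module R X)"
begin

abbreviation "F \<equiv> free_module R X"
abbreviation "P \<equiv> pres_module R X E"
abbreviation "q \<equiv> (\<lambda>f. mspan R F E +>\<^bsub>F\<^esub> f)"

sublocale F: module R F by (rule free_module_module)

lemma span_submodule: "submodule (mspan R F E) R F"
  by (rule F.mspan_submodule[OF E])

lemma pres_module_module: "module R P"
  unfolding pres_module_def by (rule F.quot_module_module[OF span_submodule])

lemma pres_map_linear: "linear_map R F P q"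
  unfolding pres_module_def by (rule F.quot_map_linear[OF span_submodule])

lemma pres_carrier: "carrier P = q ` carrier F"
  by (simp add: pres_module_def quot_module_carrier)

lemma pres_map_relation: "e \<in> E \<Longrightarrow> q e = \<zero>\<^bsub>P\<^esub>"
  unfolding pres_module_def
  using F.quot_map_eq_zero_iff[OF span_submodule] E mspan_superset[of E R F] by blast

lemma pres_generated:
  assumes H: "submodule H R P" and "\<And>x. x \<in> X \<Longrightarrow> pres_gen R X E x \<in> H"
  shows "H = carrier P"
proof
  show "H \<subseteq> carrier P" using module.submoduleD(1)[OF pres_module_module H] by auto
  have "submodule {f \<in> carrier F. q f \<in> H} R F"
    by (rule F.submodule_vimage[OF pres_module_module pres_map_linear H])
  then have "{f \<in> carrier F. q f \<in> H} = carrier F"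
    by (rule free_module_generated) (use assms(2) free_gen_closed in \<open>simp add: pres_gen_def\<close>)
  then show "carrier P \<subseteq> H" by (auto simp: pres_carrier)
qed

lemma
  assumes N: "module R N" and \<phi>: "\<phi> \<in> X \<rightarrow> carrier N"
    and rel: "\<And>e. e \<in> E \<Longrightarrow> evaluation R N \<phi> e = \<zero>\<^bsub>N\<^esub>"
  shows pres_lift_linear: "linear_map R P N (pres_lift R N \<phi>)"
    and pres_lift_gen: "x \<in> X \<Longrightarrow> pres_lift R N \<phi> (pres_gen R X E x) = \<phi> x"
proof -
  interpret N: module R N by fact
  let ?ev = "evaluation R N \<phi>"
  have ev: "linear_map R F N ?ev" by (rule N.evaluation_linear[OF \<phi>])
  note evD = linear_mapD[OF ev]
  have sub: "submodule {f \<in> carrier F. ?ev f \<in> {\<zero>\<^bsub>N\<^esub>}} R F"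
    by (rule F.submodule_vimage[OF N ev]) (auto intro!: N.submoduleI')
  have "mspan R F E \<subseteq> {f \<in> carrier F. ?ev f \<in> {\<zero>\<^bsub>N\<^esub>}}"
    by (rule mspan_least[OF sub]) (use E rel in auto)
  then have ker: "?ev f = \<zero>\<^bsub>N\<^esub>" "f \<in> carrier F" if "f \<in> mspan R F E" for f using that by auto
  have val: "pres_lift R N \<phi> (q f) = ?ev f" if f: "f \<in> carrier F" for f
  proof -
    have "?ev g = ?ev f" if g: "g \<in> q f" for g
    proof -
      obtain h where h: "h \<in> mspan R F E" "g = h \<oplus>\<^bsub>F\<^esub> f" using g by (auto simp: a_r_coset_def')
      then show ?thesis using evD f ker by auto
    qed
    moreover have "f \<in> q f"
      using f F.submoduleD(2)[OF span_submodule] by (auto simp: a_r_coset_def' intro!: bexI[of _ "\<zero>\<^bsub>F\<^esub>"])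
    ultimately show ?thesis unfolding pres_lift_def evaluation_def[symmetric] by blast
  qed
  note qD = linear_mapD[OF pres_map_linear]
  show "linear_map R P N (pres_lift R N \<phi>)"
    by (rule linear_mapI) (auto simp: pres_carrier val evD simp flip: qD(2,3))
  show "pres_lift R N \<phi> (pres_gen R X E x) = \<phi> x" if "x \<in> X"
    using that by (simp add: pres_gen_def val free_gen_closed N.evaluation_free_gen[OF \<phi>])
qed

end

lemma (in module) diff_eq_zero_iff:
  "x \<in> carrier M \<Longrightarrow> y \<in> carrier M \<Longrightarrow> x \<ominus>\<^bsub>M\<^esub> y = \<zero>\<^bsub>M\<^esub> \<longleftrightarrow> x = y"
  by (metis M.add.inv_closed M.minus_eq M.minus_equality M.minus_minus M.r_neg)


section \<open>Bilinear maps and tensor products\<close>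

definition bilinear_map ::
    "('a, 'm) ring_scheme \<Rightarrow> ('a, 'b, 'n) module_scheme \<Rightarrow> ('a, 'c, 'k) module_scheme \<Rightarrow>
     ('a, 'd, 'l) module_scheme \<Rightarrow> ('b \<Rightarrow> 'c \<Rightarrow> 'd) \<Rightarrow> bool" where
  "bilinear_map R M N P b \<longleftrightarrow>
     (\<forall>y\<in>carrier N. linear_map R M P (\<lambda>x. b x y)) \<and> (\<forall>x\<in>carrier M. linear_map R N P (b x))"

lemma bilinear_mapD:
  assumes "bilinear_map R M N P b" "x \<in> carrier M" "y \<in> carrier N"
  shows "b x y \<in> carrier P"
    and "x' \<in> carrier M \<Longrightarrow> b (x \<oplus>\<^bsub>M\<^esub> x') y = b x y \<oplus>\<^bsub>P\<^esub> b x' y"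
    and "y' \<in> carrier N \<Longrightarrow> b x (y \<oplus>\<^bsub>N\<^esub> y') = b x y \<oplus>\<^bsub>P\<^esub> b x y'"
    and "r \<in> carrier R \<Longrightarrow> b (r \<odot>\<^bsub>M\<^esub> x) y = r \<odot>\<^bsub>P\<^esub> b x y"
    and "r \<in> carrier R \<Longrightarrow> b x (r \<odot>\<^bsub>N\<^esub> y) = r \<odot>\<^bsub>P\<^esub> b x y"
  using assms by (auto simp: bilinear_map_def linear_map_def)

lemma bilinear_mapI:
  assumes "\<And>x y. x \<in> carrier M \<Longrightarrow> y \<in> carrier N \<Longrightarrow> b x y \<in> carrier P"
    and "\<And>x x' y. x \<in> carrier M \<Longrightarrow> x' \<in> carrier M \<Longrightarrow> y \<in> carrier N \<Longrightarrow> b (x \<oplus>\<^bsub>M\<^esub> x') y = b x y \<oplus>\<^bsub>P\<^esub> b x' y"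
    and "\<And>x y y'. x \<in> carrier M \<Longrightarrow> y \<in> carrier N \<Longrightarrow> y' \<in> carrier N \<Longrightarrow> b x (y \<oplus>\<^bsub>N\<^esub> y') = b x y \<oplus>\<^bsub>P\<^esub> b x y'"
    and "\<And>r x y. r \<in> carrier R \<Longrightarrow> x \<in> carrier M \<Longrightarrow> y \<in> carrier N \<Longrightarrow> b (r \<odot>\<^bsub>M\<^esub> x) y = r \<odot>\<^bsub>P\<^esub> b x y"
    and "\<And>r x y. r \<in> carrier R \<Longrightarrow> x \<in> carrier M \<Longrightarrow> y \<in> carrier N \<Longrightarrow> b x (r \<odot>\<^bsub>N\<^esub> y) = r \<odot>\<^bsub>P\<^esub> b x y"
  shows "bilinear_map R M N P b"
  using assms by (auto simp: bilinear_map_def linear_map_def)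

text \<open>A defining relation of a presentation has the form \<open>a - (b + c)\<close> or \<open>a - r b\<close>; a linear map
kills it exactly if the values satisfy the corresponding additivity or homogeneity law. The
next two lemmas translate between the two, in both directions.\<close>

lemma linear_map_relation_add:
  assumes "module R F" "module R N" "linear_map R F N f"
    and "a \<in> carrier F" "b \<in> carrier F" "c \<in> carrier F"
  shows "f (a \<ominus>\<^bsub>F\<^esub> (b \<oplus>\<^bsub>F\<^esub> c)) = \<zero>\<^bsub>N\<^esub> \<longleftrightarrow> f a = f b \<oplus>\<^bsub>N\<^esub> f c"
proof -
  interpret F: module R F by fact
  interpret N: module R N by fact
  show ?thesis
    using assms(4-6) linear_mapD[OF assms(3)]
    by (simp add: linear_map_minus[OF assms(1-3)] N.diff_eq_zero_iff)
qed

lemma linear_map_relation_smult: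
  assumes "module R F" "module R N" "linear_map R F N f"
    and "a \<in> carrier F" "b \<in> carrier F" "r \<in> carrier R"
  shows "f (a \<ominus>\<^bsub>F\<^esub> r \<odot>\<^bsub>F\<^esub> b) = \<zero>\<^bsub>N\<^esub> \<longleftrightarrow> f a = r \<odot>\<^bsub>N\<^esub> f b"
proof -
  interpret F: module R F by fact
  interpret N: module R N by fact
  show ?thesis
    using assms(4-6) linear_mapD[OF assms(3)]
    by (simp add: linear_map_minus[OF assms(1-3)] N.diff_eq_zero_iff)
qed

text \<open>Read from left to right, for the quotient map, this says that the tensor symbol is bilinear;
read from right to left, for the linear extension of a bilinear map, it says that this
extension descends to the tensor product.\<close>

lemma linear_map_kills_tensor_rels_iff:
  assumes M: "module R M" and N: "module R N" and P: "module R P"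
    and f: "linear_map R (free_module R (carrier M \<times> carrier N)) P f"
  shows "(\<forall>e\<in>tensor_rels R M N. f e = \<zero>\<^bsub>P\<^esub>) \<longleftrightarrow>
    bilinear_map R M N P (\<lambda>x y. f (free_gen R (x, y)))"
proof -
  interpret M: module R M by fact
  interpret N: module R N by fact
  interpret P: module R P by fact
  let ?X = "carrier M \<times> carrier N"
  let ?F = "free_module R ?X"
  have F: "module R ?F" by (rule M.R.free_module_module)
  note fg = M.R.free_gen_closed[of _ ?X]
  note rel = linear_map_relation_add[OF F P f fg fg fg] linear_map_relation_smult[OF F P f fg fg]
  show ?thesis
  proof
    assume *: "\<forall>e\<in>tensor_rels R M N. f e = \<zero>\<^bsub>P\<^esub>"
    show "bilinear_map R M N P (\<lambda>x y. f (free_gen R (x, y)))"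
    proof (rule bilinear_mapI)
      show "f (free_gen R (x, y)) \<in> carrier P" if "x \<in> carrier M" "y \<in> carrier N" for x y
        using linear_mapD(1)[OF f fg] that by simp
    qed ((subst rel[symmetric], auto)[1], rule *[rule_format], unfold tensor_rels_def Let_def, blast)+
  next
    assume "bilinear_map R M N P (\<lambda>x y. f (free_gen R (x, y)))"
    note b = bilinear_mapD[OF this]
    show "\<forall>e\<in>tensor_rels R M N. f e = \<zero>\<^bsub>P\<^esub>"
      unfolding tensor_rels_def Let_def by (auto simp: rel b)
  qed
qed

lemma tensor_presentation:
  assumes "module R M" "module R N"
  shows "presentation R (carrier M \<times> carrier N) (tensor_rels R M N)"
proof -
  interpret M: module R M by fact
  interpret N: module R N by fact
  let ?F = "free_module R (carrier M \<times> carrier N)"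
  interpret F: module R ?F by (rule M.R.free_module_module)
  note fg = M.R.free_gen_closed[of _ "carrier M \<times> carrier N"]
  show ?thesis
    by unfold_locales (auto simp: tensor_rels_def Let_def fg)
qed

lemma
  assumes M: "module R M" and N: "module R N"
  shows tensor_module_module: "module R (tensor_module R M N)"
    and tensor_bilinear: "bilinear_map R M N (tensor_module R M N) (tensor R M N)"
    and tensor_generated: "submodule H R (tensor_module R M N) \<Longrightarrow>
      (\<And>x y. x \<in> carrier M \<Longrightarrow> y \<in> carrier N \<Longrightarrow> tensor R M N x y \<in> H) \<Longrightarrow> H = carrier (tensor_module R M N)"
proof -
  interpret presentation R "carrier M \<times> carrier N" "tensor_rels R M N"
    by (rule tensor_presentation[OF assms])
  show mod: "module R (tensor_module R M N)"
    unfolding tensor_module_def by (rule pres_module_module)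
  show "H = carrier (tensor_module R M N)" if "submodule H R (tensor_module R M N)"
    "\<And>x y. x \<in> carrier M \<Longrightarrow> y \<in> carrier N \<Longrightarrow> tensor R M N x y \<in> H"
    using pres_generated that unfolding tensor_module_def tensor_def by auto
  show "bilinear_map R M N (tensor_module R M N) (tensor R M N)"
    using linear_map_kills_tensor_rels_iff[OF M N pres_module_module pres_map_linear] pres_map_relation
    by (auto simp: tensor_module_def tensor_def[abs_def] pres_gen_def)
qed

lemma
  assumes M: "module R M" and N: "module R N" and P: "module R P" and b: "bilinear_map R M N P b"
  shows tensor_lift_linear: "linear_map R (tensor_module R M N) P (pres_lift R P (\<lambda>(x, y). b x y))"
    and tensor_lift_tensor: "x \<in> carrier M \<Longrightarrow> y \<in> carrier N \<Longrightarrow>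
      pres_lift R P (\<lambda>(x, y). b x y) (tensor R M N x y) = b x y"
proof -
  interpret presentation R "carrier M \<times> carrier N" "tensor_rels R M N"
    by (rule tensor_presentation[OF assms(1,2)])
  interpret M: module R M by fact
  interpret N: module R N by fact
  interpret P: module R P by fact
  let ?\<phi> = "\<lambda>(x, y). b x y"
  have \<phi>: "?\<phi> \<in> carrier M \<times> carrier N \<rightarrow> carrier P" using bilinear_mapD(1)[OF b] by auto
  have "bilinear_map R M N P (\<lambda>x y. evaluation R P ?\<phi> (free_gen R (x, y)))"
    by (rule bilinear_mapI) (simp_all add: P.evaluation_free_gen[OF \<phi>] bilinear_mapD[OF b])
  then have rel: "\<And>e. e \<in> tensor_rels R M N \<Longrightarrow> evaluation R P ?\<phi> e = \<zero>\<^bsub>P\<^esub>"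
    using linear_map_kills_tensor_rels_iff[OF M N P P.evaluation_linear[OF \<phi>]] by blast
  show "linear_map R (tensor_module R M N) P (pres_lift R P ?\<phi>)"
    unfolding tensor_module_def by (rule pres_lift_linear[OF P \<phi> rel])
  show "pres_lift R P ?\<phi> (tensor R M N x y) = b x y" if "x \<in> carrier M" "y \<in> carrier N"
    unfolding tensor_def using pres_lift_gen[OF P \<phi> rel, of "(x, y)"] that by simp
qed


section \<open>Exterior powers\<close>

text \<open>Linearity in the \<open>i\<close>-th argument is stated through list update, as in \<open>ext_rels\<close>.\<close>

definition alternating_multilinear ::
    "('a, 'm) ring_scheme \<Rightarrow> nat \<Rightarrow> ('a, 'b, 'n) module_scheme \<Rightarrow> ('a, 'c, 'k) module_scheme \<Rightarrow>
     ('b list \<Rightarrow> 'c) \<Rightarrow> bool" where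
  "alternating_multilinear R k M N \<phi> \<longleftrightarrow>
     (\<forall>xs\<in>tuples k M. \<phi> xs \<in> carrier N) \<and>
     (\<forall>xs\<in>tuples k M. \<forall>i<k. linear_map R M N (\<lambda>x. \<phi> (xs[i := x]))) \<and>
     (\<forall>xs\<in>tuples k M. \<forall>j<k. \<forall>i<j. xs ! i = xs ! j \<longrightarrow> \<phi> xs = \<zero>\<^bsub>N\<^esub>)"

lemma tuples_update: "xs \<in> tuples k M \<Longrightarrow> x \<in> carrier M \<Longrightarrow> xs[i := x] \<in> tuples k M"
  using set_update_subset_insert[of xs i x] by (auto simp: tuples_def)

text \<open>The same two-way reading as for tensor products: from left to right the wedge symbol is
alternating and multilinear, from right to left alternating multilinear maps factor through
the exterior power.\<close>

lemma linear_map_kills_ext_rels_iff: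
  assumes M: "module R M" and P: "module R P" and f: "linear_map R (free_module R (tuples k M)) P f"
  shows "(\<forall>e\<in>ext_rels R k M. f e = \<zero>\<^bsub>P\<^esub>) \<longleftrightarrow>
    alternating_multilinear R k M P (\<lambda>xs. f (free_gen R xs))"
proof -
  interpret M: module R M by fact
  interpret P: module R P by fact
  let ?X = "tuples k M"
  let ?F = "free_module R ?X"
  have F: "module R ?F" by (rule M.R.free_module_module)
  note fg = M.R.free_gen_closed[of _ ?X]
  note rel = linear_map_relation_add[OF F P f fg fg fg] linear_map_relation_smult[OF F P f fg fg]
  show ?thesis
  proof
    assume *: "\<forall>e\<in>ext_rels R k M. f e = \<zero>\<^bsub>P\<^esub>"
    have "linear_map R M P (\<lambda>x. f (free_gen R (xs[i := x])))" if xs: "xs \<in> tuples k M" and i: "i < k" for xs i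
    proof (rule linear_mapI)
      fix x assume x: "x \<in> carrier M"
      show "f (free_gen R (xs[i := x])) \<in> carrier P"
        by (rule linear_mapD(1)[OF f fg[OF tuples_update[OF xs x]]])
      show "f (free_gen R (xs[i := x \<oplus>\<^bsub>M\<^esub> y])) = f (free_gen R (xs[i := x])) \<oplus>\<^bsub>P\<^esub> f (free_gen R (xs[i := y]))"
        if "y \<in> carrier M" for y
      proof -
        have "free_gen R (xs[i := x \<oplus>\<^bsub>M\<^esub> y]) \<ominus>\<^bsub>?F\<^esub>
            (free_gen R (xs[i := x]) \<oplus>\<^bsub>?F\<^esub> free_gen R (xs[i := y])) \<in> ext_rels R k M"
          unfolding ext_rels_def Let_def using xs i x that by blast
        then show ?thesis using * rel(1) xs x that by (auto simp: tuples_update)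
      qed
      show "f (free_gen R (xs[i := r \<odot>\<^bsub>M\<^esub> x])) = r \<odot>\<^bsub>P\<^esub> f (free_gen R (xs[i := x]))"
        if "r \<in> carrier R" for r
      proof -
        have "free_gen R (xs[i := r \<odot>\<^bsub>M\<^esub> x]) \<ominus>\<^bsub>?F\<^esub> r \<odot>\<^bsub>?F\<^esub> free_gen R (xs[i := x]) \<in> ext_rels R k M"
          unfolding ext_rels_def Let_def using xs i x that by blast
        then show ?thesis using * rel(2) xs x that by (auto simp: tuples_update)
      qed
    qed
    moreover have "f (free_gen R xs) = \<zero>\<^bsub>P\<^esub>" if "xs \<in> tuples k M" "j < k" "i < j" "xs ! i = xs ! j" for xs i j
      by (rule *[rule_format]) (use that in \<open>auto simp: ext_rels_def Let_def\<close>)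
    ultimately show "alternating_multilinear R k M P (\<lambda>xs. f (free_gen R xs))"
      using linear_mapD(1)[OF f fg] by (auto simp: alternating_multilinear_def)
  next
    assume *: "alternating_multilinear R k M P (\<lambda>xs. f (free_gen R xs))"
    have lin: "linear_map R M P (\<lambda>x. f (free_gen R (xs[i := x])))" if "xs \<in> tuples k M" "i < k" for xs i
      using * that by (auto simp: alternating_multilinear_def)
    have alt: "f (free_gen R xs) = \<zero>\<^bsub>P\<^esub>" if "xs \<in> tuples k M" "j < k" "i < j" "xs ! i = xs ! j" for xs i j
      using * that by (auto simp: alternating_multilinear_def)
    show "\<forall>e\<in>ext_rels R k M. f e = \<zero>\<^bsub>P\<^esub>"
      unfolding ext_rels_def Let_def
      by (auto simp: rel tuples_update linear_mapD(2,3)[OF lin] intro: alt)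
  qed
qed

lemma ext_presentation:
  assumes "module R M"
  shows "presentation R (tuples k M) (ext_rels R k M)"
proof -
  interpret M: module R M by fact
  interpret F: module R "free_module R (tuples k M)" by (rule M.R.free_module_module)
  note fg = M.R.free_gen_closed[of _ "tuples k M"]
  show ?thesis
    by unfold_locales (auto simp: ext_rels_def Let_def fg tuples_update)
qed

lemma
  assumes M: "module R M"
  shows ext_power_module: "module R (ext_power R k M)"
    and wedge_multilinear: "alternating_multilinear R k M (ext_power R k M) (wedge R M)"
    and ext_power_generated: "submodule H R (ext_power R k M) \<Longrightarrow>
      (\<And>xs. xs \<in> tuples k M \<Longrightarrow> wedge R M xs \<in> H) \<Longrightarrow> H = carrier (ext_power R k M)"
proof -
  interpret presentation R "tuples k M" "ext_rels R k M"
    by (rule ext_presentation[OF assms])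
  interpret M: module R M by fact
  have w: "wedge R M xs = pres_gen R (tuples k M) (ext_rels R k M) xs" if "xs \<in> tuples k M" for xs
    using that by (simp add: wedge_def tuples_def)
  show "module R (ext_power R k M)"
    unfolding ext_power_def by (rule pres_module_module)
  show "H = carrier (ext_power R k M)" if "submodule H R (ext_power R k M)"
    "\<And>xs. xs \<in> tuples k M \<Longrightarrow> wedge R M xs \<in> H"
    using pres_generated that w unfolding ext_power_def by auto
  have "alternating_multilinear R k M (ext_power R k M) (\<lambda>xs. pres_gen R (tuples k M) (ext_rels R k M) xs)"
    using linear_map_kills_ext_rels_iff[OF M pres_module_module pres_map_linear] pres_map_relation
    by (auto simp: ext_power_def pres_gen_def)
  then show "alternating_multilinear R k M (ext_power R k M) (wedge R M)"
    by (auto simp: alternating_multilinear_def linear_map_def w tuples_update)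
qed

lemma
  assumes M: "module R M" and P: "module R P" and \<phi>: "alternating_multilinear R k M P \<phi>"
  shows ext_lift_linear: "linear_map R (ext_power R k M) P (pres_lift R P \<phi>)"
    and ext_lift_wedge: "xs \<in> tuples k M \<Longrightarrow> pres_lift R P \<phi> (wedge R M xs) = \<phi> xs"
proof -
  interpret presentation R "tuples k M" "ext_rels R k M"
    by (rule ext_presentation[OF assms(1)])
  interpret M: module R M by fact
  interpret P: module R P by fact
  have \<phi>': "\<phi> \<in> tuples k M \<rightarrow> carrier P" using \<phi> by (auto simp: alternating_multilinear_def)
  have "alternating_multilinear R k M P (\<lambda>xs. evaluation R P \<phi> (free_gen R xs))"
    using \<phi> P.evaluation_free_gen[OF \<phi>'] by (simp add: alternating_multilinear_def linear_map_def tuples_update)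
  then have rel: "\<And>e. e \<in> ext_rels R k M \<Longrightarrow> evaluation R P \<phi> e = \<zero>\<^bsub>P\<^esub>"
    using linear_map_kills_ext_rels_iff[OF M P P.evaluation_linear[OF \<phi>']] by blast
  show "linear_map R (ext_power R k M) P (pres_lift R P \<phi>)"
    unfolding ext_power_def by (rule pres_lift_linear[OF P \<phi>' rel])
  show "pres_lift R P \<phi> (wedge R M xs) = \<phi> xs" if "xs \<in> tuples k M"
    unfolding wedge_def using pres_lift_gen[OF P \<phi>' rel, of xs] that by (simp add: tuples_def)
qed

definition alternating_bilinear ::
    "('a, 'm) ring_scheme \<Rightarrow> ('a, 'b, 'n) module_scheme \<Rightarrow> ('a, 'c, 'k) module_scheme \<Rightarrow> ('b \<Rightarrow> 'b \<Rightarrow> 'c) \<Rightarrow> bool" where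
  "alternating_bilinear R M N b \<longleftrightarrow> bilinear_map R M M N b \<and> (\<forall>x\<in>carrier M. b x x = \<zero>\<^bsub>N\<^esub>)"

lemma alternating_bilinearD:
  assumes "alternating_bilinear R M N b"
  shows "bilinear_map R M M N b" "x \<in> carrier M \<Longrightarrow> b x x = \<zero>\<^bsub>N\<^esub>"
  using assms by (auto simp: alternating_bilinear_def)

lemma alternating_bilinear_antisym:
  assumes "module R M" "module R N" "alternating_bilinear R M N b" "x \<in> carrier M" "y \<in> carrier M"
  shows "b x y \<oplus>\<^bsub>N\<^esub> b y x = \<zero>\<^bsub>N\<^esub>"
proof -
  interpret M: module R M by fact
  interpret N: module R N by fact
  have b: "bilinear_map R M M N b" and alt: "\<And>x. x \<in> carrier M \<Longrightarrow> b x x = \<zero>\<^bsub>N\<^esub>"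
    using assms by (auto simp: alternating_bilinear_def)
  note bD = bilinear_mapD[OF b]
  have "\<zero>\<^bsub>N\<^esub> = b (x \<oplus>\<^bsub>M\<^esub> y) (x \<oplus>\<^bsub>M\<^esub> y)" using alt assms by simp
  also have "\<dots> = b x (x \<oplus>\<^bsub>M\<^esub> y) \<oplus>\<^bsub>N\<^esub> b y (x \<oplus>\<^bsub>M\<^esub> y)" using bD(2) assms by simp
  also have "\<dots> = b x y \<oplus>\<^bsub>N\<^esub> b y x" using bD(1,3) assms alt by simp
  finally show ?thesis by simp
qed

lemma tuples_2: "xs \<in> tuples 2 M \<longleftrightarrow> (\<exists>x\<in>carrier M. \<exists>y\<in>carrier M. xs = [x, y])"
  by (auto simp: tuples_def numeral_2_eq_2 length_Suc_conv)

lemma tuples_3: "xs \<in> tuples 3 M \<longleftrightarrow> (\<exists>x\<in>carrier M. \<exists>y\<in>carrier M. \<exists>z\<in>carrier M. xs = [x, y, z])"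
  by (auto simp: tuples_def numeral_3_eq_3 length_Suc_conv)

lemma alternating_bilinear_imp_multilinear:
  assumes "alternating_bilinear R M N b"
  shows "alternating_multilinear R 2 M N (\<lambda>xs. b (xs ! 0) (xs ! 1))"
proof -
  have "linear_map R M N (\<lambda>z. b ([x, y][i := z] ! 0) ([x, y][i := z] ! 1))"
    if "x \<in> carrier M" "y \<in> carrier M" "i < 2" for x y i
    using assms that by (cases i) (auto simp: alternating_bilinear_def bilinear_map_def less_2_cases_iff)
  moreover have "b ([x, y] ! 0) ([x, y] ! 1) = \<zero>\<^bsub>N\<^esub>"
    if "x \<in> carrier M" "y \<in> carrier M" "j < 2" "i < j" "[x, y] ! i = [x, y] ! j" for x y i j
    using assms that by (cases j; cases i) (auto simp: alternating_bilinear_def less_2_cases_iff)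
  moreover have "b x y \<in> carrier N" if "x \<in> carrier M" "y \<in> carrier M" for x y
    using assms that by (auto simp: alternating_bilinear_def bilinear_mapD)
  ultimately show ?thesis
    unfolding alternating_multilinear_def by (auto simp: tuples_2)
qed

lemma wedge_alternating_bilinear:
  assumes "module R M"
  shows "alternating_bilinear R M (ext_power R 2 M) (\<lambda>x y. wedge R M [x, y])"
proof -
  let ?W = "ext_power R 2 M"
  note w = wedge_multilinear[OF assms, of 2, unfolded alternating_multilinear_def]
  have lin: "linear_map R M ?W (\<lambda>z. wedge R M ([x, y][i := z]))"
    if "x \<in> carrier M" "y \<in> carrier M" "i < 2" for x y i
  proof -
    have "[x, y] \<in> tuples 2 M" using that by (auto simp: tuples_2)
    then show ?thesis using w that(3) by blast
  qed
  have "linear_map R M ?W (\<lambda>z. wedge R M [z, y])" if "y \<in> carrier M" for y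
    using lin[of y y 0] that by simp
  moreover have "linear_map R M ?W (\<lambda>z. wedge R M [x, z])" if "x \<in> carrier M" for x
    using lin[of x x 1] that by simp
  moreover have "wedge R M [x, x] = \<zero>\<^bsub>?W\<^esub>" if "x \<in> carrier M" for x
  proof -
    have "[x, x] \<in> tuples 2 M" using that by (auto simp: tuples_2)
    moreover have "(0::nat) < 1" "(1::nat) < 2" "[x, x] ! 0 = [x, x] ! 1" by auto
    ultimately show ?thesis using w by blast
  qed
  ultimately show ?thesis by (auto simp: alternating_bilinear_def bilinear_map_def)
qed

lemma linear_map_comp:
  "linear_map R M N f \<Longrightarrow> linear_map R N P g \<Longrightarrow> linear_map R M P (\<lambda>x. g (f x))"
  by (auto simp: linear_map_def Pi_iff)

lemma linear_map_add:
  assumes "module R M" "module R N" "linear_map R M N f" "linear_map R M N g"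
  shows "linear_map R M N (\<lambda>x. f x \<oplus>\<^bsub>N\<^esub> g x)"
proof -
  interpret N: module R N by fact
  show ?thesis
    by (rule linear_mapI)
      (auto simp: linear_mapD[OF assms(3)] linear_mapD[OF assms(4)] N.M.add.m_ac N.smult_r_distr)
qed

text \<open>The value of \<open>jacobi_map\<close> on \<open>x \<and> y \<and> z\<close>.\<close>

definition jacobi_form ::
   "('a, 'm) ring_scheme \<Rightarrow> ('a, 'b, 'n) lie_alg_scheme \<Rightarrow> 'b \<Rightarrow> 'b \<Rightarrow> 'b \<Rightarrow> ('b list \<Rightarrow> 'a) set" where
  "jacobi_form R M x y z = wedge R M [bracket M x y, z] \<oplus>\<^bsub>ext_power R 2 M\<^esub>
          wedge R M [bracket M y z, x] \<oplus>\<^bsub>ext_power R 2 M\<^esub>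
          wedge R M [bracket M z x, y]"

text \<open>The expression is invariant under cyclic permutation of its arguments, so linearity in the
first argument and vanishing for equal first and second arguments suffice. The latter holds
because \<open>[x, x] = 0\<close> and the remaining two terms cancel by antisymmetry of the bracket.\<close>

lemma jacobi_form_multilinear:
  assumes M: "module R M" and b: "alternating_bilinear R M M (bracket M)"
  shows "alternating_multilinear R 3 M (ext_power R 2 M) (\<lambda>xs. jacobi_form R M (xs ! 0) (xs ! 1) (xs ! 2))"
proof -
  let ?W = "ext_power R 2 M"
  have W: "module R ?W" by (rule ext_power_module[OF M])
  interpret M: module R M by fact
  interpret W: module R ?W by fact
  note w = wedge_alternating_bilinear[OF M]
  have bil: "bilinear_map R M M M (bracket M)" "bilinear_map R M M ?W (\<lambda>x y. wedge R M [x, y])"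
    using b w by (auto simp: alternating_bilinear_def)
  note D = bilinear_mapD[OF bil(1)] bilinear_mapD[OF bil(2)]
  have alt: "bracket M x x = \<zero>\<^bsub>M\<^esub>" "wedge R M [\<zero>\<^bsub>M\<^esub>, x] = \<zero>\<^bsub>?W\<^esub>" if "x \<in> carrier M" for x
    using b w that linear_map_zero[OF M W, of "\<lambda>y. wedge R M [y, x]"]
    by (auto simp: alternating_bilinear_def bilinear_map_def)
  have anti: "wedge R M [bracket M x y, z] \<oplus>\<^bsub>?W\<^esub> wedge R M [bracket M y x, z] = \<zero>\<^bsub>?W\<^esub>"
    if "x \<in> carrier M" "y \<in> carrier M" "z \<in> carrier M" for x y z
    using that alternating_bilinear_antisym[OF M M b, of x y] alt(2) by (simp add: D flip: D(7))
  have cyc: "jacobi_form R M x y z = jacobi_form R M y z x"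
    if "x \<in> carrier M" "y \<in> carrier M" "z \<in> carrier M" for x y z
    using that by (simp add: jacobi_form_def D W.M.add.m_ac)
  have lin0: "linear_map R M ?W (\<lambda>x. jacobi_form R M x y z)" if "y \<in> carrier M" "z \<in> carrier M" for y z
    unfolding jacobi_form_def
  proof (intro linear_map_add[OF M W])
    show "linear_map R M ?W (\<lambda>x. wedge R M [bracket M x y, z])"
      by (rule linear_map_comp[of R M M "\<lambda>x. bracket M x y"]) (use bil that in \<open>auto simp: bilinear_map_def\<close>)
    show "linear_map R M ?W (\<lambda>x. wedge R M [bracket M z x, y])"
      by (rule linear_map_comp[of R M M "\<lambda>x. bracket M z x"]) (use bil that in \<open>auto simp: bilinear_map_def\<close>)
    show "linear_map R M ?W (\<lambda>x. wedge R M [bracket M y z, x])"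
      using bil that D(1) by (auto simp: bilinear_map_def)
  qed
  have lin_cong: "linear_map R M ?W g" if "linear_map R M ?W f" "\<And>x. x \<in> carrier M \<Longrightarrow> g x = f x" for f g
    using that by (simp add: linear_map_def Pi_iff)
  have lin1: "linear_map R M ?W (\<lambda>y. jacobi_form R M x y z)" if "x \<in> carrier M" "z \<in> carrier M" for x z
    by (rule lin_cong[OF lin0[OF that(2,1)]]) (simp add: cyc that)
  have lin2: "linear_map R M ?W (\<lambda>z. jacobi_form R M x y z)" if "x \<in> carrier M" "y \<in> carrier M" for x y
    by (rule lin_cong[OF lin0[OF that]]) (metis cyc that)
  have alt0: "jacobi_form R M x x z = \<zero>\<^bsub>?W\<^esub>" if "x \<in> carrier M" "z \<in> carrier M" for x z
    using that alt anti[of x z x] by (simp add: jacobi_form_def D)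
  have alt1: "jacobi_form R M x y y = \<zero>\<^bsub>?W\<^esub>" "jacobi_form R M y x y = \<zero>\<^bsub>?W\<^esub>" if "x \<in> carrier M" "y \<in> carrier M" for x y
    using alt0[OF that(2,1)] cyc that by metis+
  have lin: "linear_map R M ?W (\<lambda>a. jacobi_form R M ([x, y, z][i := a] ! 0) ([x, y, z][i := a] ! 1) ([x, y, z][i := a] ! 2))"
    if "x \<in> carrier M" "y \<in> carrier M" "z \<in> carrier M" "i < 3" for x y z i
  proof -
    from \<open>i < 3\<close> consider "i = 0" | "i = 1" | "i = 2" by linarith
    then show ?thesis using that lin0 lin1 lin2 by cases auto
  qed
  have "jacobi_form R M ([x, y, z] ! 0) ([x, y, z] ! 1) ([x, y, z] ! 2) = \<zero>\<^bsub>?W\<^esub>"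
    if "x \<in> carrier M" "y \<in> carrier M" "z \<in> carrier M" "j < 3" "i < j" "[x, y, z] ! i = [x, y, z] ! j" for x y z i j
  proof -
    from \<open>i < j\<close> \<open>j < 3\<close> consider "i = 0" "j = 1" | "i = 0" "j = 2" | "i = 1" "j = 2" by linarith
    then show ?thesis using that alt0 alt1 by cases auto
  qed
  moreover have "jacobi_form R M x y z \<in> carrier ?W"
    if "x \<in> carrier M" "y \<in> carrier M" "z \<in> carrier M" for x y z
    using that by (simp add: jacobi_form_def D)
  ultimately show ?thesis
    using lin unfolding alternating_multilinear_def by (auto simp: tuples_3)
qed


section \<open>Localization of scalars\<close>

text \<open>Maps out of an \<open>R\<close>-module into an \<open>S\<close>-module that are linear along \<open>h\<close> are treated as
\<open>R\<close>-linear maps into the restriction of scalars of the target.\<close>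

definition restrict_scalars :: "('a \<Rightarrow> 'c) \<Rightarrow> ('c, 'b, 'n) module_scheme \<Rightarrow> ('a, 'b) module" where
  "restrict_scalars h N = \<lparr>carrier = carrier N, monoid.mult = undefined, one = undefined,
     zero = \<zero>\<^bsub>N\<^esub>, add = add N, smult = (\<lambda>r. smult N (h r))\<rparr>"

text \<open>The module underlying \<open>base_change\<close>, for modules that carry no bracket. It is needed for
the exterior square of a Lie algebra.\<close>

definition extend_scalars ::
    "('a, 'm) ring_scheme \<Rightarrow> ('c, 'k) ring_scheme \<Rightarrow> ('a \<Rightarrow> 'c) \<Rightarrow> ('a, 'b, 'n) module_scheme \<Rightarrow>
     ('c, ('b \<times> 'c \<Rightarrow> 'a) set) module" where
  "extend_scalars R S h M = (let S' = ring_as_module S h; T = tensor_module R M S' in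
     \<lparr>carrier = carrier T, monoid.mult = undefined, one = undefined, zero = \<zero>\<^bsub>T\<^esub>, add = add T,
      smult = (\<lambda>s. pres_lift R T (\<lambda>(x, t). tensor R M S' x (s \<otimes>\<^bsub>S\<^esub> t)))\<rparr>)"

text \<open>The construction by which \<open>base_change\<close> extends the bracket, for bilinear maps with values
in a second module; the second use is the wedge product.\<close>

definition extend_bilinear ::
    "('a, 'm) ring_scheme \<Rightarrow> ('c, 'k) ring_scheme \<Rightarrow> ('a \<Rightarrow> 'c) \<Rightarrow> ('a, 'd, 'l) module_scheme \<Rightarrow>
     ('b \<Rightarrow> 'b \<Rightarrow> 'd) \<Rightarrow> ('b \<times> 'c \<Rightarrow> 'a) set \<Rightarrow> ('b \<times> 'c \<Rightarrow> 'a) set \<Rightarrow> ('d \<times> 'c \<Rightarrow> 'a) set" where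
  "extend_bilinear R S h N b = (let S' = ring_as_module S h; T = tensor_module R N S' in
     (\<lambda>\<xi> \<eta>. pres_lift R T (\<lambda>(x, s). pres_lift R T (\<lambda>(y, t). tensor R N S' (b x y) (s \<otimes>\<^bsub>S\<^esub> t)) \<eta>) \<xi>))"

lemma abelian_group_cong:
  assumes "abelian_group M" "carrier N = carrier M" "\<zero>\<^bsub>N\<^esub> = \<zero>\<^bsub>M\<^esub>" "add N = add M"
  shows "abelian_group N"
proof -
  interpret M: abelian_group M by fact
  show ?thesis
    by (rule abelian_groupI) (auto simp: assms(2-4) M.a_ac intro: M.l_neg)
qed

lemma module_cong:
  assumes "module R M" "carrier N = carrier M" "\<zero>\<^bsub>N\<^esub> = \<zero>\<^bsub>M\<^esub>" "add N = add M" "smult N = smult M"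
  shows "module R N"
proof -
  interpret M: module R M by fact
  have "abelian_group N"
    by (rule abelian_group_cong[OF M.abelian_group_axioms assms(2-4)])
  then show ?thesis
    by (intro moduleI) (auto simp: assms M.R.is_cring M.smult_l_distr M.smult_r_distr M.smult_assoc1)
qed

lemma (in domain) nonzero_mult:
  "b \<in> carrier R - {\<zero>} \<Longrightarrow> d \<in> carrier R - {\<zero>} \<Longrightarrow> b \<otimes> d \<in> carrier R - {\<zero>}"
  using integral by auto

text \<open>\<open>S\<close> is the field of fractions of \<open>R\<close>, in the form in which it is used: nonzero elements of \<open>R\<close>
become invertible, and every element of \<open>S\<close> has a denominator in \<open>R\<close>.\<close>

locale scalar_localization = R: domain R + S: cring S
  for R :: "('a, 'm) ring_scheme" and S :: "('c, 'k) ring_scheme" +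
  fixes h :: "'a \<Rightarrow> 'c"
  assumes hom: "h \<in> ring_hom R S"
    and inj: "inj_on h (carrier R)"
    and invertible: "\<And>r. r \<in> carrier R - {\<zero>\<^bsub>R\<^esub>} \<Longrightarrow> \<exists>u\<in>carrier S. h r \<otimes>\<^bsub>S\<^esub> u = \<one>\<^bsub>S\<^esub>"
    and denominator: "\<And>s. s \<in> carrier S \<Longrightarrow> \<exists>r\<in>carrier R - {\<zero>\<^bsub>R\<^esub>}. \<exists>a\<in>carrier R. h r \<otimes>\<^bsub>S\<^esub> s = h a"
begin

abbreviation "nonzero \<equiv> carrier R - {\<zero>\<^bsub>R\<^esub>}"
abbreviation "ext \<equiv> extend_scalars R S h"

lemmas h_simps [simp] = ring_hom_closed[OF hom] ring_hom_add[OF hom] ring_hom_mult[OF hom] ring_hom_one[OF hom]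

lemma one_nonzero: "\<one>\<^bsub>R\<^esub> \<in> nonzero"
  by simp

lemma restrict_scalars_module:
  assumes "module S N"
  shows "module R (restrict_scalars h N)"
proof -
  interpret N: module S N by fact
  have "abelian_group (restrict_scalars h N)"
    by (rule abelian_group_cong[OF N.abelian_group_axioms]) (simp_all add: restrict_scalars_def)
  then show ?thesis
    by (intro moduleI)
      (auto simp: restrict_scalars_def R.is_cring N.smult_l_distr N.smult_r_distr N.smult_assoc1)
qed

text \<open>A map to the localization, characterized by its elements: everything in \<open>N\<close> becomes an image
after multiplication by a nonzero scalar, and only torsion is lost.\<close>

definition localization_map :: "('a, 'b, 'n) module_scheme \<Rightarrow> ('c, 'd, 'l) module_scheme \<Rightarrow> ('b \<Rightarrow> 'd) \<Rightarrow> bool" where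
  "localization_map M N j \<longleftrightarrow> module R M \<and> module S N \<and> linear_map R M (restrict_scalars h N) j \<and>
     (\<forall>y\<in>carrier N. \<exists>r\<in>nonzero. \<exists>x\<in>carrier M. h r \<odot>\<^bsub>N\<^esub> y = j x) \<and>
     (\<forall>x\<in>carrier M. j x = \<zero>\<^bsub>N\<^esub> \<longrightarrow> (\<exists>r\<in>nonzero. r \<odot>\<^bsub>M\<^esub> x = \<zero>\<^bsub>M\<^esub>))"

abbreviation "S' \<equiv> ring_as_module S h"

lemma S'_simps: "carrier S' = carrier S" "add S' = add S" "\<zero>\<^bsub>S'\<^esub> = \<zero>\<^bsub>S\<^esub>" "r \<odot>\<^bsub>S'\<^esub> s = h r \<otimes>\<^bsub>S\<^esub> s"
  by (simp_all add: ring_as_module_def)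

lemma S'_module: "module R S'"
proof -
  have "abelian_group S'"
    by (rule abelian_group_cong[OF S.abelian_group_axioms]) (simp_all add: S'_simps)
  then show ?thesis
    by (intro moduleI) (auto simp: S'_simps R.is_cring S.l_distr S.r_distr S.m_assoc)
qed

context
  fixes M :: "('a, 'b, 'n) module_scheme"
  assumes M: "module R M"
begin

interpretation M: module R M by (rule M)

abbreviation "T \<equiv> tensor_module R M S'"
abbreviation "tens \<equiv> tensor R M S'"

lemma T_module: "module R T"
  by (rule tensor_module_module[OF M S'_module])

interpretation T: module R T by (rule T_module)

lemma tens_simps:
  assumes "x \<in> carrier M" "t \<in> carrier S"
  shows "tens x t \<in> carrier T"
    and "x' \<in> carrier M \<Longrightarrow> tens (x \<oplus>\<^bsub>M\<^esub> x') t = tens x t \<oplus>\<^bsub>T\<^esub> tens x' t"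
    and "t' \<in> carrier S \<Longrightarrow> tens x (t \<oplus>\<^bsub>S\<^esub> t') = tens x t \<oplus>\<^bsub>T\<^esub> tens x t'"
    and "r \<in> carrier R \<Longrightarrow> tens (r \<odot>\<^bsub>M\<^esub> x) t = r \<odot>\<^bsub>T\<^esub> tens x t"
    and "r \<in> carrier R \<Longrightarrow> tens x (h r \<otimes>\<^bsub>S\<^esub> t) = r \<odot>\<^bsub>T\<^esub> tens x t"
  using bilinear_mapD[OF tensor_bilinear[OF M S'_module], of x t] assms by (auto simp: S'_simps)

text \<open>Any two fractions have a common denominator, hence sums of tensors can be contracted: the
tensors \<open>x \<otimes> 1/r\<close> are closed under addition and form a submodule.\<close>

lemma simple_tensor:
  assumes "\<xi> \<in> carrier T"
  shows "\<exists>x\<in>carrier M. \<exists>r\<in>nonzero. \<exists>u\<in>carrier S. h r \<otimes>\<^bsub>S\<^esub> u = \<one>\<^bsub>S\<^esub> \<and> \<xi> = tens x u"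
proof -
  define H where "H = {tens x u | x u r. x \<in> carrier M \<and> r \<in> nonzero \<and> u \<in> carrier S \<and> h r \<otimes>\<^bsub>S\<^esub> u = \<one>\<^bsub>S\<^esub>}"
  have HI: "tens x u \<in> H" if "x \<in> carrier M" "r \<in> nonzero" "u \<in> carrier S" "h r \<otimes>\<^bsub>S\<^esub> u = \<one>\<^bsub>S\<^esub>" for x u r
    unfolding H_def using that by blast
  have one: "tens x \<one>\<^bsub>S\<^esub> \<in> H" if "x \<in> carrier M" for x
    by (rule HI[OF that one_nonzero]) auto
  have "submodule H R T"
  proof (rule T.submoduleI')
    show "H \<subseteq> carrier T" by (auto simp: H_def tens_simps)
    have "tens \<zero>\<^bsub>M\<^esub> \<one>\<^bsub>S\<^esub> = \<zero>\<^bsub>T\<^esub>"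
      using tens_simps(4)[OF M.zero_closed S.one_closed R.zero_closed] by (simp add: tens_simps)
    then show "\<zero>\<^bsub>T\<^esub> \<in> H" using one[of "\<zero>\<^bsub>M\<^esub>"] by simp
  next
    fix r \<xi> assume "r \<in> carrier R" "\<xi> \<in> H"
    then show "r \<odot>\<^bsub>T\<^esub> \<xi> \<in> H"
      unfolding H_def by (auto simp flip: tens_simps(4)) (metis M.smult_closed)
  next
    fix \<xi> \<xi>' assume "\<xi> \<in> H" "\<xi>' \<in> H"
    then obtain x u r x' u' r' where *:
      "x \<in> carrier M" "r \<in> nonzero" "u \<in> carrier S" "h r \<otimes>\<^bsub>S\<^esub> u = \<one>\<^bsub>S\<^esub>" "\<xi> = tens x u"
      "x' \<in> carrier M" "r' \<in> nonzero" "u' \<in> carrier S" "h r' \<otimes>\<^bsub>S\<^esub> u' = \<one>\<^bsub>S\<^esub>" "\<xi>' = tens x' u'"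
      unfolding H_def by blast
    \<comment> \<open>Pass to the common denominator \<open>r r'\<close>.\<close>
    have "u = h r' \<otimes>\<^bsub>S\<^esub> (u \<otimes>\<^bsub>S\<^esub> u')" using * S.m_lcomm[of "h r'" u u'] by simp
    moreover have "u' = h r \<otimes>\<^bsub>S\<^esub> (u \<otimes>\<^bsub>S\<^esub> u')" using * S.m_assoc[of "h r" u u'] by simp
    ultimately have "\<xi> = tens (r' \<odot>\<^bsub>M\<^esub> x) (u \<otimes>\<^bsub>S\<^esub> u')" "\<xi>' = tens (r \<odot>\<^bsub>M\<^esub> x') (u \<otimes>\<^bsub>S\<^esub> u')"
      using * tens_simps(4,5) by (metis DiffD1 S.m_closed)+
    then have "\<xi> \<oplus>\<^bsub>T\<^esub> \<xi>' = tens (r' \<odot>\<^bsub>M\<^esub> x \<oplus>\<^bsub>M\<^esub> r \<odot>\<^bsub>M\<^esub> x') (u \<otimes>\<^bsub>S\<^esub> u')"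
      using * by (simp add: tens_simps)
    moreover have "h (r \<otimes>\<^bsub>R\<^esub> r') \<otimes>\<^bsub>S\<^esub> (u \<otimes>\<^bsub>S\<^esub> u') = (h r \<otimes>\<^bsub>S\<^esub> u) \<otimes>\<^bsub>S\<^esub> (h r' \<otimes>\<^bsub>S\<^esub> u')"
      using * by (simp add: S.m_ac)
    ultimately show "\<xi> \<oplus>\<^bsub>T\<^esub> \<xi>' \<in> H"
      using HI[of "r' \<odot>\<^bsub>M\<^esub> x \<oplus>\<^bsub>M\<^esub> r \<odot>\<^bsub>M\<^esub> x'" "r \<otimes>\<^bsub>R\<^esub> r'" "u \<otimes>\<^bsub>S\<^esub> u'"] * R.nonzero_mult by simp
  qed
  moreover have "tens x t \<in> H" if xt: "x \<in> carrier M" "t \<in> carrier S'" for x t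
  proof -
    have t: "t \<in> carrier S" using xt by (simp add: S'_simps)
    obtain r a where r: "r \<in> nonzero" "a \<in> carrier R" "h r \<otimes>\<^bsub>S\<^esub> t = h a" using denominator[OF t] by blast
    obtain u where u: "u \<in> carrier S" "h r \<otimes>\<^bsub>S\<^esub> u = \<one>\<^bsub>S\<^esub>" using invertible[OF r(1)] by blast
    have "t = (h r \<otimes>\<^bsub>S\<^esub> t) \<otimes>\<^bsub>S\<^esub> u" using u r t by (simp add: S.m_ac del: r(3)) (metis DiffD1 S.m_comm S.m_lcomm S.r_one h_simps(1))
    then have "t = h a \<otimes>\<^bsub>S\<^esub> u" using r by simp
    then have "tens x t = tens (a \<odot>\<^bsub>M\<^esub> x) u" using tens_simps(4,5) u r xt by simp
    then show ?thesis using HI[OF _ r(1) u] r(2) xt by simp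
  qed
  ultimately have "H = carrier T" by (rule tensor_generated[OF M S'_module])
  then have "\<xi> \<in> H" using assms by simp
  then show ?thesis unfolding H_def by blast
qed

text \<open>Only torsion is killed by passing to the tensor product. To detect this without a model of
the localization of \<open>M\<close>, denominators are cleared: for \<open>c\<close> in \<open>R\<close> let \<open>\<phi> c\<close> send the generator
\<open>(x, t)\<close> to \<open>(c t) x\<close> if \<open>c t\<close> lies in \<open>R\<close>. This is not compatible with the relations for
a fixed \<open>c\<close>, but each relation is killed by \<open>\<phi> c\<close> as soon as \<open>c\<close> is a multiple of a
suitable nonzero \<open>d\<close>. The elements with this property form a submodule, so it contains the
span of the relations. If \<open>x \<otimes> 1 = 0\<close>, then \<open>\<phi> d\<close> kills the generator \<open>(x, 1)\<close>, that is,
\<open>d x = 0\<close>.\<close>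

lemma tens_one_eq_zero:
  assumes "x \<in> carrier M" "tens x \<one>\<^bsub>S\<^esub> = \<zero>\<^bsub>T\<^esub>"
  shows "\<exists>r\<in>nonzero. r \<odot>\<^bsub>M\<^esub> x = \<zero>\<^bsub>M\<^esub>"
proof -
  let ?X = "carrier M \<times> carrier S'"
  let ?F = "free_module R ?X"
  interpret presentation R ?X "tensor_rels R M S'"
    by (rule tensor_presentation[OF M S'_module])
  \<comment> \<open>The value \<open>0\<close> outside of the image of \<open>h\<close> is arbitrary.\<close>
  define n where "n s = (if s \<in> h ` carrier R then inv_into (carrier R) h s else \<zero>\<^bsub>R\<^esub>)" for s
  have n_closed: "n s \<in> carrier R" for s by (auto simp: n_def inv_into_into)
  have n_h: "n (h r) = r" if "r \<in> carrier R" for r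
    using that inj by (simp add: n_def inv_into_f_f)
  define \<phi> where "\<phi> c = (\<lambda>(x, t). n (h c \<otimes>\<^bsub>S\<^esub> t) \<odot>\<^bsub>M\<^esub> x)" for c
  have \<phi>: "\<phi> c \<in> ?X \<rightarrow> carrier M" for c by (auto simp: \<phi>_def n_closed)
  let ?ev = "\<lambda>c. evaluation R M (\<phi> c)"
  note evL = M.evaluation_linear[OF \<phi>] and evG = M.evaluation_free_gen[OF \<phi>]
  \<comment> \<open>\<open>d\<close> and all of its multiples turn \<open>t\<close> into an element of \<open>R\<close>.\<close>
  define clears where "clears d t \<longleftrightarrow> (\<forall>c\<in>carrier R. h (c \<otimes>\<^bsub>R\<^esub> d) \<otimes>\<^bsub>S\<^esub> t \<in> h ` carrier R)" for d t
  have clears: "\<exists>d\<in>nonzero. clears d t" if t: "t \<in> carrier S" for t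
  proof -
    obtain r a where r: "r \<in> nonzero" "a \<in> carrier R" "h r \<otimes>\<^bsub>S\<^esub> t = h a" using denominator[OF t] by blast
    have "h (c \<otimes>\<^bsub>R\<^esub> r) \<otimes>\<^bsub>S\<^esub> t = h (c \<otimes>\<^bsub>R\<^esub> a)" if "c \<in> carrier R" for c
      using that r t by (simp add: S.m_assoc)
    then show ?thesis using r unfolding clears_def by blast
  qed
  define H where "H = {f \<in> carrier ?F. \<exists>d\<in>nonzero. \<forall>c\<in>carrier R. ?ev (c \<otimes>\<^bsub>R\<^esub> d) f = \<zero>\<^bsub>M\<^esub>}"
  have "submodule H R ?F"
  proof (rule F.submoduleI')
    show "H \<subseteq> carrier ?F" by (auto simp: H_def)
    show "\<zero>\<^bsub>?F\<^esub> \<in> H" using one_nonzero by (auto simp: H_def linear_map_zero[OF F.module_axioms M evL])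
    show "r \<odot>\<^bsub>?F\<^esub> f \<in> H" if "r \<in> carrier R" "f \<in> H" for r f
      using that by (force simp: H_def linear_mapD(3)[OF evL])
  next
    fix f g assume "f \<in> H" "g \<in> H"
    then obtain d e where *: "f \<in> carrier ?F" "g \<in> carrier ?F" "d \<in> nonzero" "e \<in> nonzero"
      "\<And>c. c \<in> carrier R \<Longrightarrow> ?ev (c \<otimes>\<^bsub>R\<^esub> d) f = \<zero>\<^bsub>M\<^esub>" "\<And>c. c \<in> carrier R \<Longrightarrow> ?ev (c \<otimes>\<^bsub>R\<^esub> e) g = \<zero>\<^bsub>M\<^esub>"
      unfolding H_def by blast
    have "?ev (c \<otimes>\<^bsub>R\<^esub> (d \<otimes>\<^bsub>R\<^esub> e)) (f \<oplus>\<^bsub>?F\<^esub> g) = \<zero>\<^bsub>M\<^esub>" if c: "c \<in> carrier R" for c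
    proof -
      have eq: "c \<otimes>\<^bsub>R\<^esub> (d \<otimes>\<^bsub>R\<^esub> e) = (c \<otimes>\<^bsub>R\<^esub> e) \<otimes>\<^bsub>R\<^esub> d" "c \<otimes>\<^bsub>R\<^esub> (d \<otimes>\<^bsub>R\<^esub> e) = (c \<otimes>\<^bsub>R\<^esub> d) \<otimes>\<^bsub>R\<^esub> e"
        using c * by (simp_all add: R.m_ac)
      have "?ev (c \<otimes>\<^bsub>R\<^esub> (d \<otimes>\<^bsub>R\<^esub> e)) f = \<zero>\<^bsub>M\<^esub>" unfolding eq(1) using * c by simp
      moreover have "?ev (c \<otimes>\<^bsub>R\<^esub> (d \<otimes>\<^bsub>R\<^esub> e)) g = \<zero>\<^bsub>M\<^esub>" unfolding eq(2) using * c by simp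
      ultimately show ?thesis using * by (simp add: linear_mapD(2)[OF evL])
    qed
    then show "f \<oplus>\<^bsub>?F\<^esub> g \<in> H" unfolding H_def using * R.nonzero_mult by blast
  qed
  moreover have "tensor_rels R M S' \<subseteq> H"
  proof
    fix e assume e: "e \<in> tensor_rels R M S'"
    have eF: "e \<in> carrier ?F" using e E by blast
    note fg = R.free_gen_closed[of _ ?X]
    note rel = linear_map_relation_add[OF F.module_axioms M evL fg fg fg]
      linear_map_relation_smult[OF F.module_axioms M evL fg fg]
    have inH: "e \<in> H" if "d \<in> nonzero" "\<And>c. c \<in> carrier R \<Longrightarrow> ?ev (c \<otimes>\<^bsub>R\<^esub> d) e = \<zero>\<^bsub>M\<^esub>" for d
      unfolding H_def using that eF by blast
    have rel1: "e \<in> H" if hyp: "x \<in> carrier M" "x' \<in> carrier M" "t \<in> carrier S'"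
      "e = free_gen R (x \<oplus>\<^bsub>M\<^esub> x', t) \<ominus>\<^bsub>?F\<^esub> (free_gen R (x, t) \<oplus>\<^bsub>?F\<^esub> free_gen R (x', t))" for x x' t
    proof -
      have "?ev c e = \<zero>\<^bsub>M\<^esub>" for c
        unfolding hyp(4) using hyp(1-3)
        by (subst rel) (simp_all add: S'_simps evG, simp add: \<phi>_def M.smult_r_distr n_closed)
      then show ?thesis by (intro inH[OF one_nonzero])
    qed
    have rel2: "e \<in> H" if hyp: "x \<in> carrier M" "t \<in> carrier S'" "t' \<in> carrier S'"
      "e = free_gen R (x, t \<oplus>\<^bsub>S'\<^esub> t') \<ominus>\<^bsub>?F\<^esub> (free_gen R (x, t) \<oplus>\<^bsub>?F\<^esub> free_gen R (x, t'))" for x t t'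
    proof -
      obtain d1 d2 where d: "d1 \<in> nonzero" "clears d1 t" "d2 \<in> nonzero" "clears d2 t'"
        using clears hyp(1-3)[unfolded S'_simps] by metis
      show ?thesis
      proof (rule inH[OF R.nonzero_mult[OF d(1,3)]])
        fix c assume c: "c \<in> carrier R"
        let ?c = "c \<otimes>\<^bsub>R\<^esub> (d1 \<otimes>\<^bsub>R\<^esub> d2)"
        have eq: "?c = (c \<otimes>\<^bsub>R\<^esub> d2) \<otimes>\<^bsub>R\<^esub> d1" "?c = (c \<otimes>\<^bsub>R\<^esub> d1) \<otimes>\<^bsub>R\<^esub> d2"
          using c d by (simp_all add: R.m_ac)
        have "h ?c \<otimes>\<^bsub>S\<^esub> t \<in> h ` carrier R"
          unfolding eq(1) using d(2)[unfolded clears_def, rule_format, of "c \<otimes>\<^bsub>R\<^esub> d2"] c d by simp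
        then obtain a where a: "a \<in> carrier R" "h ?c \<otimes>\<^bsub>S\<^esub> t = h a" by blast
        have "h ?c \<otimes>\<^bsub>S\<^esub> t' \<in> h ` carrier R"
          unfolding eq(2) using d(4)[unfolded clears_def, rule_format, of "c \<otimes>\<^bsub>R\<^esub> d1"] c d by simp
        then obtain b where b: "b \<in> carrier R" "h ?c \<otimes>\<^bsub>S\<^esub> t' = h b" by blast
        note ab = a b
        have "h ?c \<otimes>\<^bsub>S\<^esub> (t \<oplus>\<^bsub>S\<^esub> t') = h (a \<oplus>\<^bsub>R\<^esub> b)"
          using S.r_distr[of t t' "h ?c"] hyp(1-3)[unfolded S'_simps] ab c d by simp
        then have "\<phi> ?c (x, t \<oplus>\<^bsub>S'\<^esub> t') = \<phi> ?c (x, t) \<oplus>\<^bsub>M\<^esub> \<phi> ?c (x, t')"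
          unfolding \<phi>_def using ab hyp(1-3) by (simp only: S'_simps prod.case n_h R.a_closed M.smult_l_distr)
        then show "?ev ?c e = \<zero>\<^bsub>M\<^esub>"
          unfolding hyp(4) using hyp(1-3) by (subst rel) (simp_all add: S'_simps evG)
      qed
    qed
    have rel3: "e \<in> H" if hyp: "r \<in> carrier R" "x \<in> carrier M" "t \<in> carrier S'"
      "e = free_gen R (r \<odot>\<^bsub>M\<^esub> x, t) \<ominus>\<^bsub>?F\<^esub> r \<odot>\<^bsub>?F\<^esub> free_gen R (x, t)" for r x t
    proof -
      have "?ev c e = \<zero>\<^bsub>M\<^esub>" for c
        unfolding hyp(4) using hyp(1-3)
        by (subst rel) (simp_all add: S'_simps evG, simp add: \<phi>_def n_closed R.m_comm flip: M.smult_assoc1)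
      then show ?thesis by (intro inH[OF one_nonzero])
    qed
    have rel4: "e \<in> H" if hyp: "r \<in> carrier R" "x \<in> carrier M" "t \<in> carrier S'"
      "e = free_gen R (x, r \<odot>\<^bsub>S'\<^esub> t) \<ominus>\<^bsub>?F\<^esub> r \<odot>\<^bsub>?F\<^esub> free_gen R (x, t)" for r x t
    proof -
      obtain d where d: "d \<in> nonzero" "clears d t" using clears hyp(1-3)[unfolded S'_simps] by metis
      show ?thesis
      proof (rule inH[OF d(1)])
        fix c assume c: "c \<in> carrier R"
        let ?c = "c \<otimes>\<^bsub>R\<^esub> d"
        obtain a where a: "a \<in> carrier R" "h ?c \<otimes>\<^bsub>S\<^esub> t = h a" using d c unfolding clears_def by blast
        have "h ?c \<otimes>\<^bsub>S\<^esub> (h r \<otimes>\<^bsub>S\<^esub> t) = h (r \<otimes>\<^bsub>R\<^esub> a)"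
          using S.m_lcomm[of "h ?c" "h r" t] hyp(1-3)[unfolded S'_simps] a c d by simp
        then have "\<phi> ?c (x, r \<odot>\<^bsub>S'\<^esub> t) = r \<odot>\<^bsub>M\<^esub> \<phi> ?c (x, t)"
          unfolding \<phi>_def using a hyp(1-3) by (simp only: S'_simps prod.case n_h R.m_closed M.smult_assoc1)
        then show "?ev ?c e = \<zero>\<^bsub>M\<^esub>"
          unfolding hyp(4) using hyp(1-3) by (subst rel) (simp_all add: S'_simps evG)
      qed
    qed
    show "e \<in> H"
      using e unfolding tensor_rels_def Let_def
      by (elim UnE CollectE exE conjE) (rule rel1 rel2 rel3 rel4, assumption+)+
  qed
  ultimately have "mspan R ?F (tensor_rels R M S') \<subseteq> H" by (rule mspan_least)
  moreover have x1: "(x, \<one>\<^bsub>S\<^esub>) \<in> ?X" using assms by (simp add: S'_simps)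
  then have "free_gen R (x, \<one>\<^bsub>S\<^esub>) \<in> mspan R ?F (tensor_rels R M S')"
    using F.quot_map_eq_zero_iff[OF span_submodule R.free_gen_closed[OF x1]] assms(2)
    by (simp add: tensor_def tensor_module_def pres_gen_def pres_module_def)
  ultimately obtain d where d: "d \<in> nonzero" "?ev (\<one>\<^bsub>R\<^esub> \<otimes>\<^bsub>R\<^esub> d) (free_gen R (x, \<one>\<^bsub>S\<^esub>)) = \<zero>\<^bsub>M\<^esub>"
    unfolding H_def using R.one_closed by blast
  then have "\<phi> d (x, \<one>\<^bsub>S\<^esub>) = \<zero>\<^bsub>M\<^esub>" using evG[OF x1] by simp
  then show ?thesis using d(1) by (auto simp: \<phi>_def n_h)
qed

lemma extend_scalars_carrier: "carrier (ext M) = carrier T" "add (ext M) = add T"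
   "\<zero>\<^bsub>ext M\<^esub> = \<zero>\<^bsub>T\<^esub>"
  by (simp_all add: extend_scalars_def Let_def)

lemma
  assumes s: "s \<in> carrier S"
  shows extend_scalars_smult: "x \<in> carrier M \<Longrightarrow> t \<in> carrier S \<Longrightarrow>
      s \<odot>\<^bsub>ext M\<^esub> tens x t = tens x (s \<otimes>\<^bsub>S\<^esub> t)"
    and extend_scalars_smult_linear: "linear_map R T T (\<lambda>\<xi>. s \<odot>\<^bsub>ext M\<^esub> \<xi>)"
proof -
  have b: "bilinear_map R M S' T (\<lambda>x t. tens x (s \<otimes>\<^bsub>S\<^esub> t))"
  proof (rule bilinear_mapI)
    fix r x y assume "r \<in> carrier R" "x \<in> carrier M" "y \<in> carrier S'"
    then show "tens x (s \<otimes>\<^bsub>S\<^esub> (r \<odot>\<^bsub>S'\<^esub> y)) = r \<odot>\<^bsub>T\<^esub> tens x (s \<otimes>\<^bsub>S\<^esub> y)"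
      using s by (simp add: S'_simps S.m_lcomm[of s] tens_simps)
  qed (use s in \<open>simp_all add: S'_simps tens_simps S.r_distr\<close>)
  note lift = tensor_lift_linear[OF M S'_module T_module b] tensor_lift_tensor[OF M S'_module T_module b]
  show "linear_map R T T (\<lambda>\<xi>. s \<odot>\<^bsub>ext M\<^esub> \<xi>)" using lift(1) by (simp add: extend_scalars_def Let_def)
  show "s \<odot>\<^bsub>ext M\<^esub> tens x t = tens x (s \<otimes>\<^bsub>S\<^esub> t)" if "x \<in> carrier M" "t \<in> carrier S"
    using lift(2)[of x t] that by (simp add: extend_scalars_def Let_def S'_simps)
qed

lemma extend_scalars_module: "module S (ext M)"
proof (rule moduleI)
  note car = extend_scalars_carrier
  show "abelian_group (ext M)"
    by (rule abelian_group_cong[OF T.abelian_group_axioms]) (simp_all add: car)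
  fix s \<xi> assume s: "s \<in> carrier S" and \<xi>: "\<xi> \<in> carrier (ext M)"
  note lin = linear_mapD[OF extend_scalars_smult_linear[OF s]]
  show "s \<odot>\<^bsub>ext M\<^esub> \<xi> \<in> carrier (ext M)"
    using lin \<xi> by (simp add: car)
  obtain x u where x: "x \<in> carrier M" "u \<in> carrier S" "\<xi> = tens x u"
    using simple_tensor \<xi> unfolding car by blast
  fix t assume t: "t \<in> carrier S"
  show "(s \<oplus>\<^bsub>S\<^esub> t) \<odot>\<^bsub>ext M\<^esub> \<xi> =
      s \<odot>\<^bsub>ext M\<^esub> \<xi> \<oplus>\<^bsub>ext M\<^esub> t \<odot>\<^bsub>ext M\<^esub> \<xi>"
    using s t x by (simp add: extend_scalars_smult S.l_distr tens_simps car)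
  show "s \<otimes>\<^bsub>S\<^esub> t \<odot>\<^bsub>ext M\<^esub> \<xi> = s \<odot>\<^bsub>ext M\<^esub> (t \<odot>\<^bsub>ext M\<^esub> \<xi>)"
    using s t x by (simp add: extend_scalars_smult S.m_assoc)
next
  fix \<xi> assume \<xi>: "\<xi> \<in> carrier (ext M)"
  obtain x u where x: "x \<in> carrier M" "u \<in> carrier S" "\<xi> = tens x u"
    using simple_tensor \<xi> unfolding extend_scalars_carrier by blast
  then show "\<one>\<^bsub>S\<^esub> \<odot>\<^bsub>ext M\<^esub> \<xi> = \<xi>" by (simp add: extend_scalars_smult)
qed (auto simp: S.is_cring linear_mapD[OF extend_scalars_smult_linear] extend_scalars_carrier)

lemma extend_scalars_localization: "localization_map M (ext M) (\<lambda>x. tens x \<one>\<^bsub>S\<^esub>)"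
proof -
  note car = extend_scalars_carrier
  have "linear_map R M (restrict_scalars h (ext M)) (\<lambda>x. tens x \<one>\<^bsub>S\<^esub>)"
    by (rule linear_mapI)
      (auto simp: restrict_scalars_def car tens_simps extend_scalars_smult simp flip: tens_simps(5))
  moreover have "\<exists>r\<in>nonzero. \<exists>x\<in>carrier M. h r \<odot>\<^bsub>ext M\<^esub> \<xi> = tens x \<one>\<^bsub>S\<^esub>"
    if \<xi>: "\<xi> \<in> carrier (ext M)" for \<xi>
  proof -
    obtain x r u where x: "x \<in> carrier M" "r \<in> nonzero" "u \<in> carrier S" "h r \<otimes>\<^bsub>S\<^esub> u = \<one>\<^bsub>S\<^esub>" "\<xi> = tens x u"
      using simple_tensor \<xi> car by blast
    then have "h r \<odot>\<^bsub>ext M\<^esub> \<xi> = tens x \<one>\<^bsub>S\<^esub>" by (simp add: extend_scalars_smult)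
    then show ?thesis using x by blast
  qed
  ultimately show ?thesis
    using M extend_scalars_module tens_one_eq_zero by (auto simp: localization_map_def car)
qed

end

text \<open>Both arguments can be written as single tensors, on which the extended map is given by a
formula; bilinearity over \<open>S\<close> and the alternating law are read off from it.\<close>

lemma
  assumes M: "module R M" and N: "module R N" and b: "alternating_bilinear R M N b"
  shows extend_bilinear_alternating:
      "alternating_bilinear S (ext M) (ext N) (extend_bilinear R S h N b)"
    and extend_bilinear_tensor: "x \<in> carrier M \<Longrightarrow> y \<in> carrier M \<Longrightarrow> s \<in> carrier S \<Longrightarrow> t \<in> carrier S \<Longrightarrow>
      extend_bilinear R S h N b (tensor R M S' x s) (tensor R M S' y t) = tensor R N S' (b x y) (s \<otimes>\<^bsub>S\<^esub> t)"
proof -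
  let ?B = "extend_bilinear R S h N b"
  let ?TM = "tensor_module R M S'" and ?TN = "tensor_module R N S'"
  let ?m = "tensor R M S'" and ?n = "tensor R N S'"
  note TN = T_module[OF N]
  interpret M: module R M by fact
  interpret N: module R N by fact
  interpret TN: module R ?TN by fact
  note t = tens_simps[OF N]
  note bD = bilinear_mapD[OF alternating_bilinearD(1)[OF b]]
  define inner where "inner x s = pres_lift R ?TN (\<lambda>(y, t). ?n (b x y) (s \<otimes>\<^bsub>S\<^esub> t))" for x s
  have bil1: "bilinear_map R M S' ?TN (\<lambda>y t. ?n (b x y) (s \<otimes>\<^bsub>S\<^esub> t))" if "x \<in> carrier M" "s \<in> carrier S" for x s
  proof (rule bilinear_mapI)
    fix r y u assume "r \<in> carrier R" "y \<in> carrier M" "u \<in> carrier S'"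
    then show "?n (b x y) (s \<otimes>\<^bsub>S\<^esub> (r \<odot>\<^bsub>S'\<^esub> u)) = r \<odot>\<^bsub>?TN\<^esub> ?n (b x y) (s \<otimes>\<^bsub>S\<^esub> u)"
      using that by (simp add: S'_simps S.m_lcomm[of s] t bD)
  qed (use that in \<open>simp_all add: S'_simps t bD S.r_distr\<close>)
  have inner_lin: "linear_map R ?TM ?TN (inner x s)" if "x \<in> carrier M" "s \<in> carrier S" for x s
    unfolding inner_def by (rule tensor_lift_linear[OF M S'_module TN bil1[OF that]])
  have inner: "inner x s (?m y t) = ?n (b x y) (s \<otimes>\<^bsub>S\<^esub> t)"
    if "x \<in> carrier M" "s \<in> carrier S" "y \<in> carrier M" "t \<in> carrier S" for x s y t
    unfolding inner_def by (rule tensor_lift_tensor[OF M S'_module TN bil1]) (use that S'_simps in auto)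
  have bil2: "bilinear_map R M S' ?TN (\<lambda>x s. inner x s \<eta>)" if \<eta>: "\<eta> \<in> carrier ?TM" for \<eta>
  proof -
    obtain y u where y: "y \<in> carrier M" "u \<in> carrier S" "\<eta> = ?m y u" using simple_tensor[OF M \<eta>] by blast
    show ?thesis unfolding y(3)
      by (rule bilinear_mapI) (use y(1,2) in \<open>simp_all add: S'_simps t bD inner S.l_distr S.m_assoc\<close>)
  qed
  have B: "?B \<xi> \<eta> = pres_lift R ?TN (\<lambda>(x, s). inner x s \<eta>) \<xi>" for \<xi> \<eta>
    by (simp add: extend_bilinear_def inner_def Let_def)
  have lin1: "linear_map R ?TM ?TN (\<lambda>\<xi>. ?B \<xi> \<eta>)" if \<eta>: "\<eta> \<in> carrier ?TM" for \<eta>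
    unfolding B by (rule tensor_lift_linear[OF M S'_module TN bil2[OF that]])
  have B': "?B (?m x s) \<eta> = inner x s \<eta>"
    if "x \<in> carrier M" "s \<in> carrier S" "\<eta> \<in> carrier ?TM" for x s \<eta>
    unfolding B by (rule tensor_lift_tensor[OF M S'_module TN bil2]) (use that S'_simps in auto)
  show tens: "?B (?m x s) (?m y t) = ?n (b x y) (s \<otimes>\<^bsub>S\<^esub> t)"
    if "x \<in> carrier M" "y \<in> carrier M" "s \<in> carrier S" "t \<in> carrier S" for x y s t
    using B' inner that tens_simps(1)[OF M] by simp
  show "alternating_bilinear S (ext M) (ext N) (?B)"
    unfolding alternating_bilinear_def
  proof (intro conjI bilinear_mapI ballI)
    note car = extend_scalars_carrier[OF M] extend_scalars_carrier[OF N]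
    fix \<xi> assume "\<xi> \<in> carrier (ext M)"
    then have \<xi>: "\<xi> \<in> carrier ?TM" by (simp add: car)
    then obtain x s where x: "x \<in> carrier M" "s \<in> carrier S" "\<xi> = ?m x s" using simple_tensor[OF M \<xi>] by blast
    have b0: "b x x = \<zero>\<^bsub>N\<^esub>" using b x by (simp add: alternating_bilinear_def)
    have "?n \<zero>\<^bsub>N\<^esub> (s \<otimes>\<^bsub>S\<^esub> s) = \<zero>\<^bsub>?TN\<^esub>"
      using t(4)[of "\<zero>\<^bsub>N\<^esub>" "s \<otimes>\<^bsub>S\<^esub> s" "\<zero>\<^bsub>R\<^esub>"] x by (simp add: t)
    then show "?B \<xi> \<xi> = \<zero>\<^bsub>ext N\<^esub>"
      unfolding x(3) using x(1,2) by (simp add: tens b0 car)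
    fix \<eta> assume "\<eta> \<in> carrier (ext M)"
    then have \<eta>: "\<eta> \<in> carrier ?TM" by (simp add: car)
    then obtain y u where y: "y \<in> carrier M" "u \<in> carrier S" "\<eta> = ?m y u" using simple_tensor[OF M \<eta>] by blast
    show "?B \<xi> \<eta> \<in> carrier (ext N)"
      using linear_mapD[OF lin1[OF \<eta>]] \<xi> by (simp add: car)
    show "?B (r \<odot>\<^bsub>ext M\<^esub> \<xi>) \<eta> =
       r \<odot>\<^bsub>ext N\<^esub> ?B \<xi> \<eta>" if "r \<in> carrier S" for r
      unfolding x(3) y(3) using x(1,2) y(1,2) that
      by (simp add: extend_scalars_smult M N tens bD S.m_assoc)
    show "?B \<xi> (r \<odot>\<^bsub>ext M\<^esub> \<eta>) =
       r \<odot>\<^bsub>ext N\<^esub> ?B \<xi> \<eta>" if "r \<in> carrier S" for r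
      unfolding x(3) y(3) using x(1,2) y(1,2) that
      by (simp add: extend_scalars_smult M N tens bD S.m_lcomm)
    fix \<zeta> assume "\<zeta> \<in> carrier (ext M)"
    then have \<zeta>: "\<zeta> \<in> carrier ?TM" by (simp add: car)
    show "?B (\<xi> \<oplus>\<^bsub>ext M\<^esub> \<eta>) \<zeta> =
      ?B \<xi> \<zeta> \<oplus>\<^bsub>ext N\<^esub> ?B \<eta> \<zeta>"
      using linear_mapD(2)[OF lin1[OF \<zeta>] \<xi> \<eta>] by (simp add: car)
    show "?B \<xi> (\<eta> \<oplus>\<^bsub>ext M\<^esub> \<zeta>) =
      ?B \<xi> \<eta> \<oplus>\<^bsub>ext N\<^esub> ?B \<xi> \<zeta>"
      using linear_mapD(2)[OF inner_lin[OF x(1,2)] \<eta> \<zeta>] B'[OF x(1,2)] \<eta> \<zeta>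
        module.submoduleD(3)[OF T_module[OF M] module.carrier_is_submodule[OF T_module[OF M]]]
      by (simp add: car x(3))
  qed
qed

end


section \<open>The group \<open>SK\<^sub>1\<close> of a localized Lie algebra\<close>

text \<open>Linear maps agree on a submodule, and the wedges generate.\<close>

lemma ext_power_maps_agree:
  assumes M: "module R M" and N: "module R N"
    and f: "linear_map R (ext_power R k M) N f" and g: "linear_map R (ext_power R k M) N g"
    and eq: "\<And>xs. xs \<in> tuples k M \<Longrightarrow> f (wedge R M xs) = g (wedge R M xs)"
    and \<xi>: "\<xi> \<in> carrier (ext_power R k M)"
  shows "f \<xi> = g \<xi>"
proof -
  let ?W = "ext_power R k M"
  interpret W: module R ?W by (rule ext_power_module[OF M])
  interpret N: module R N by fact
  have "submodule {\<xi> \<in> carrier ?W. f \<xi> = g \<xi>} R ?W"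
    by (rule W.submoduleI')
      (auto simp: linear_mapD[OF f] linear_mapD[OF g] linear_map_zero[OF W.module_axioms N f]
        linear_map_zero[OF W.module_axioms N g])
  moreover have "wedge R M xs \<in> carrier ?W" if "xs \<in> tuples k M" for xs
    using wedge_multilinear[OF M, of k] that by (auto simp: alternating_multilinear_def)
  ultimately have "{\<xi> \<in> carrier ?W. f \<xi> = g \<xi>} = carrier ?W"
    by (intro ext_power_generated[OF M]) (auto simp: eq)
  then show ?thesis using \<xi> by blast
qed

text \<open>The numerator and the denominator in the definition of \<open>SK\<^sub>1\<close>.\<close>

definition SK1_kernel where
  "SK1_kernel R M = {\<xi> \<in> carrier (ext_power R 2 M). bracket_map R M \<xi> = \<zero>\<^bsub>M\<^esub>}"

definition SK1_relations where
  "SK1_relations R M = jacobi_map R M ` carrier (ext_power R 3 M) <+>\<^bsub>ext_power R 2 M\<^esub>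
     mspan R (ext_power R 2 M) (decomposables R M \<inter> SK1_kernel R M)"

lemma SK1_eq:
  "carrier (SK1 R M) = (\<lambda>\<xi>. SK1_relations R M +>\<^bsub>ext_power R 2 M\<^esub> \<xi>) ` SK1_kernel R M"
  "\<zero>\<^bsub>SK1 R M\<^esub> = SK1_relations R M"
proof -
  have "a_kernel (ext_power R 2 M) M (bracket_map R M) = SK1_kernel R M"
    by (simp add: a_kernel_def' SK1_kernel_def)
  then show "\<zero>\<^bsub>SK1 R M\<^esub> = SK1_relations R M"
    "carrier (SK1 R M) = (\<lambda>\<xi>. SK1_relations R M +>\<^bsub>ext_power R 2 M\<^esub> \<xi>) ` SK1_kernel R M"
    by (auto simp: SK1_def Let_def SK1_relations_def quot_module_def A_RCOSETS_def' a_r_coset_def')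
qed

text \<open>An alternating bilinear bracket is what makes \<open>bracket_map\<close> and \<open>jacobi_map\<close> well-defined
linear maps on exterior powers.\<close>

locale bracket_module = module R M for R :: "('a, 'm) ring_scheme" and M :: "('a, 'b, 'n) lie_alg_scheme" +
  assumes bracket: "alternating_bilinear R M M (bracket M)"
begin

abbreviation "W \<equiv> ext_power R 2 M"

lemma W_module: "module R W"
  by (rule ext_power_module[OF module_axioms])

sublocale W: module R W by (rule W_module)

lemma wedge_closed [simp]: "x \<in> carrier M \<Longrightarrow> y \<in> carrier M \<Longrightarrow> wedge R M [x, y] \<in> carrier W"
  using bilinear_mapD(1)[OF alternating_bilinearD(1)[OF wedge_alternating_bilinear[OF module_axioms]]] .

lemma bracket_closed [simp]: "x \<in> carrier M \<Longrightarrow> y \<in> carrier M \<Longrightarrow> bracket M x y \<in> carrier M"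
  using bilinear_mapD(1)[OF alternating_bilinearD(1)[OF bracket]] .

lemma bracket_map_linear: "linear_map R W M (bracket_map R M)"
  and bracket_map_wedge [simp]: "x \<in> carrier M \<Longrightarrow> y \<in> carrier M \<Longrightarrow> bracket_map R M (wedge R M [x, y]) = bracket M x y"
  using ext_lift_linear[OF module_axioms module_axioms alternating_bilinear_imp_multilinear[OF bracket]]
    ext_lift_wedge[OF module_axioms module_axioms alternating_bilinear_imp_multilinear[OF bracket], of "[x, y]"]
  by (auto simp: bracket_map_def tuples_2)

lemma jacobi_map_linear: "linear_map R (ext_power R 3 M) W (jacobi_map R M)"
  and jacobi_map_wedge: "x \<in> carrier M \<Longrightarrow> y \<in> carrier M \<Longrightarrow> z \<in> carrier M \<Longrightarrow>
    jacobi_map R M (wedge R M [x, y, z]) = jacobi_form R M x y z"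
  using ext_lift_linear[OF module_axioms W_module jacobi_form_multilinear[OF module_axioms bracket]]
    ext_lift_wedge[OF module_axioms W_module jacobi_form_multilinear[OF module_axioms bracket], of "[x, y, z]"]
  by (auto simp: jacobi_map_def jacobi_form_def tuples_3)

lemma kernel_submodule: "submodule (SK1_kernel R M) R W"
proof -
  have "submodule {\<xi> \<in> carrier W. bracket_map R M \<xi> \<in> {\<zero>\<^bsub>M\<^esub>}} R W"
    by (rule W.submodule_vimage[OF module_axioms bracket_map_linear]) (auto intro!: submoduleI')
  then show ?thesis by (simp add: SK1_kernel_def)
qed

lemma image_submodule: "submodule (jacobi_map R M ` carrier (ext_power R 3 M)) R W"
  by (rule W.submodule_image[OF ext_power_module[OF module_axioms] jacobi_map_linear])

lemma decomposables_span_submodule: "submodule (mspan R W (decomposables R M \<inter> SK1_kernel R M)) R W"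
  by (rule W.mspan_submodule) (auto simp: SK1_kernel_def)

lemma relations_submodule: "submodule (SK1_relations R M) R W"
  unfolding SK1_relations_def
  by (rule W.submodule_set_add[OF image_submodule decomposables_span_submodule])

lemma wedge3_closed: "x \<in> carrier M \<Longrightarrow> y \<in> carrier M \<Longrightarrow> z \<in> carrier M \<Longrightarrow>
    wedge R M [x, y, z] \<in> carrier (ext_power R 3 M)"
  using wedge_multilinear[OF module_axioms, of 3] by (auto simp: alternating_multilinear_def tuples_3)

lemma jacobi_form_in_relations:
  "x \<in> carrier M \<Longrightarrow> y \<in> carrier M \<Longrightarrow> z \<in> carrier M \<Longrightarrow> jacobi_form R M x y z \<in> SK1_relations R M"
  using W.set_add_superset(1)[OF image_submodule decomposables_span_submodule]
    imageI[OF wedge3_closed[of x y z], of "jacobi_map R M"] jacobi_map_wedge[of x y z]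
  unfolding SK1_relations_def by auto

lemma wedge_in_relations:
  "x \<in> carrier M \<Longrightarrow> y \<in> carrier M \<Longrightarrow> bracket M x y = \<zero>\<^bsub>M\<^esub> \<Longrightarrow> wedge R M [x, y] \<in> SK1_relations R M"
proof -
  assume xy: "x \<in> carrier M" "y \<in> carrier M" "bracket M x y = \<zero>\<^bsub>M\<^esub>"
  then have "wedge R M [x, y] \<in> decomposables R M \<inter> SK1_kernel R M"
    by (auto simp: decomposables_def SK1_kernel_def)
  then show ?thesis
    using W.set_add_superset(2)[OF image_submodule decomposables_span_submodule]
      mspan_superset[of "decomposables R M \<inter> SK1_kernel R M" R W]
    unfolding SK1_relations_def by blast
qed

text \<open>Membership in the relations can be tested on generators: the values of \<open>jacobi_map\<close> on
wedges and the wedges of commuting pairs.\<close>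

lemma relations_least:
  assumes H: "submodule H R W"
    and jacobi: "\<And>x y z. x \<in> carrier M \<Longrightarrow> y \<in> carrier M \<Longrightarrow> z \<in> carrier M \<Longrightarrow> jacobi_form R M x y z \<in> H"
    and decomp: "\<And>x y. x \<in> carrier M \<Longrightarrow> y \<in> carrier M \<Longrightarrow> bracket M x y = \<zero>\<^bsub>M\<^esub> \<Longrightarrow> wedge R M [x, y] \<in> H"
  shows "SK1_relations R M \<subseteq> H"
  unfolding SK1_relations_def
proof (rule W.set_add_least[OF H])
  interpret W3: module R "ext_power R 3 M" by (rule ext_power_module[OF module_axioms])
  have "submodule {\<omega> \<in> carrier (ext_power R 3 M). jacobi_map R M \<omega> \<in> H} R (ext_power R 3 M)"
    by (rule W3.submodule_vimage[OF W_module jacobi_map_linear H])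
  then have "{\<omega> \<in> carrier (ext_power R 3 M). jacobi_map R M \<omega> \<in> H} = carrier (ext_power R 3 M)"
    by (rule ext_power_generated[OF module_axioms]) (auto simp: tuples_3 jacobi_map_wedge jacobi wedge3_closed)
  then show "jacobi_map R M ` carrier (ext_power R 3 M) \<subseteq> H" by blast
  show "mspan R W (decomposables R M \<inter> SK1_kernel R M) \<subseteq> H"
    by (rule mspan_least[OF H]) (auto simp: decomposables_def SK1_kernel_def decomp)
qed

lemma SK1_trivial_iff:
  "carrier (SK1 R M) = {\<zero>\<^bsub>SK1 R M\<^esub>} \<longleftrightarrow> SK1_kernel R M \<subseteq> SK1_relations R M"
proof -
  have zero: "\<zero>\<^bsub>W\<^esub> \<in> SK1_kernel R M" by (rule W.submoduleD(2)[OF kernel_submodule])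
  have "SK1_relations R M +>\<^bsub>W\<^esub> \<xi> = SK1_relations R M \<longleftrightarrow> \<xi> \<in> SK1_relations R M" if "\<xi> \<in> SK1_kernel R M" for \<xi>
    using W.quot_map_eq_zero_iff[OF relations_submodule W.submoduleD(1)[OF kernel_submodule that]]
    by (simp add: quot_module_def)
  then show ?thesis using zero unfolding SK1_eq by blast
qed

end

context scalar_localization
begin

lemma linear_map_restrict:
  "linear_map S A B f \<Longrightarrow> linear_map R (restrict_scalars h A) (restrict_scalars h B) f"
  by (auto simp: linear_map_def restrict_scalars_def)

lemma restrict_simps:
  "carrier (restrict_scalars h N) = carrier N" "add (restrict_scalars h N) = add N"
  "\<zero>\<^bsub>restrict_scalars h N\<^esub> = \<zero>\<^bsub>N\<^esub>" "r \<odot>\<^bsub>restrict_scalars h N\<^esub> x = h r \<odot>\<^bsub>N\<^esub> x"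
  by (simp_all add: restrict_scalars_def)

text \<open>The elements of \<open>N\<close> with a multiple in the image of \<open>J\<close> make up the \<open>S\<close>-span of that image.
As they form a submodule, inclusions into this set can be checked on generators.\<close>

lemma saturation_submodule:
  assumes M: "module R M" and N: "module S N" and j: "linear_map R M (restrict_scalars h N) j"
    and J: "submodule J R M"
  shows "submodule {y \<in> carrier N. \<exists>r\<in>nonzero. \<exists>x\<in>J. h r \<odot>\<^bsub>N\<^esub> y = j x} S N"
    (is "submodule ?H S N")
proof -
  interpret M: module R M by fact
  interpret N: module S N by fact
  note jD = linear_mapD[OF j, unfolded restrict_simps] and JD = M.submoduleD[OF J]
  show ?thesis
  proof (rule N.submoduleI')
    show "?H \<subseteq> carrier N" by auto
    have "h \<one>\<^bsub>R\<^esub> \<odot>\<^bsub>N\<^esub> \<zero>\<^bsub>N\<^esub> = j \<zero>\<^bsub>M\<^esub>"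
      using linear_map_zero[OF M restrict_scalars_module[OF N] j] by (simp add: restrict_simps)
    then show "\<zero>\<^bsub>N\<^esub> \<in> ?H" using JD(2) one_nonzero by blast
  next
    fix y z assume "y \<in> ?H" "z \<in> ?H"
    then obtain r s a b where *: "y \<in> carrier N" "z \<in> carrier N" "r \<in> nonzero" "s \<in> nonzero"
      "a \<in> J" "b \<in> J" "h r \<odot>\<^bsub>N\<^esub> y = j a" "h s \<odot>\<^bsub>N\<^esub> z = j b" by blast
    have rs: "h (r \<otimes>\<^bsub>R\<^esub> s) = h s \<otimes>\<^bsub>S\<^esub> h r" "h (r \<otimes>\<^bsub>R\<^esub> s) = h r \<otimes>\<^bsub>S\<^esub> h s"
      using * by (simp_all add: S.m_comm)
    have "h (r \<otimes>\<^bsub>R\<^esub> s) \<odot>\<^bsub>N\<^esub> y = h s \<odot>\<^bsub>N\<^esub> (h r \<odot>\<^bsub>N\<^esub> y)"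
      unfolding rs(1) by (rule N.smult_assoc1) (use * in auto)
    moreover have "h (r \<otimes>\<^bsub>R\<^esub> s) \<odot>\<^bsub>N\<^esub> z = h r \<odot>\<^bsub>N\<^esub> (h s \<odot>\<^bsub>N\<^esub> z)"
      unfolding rs(2) by (rule N.smult_assoc1) (use * in auto)
    moreover have "h (r \<otimes>\<^bsub>R\<^esub> s) \<in> carrier S" using * by simp
    ultimately have "h (r \<otimes>\<^bsub>R\<^esub> s) \<odot>\<^bsub>N\<^esub> (y \<oplus>\<^bsub>N\<^esub> z) = j (s \<odot>\<^bsub>M\<^esub> a \<oplus>\<^bsub>M\<^esub> r \<odot>\<^bsub>M\<^esub> b)"
      using * JD(1) jD by (simp add: N.smult_r_distr del: h_simps(3))
    moreover have "s \<odot>\<^bsub>M\<^esub> a \<oplus>\<^bsub>M\<^esub> r \<odot>\<^bsub>M\<^esub> b \<in> J" using * JD by blast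
    moreover have "y \<oplus>\<^bsub>N\<^esub> z \<in> carrier N" using * by simp
    ultimately show "y \<oplus>\<^bsub>N\<^esub> z \<in> ?H" using R.nonzero_mult[OF *(3,4)] by blast
  next
    fix s y assume s: "s \<in> carrier S" and "y \<in> ?H"
    then obtain r x where *: "y \<in> carrier N" "r \<in> nonzero" "x \<in> J" "h r \<odot>\<^bsub>N\<^esub> y = j x" by blast
    obtain b a where ba: "b \<in> nonzero" "a \<in> carrier R" "h b \<otimes>\<^bsub>S\<^esub> s = h a" using denominator[OF s] by blast
    have "h (b \<otimes>\<^bsub>R\<^esub> r) \<otimes>\<^bsub>S\<^esub> s = (h b \<otimes>\<^bsub>S\<^esub> s) \<otimes>\<^bsub>S\<^esub> h r"
      using * ba(1,2) s S.m_comm[of "h r" s] S.m_assoc[of "h b" s "h r"] S.m_assoc[of "h b" "h r" s] by simp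
    then have eq: "h (b \<otimes>\<^bsub>R\<^esub> r) \<otimes>\<^bsub>S\<^esub> s = h a \<otimes>\<^bsub>S\<^esub> h r" by (simp only: ba(3))
    have "h (b \<otimes>\<^bsub>R\<^esub> r) \<odot>\<^bsub>N\<^esub> (s \<odot>\<^bsub>N\<^esub> y) = (h (b \<otimes>\<^bsub>R\<^esub> r) \<otimes>\<^bsub>S\<^esub> s) \<odot>\<^bsub>N\<^esub> y"
      by (rule N.smult_assoc1[symmetric]) (use * ba s in auto)
    also have "\<dots> = h a \<odot>\<^bsub>N\<^esub> (h r \<odot>\<^bsub>N\<^esub> y)"
      unfolding eq by (rule N.smult_assoc1) (use * ba in auto)
    also have "\<dots> = j (a \<odot>\<^bsub>M\<^esub> x)" using * ba jD JD(1) by simp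
    finally have "h (b \<otimes>\<^bsub>R\<^esub> r) \<odot>\<^bsub>N\<^esub> (s \<odot>\<^bsub>N\<^esub> y) = j (a \<odot>\<^bsub>M\<^esub> x)" .
    moreover have "a \<odot>\<^bsub>M\<^esub> x \<in> J" using * ba JD by blast
    moreover have "s \<odot>\<^bsub>N\<^esub> y \<in> carrier N" using * s by simp
    ultimately show "s \<odot>\<^bsub>N\<^esub> y \<in> ?H" using R.nonzero_mult[OF ba(1) *(2)] by blast
  qed
qed

lemma unscale:
  assumes N: "module S N" and H: "submodule H S N"
    and r: "r \<in> nonzero" and y: "y \<in> carrier N" "h r \<odot>\<^bsub>N\<^esub> y \<in> H"
  shows "y \<in> H"
proof -
  interpret N: module S N by fact
  obtain u where u: "u \<in> carrier S" "h r \<otimes>\<^bsub>S\<^esub> u = \<one>\<^bsub>S\<^esub>" using invertible[OF r] by blast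
  have "u \<odot>\<^bsub>N\<^esub> (h r \<odot>\<^bsub>N\<^esub> y) = y" using u r y(1) by (simp add: S.m_comm[of u] flip: N.smult_assoc1)
  then show ?thesis using N.submoduleD(4)[OF H u(1) y(2)] by simp
qed

end

locale localized_bracket_module = scalar_localization R S h + bracket_module R M
  for R :: "('a, 'm) ring_scheme" and S :: "('c, 'k) ring_scheme" and h
    and M :: "('a, 'b, 'n) lie_alg_scheme"
begin

abbreviation "MS \<equiv> base_change R S h M"
abbreviation "j \<equiv> \<lambda>x. tensor R M S' x \<one>\<^bsub>S\<^esub>"

lemma MS_simps:
  "carrier MS = carrier (ext M)" "add MS = add (ext M)"
  "\<zero>\<^bsub>MS\<^esub> = \<zero>\<^bsub>ext M\<^esub>" "smult MS = smult (ext M)"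
  "bracket MS = extend_bilinear R S h M (bracket M)"
  by (simp_all add: base_change_def extend_scalars_def extend_bilinear_def Let_def)

lemma MS_module: "module S MS"
  by (rule module_cong[OF extend_scalars_module[OF module_axioms]]) (simp_all add: MS_simps)

lemma MS_localization: "localization_map M MS j"
  using extend_scalars_localization[OF module_axioms] MS_module
  by (simp add: localization_map_def restrict_scalars_def MS_simps)

lemma alternating_bilinear_MS:
  assumes "module R N" "alternating_bilinear R M N b"
  shows "alternating_bilinear S MS (ext N) (extend_bilinear R S h N b)"
  using extend_bilinear_alternating[OF module_axioms assms]
  by (simp add: alternating_bilinear_def bilinear_map_def linear_map_def MS_simps)

sublocale MS: bracket_module S MS
proof -
  interpret MS: module S MS by (rule MS_module)
  show "bracket_module S MS"
    by unfold_locales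
      (use alternating_bilinear_MS[OF module_axioms bracket]
        in \<open>simp add: alternating_bilinear_def bilinear_map_def linear_map_def MS_simps\<close>)
qed

lemma j_linear: "linear_map R M (restrict_scalars h MS) j"
  and j_denominator: "y \<in> carrier MS \<Longrightarrow> \<exists>r\<in>nonzero. \<exists>x\<in>carrier M. h r \<odot>\<^bsub>MS\<^esub> y = j x"
  and j_kernel: "x \<in> carrier M \<Longrightarrow> j x = \<zero>\<^bsub>MS\<^esub> \<Longrightarrow> \<exists>r\<in>nonzero. r \<odot>\<^bsub>M\<^esub> x = \<zero>\<^bsub>M\<^esub>"
  using MS_localization by (auto simp: localization_map_def)

lemmas jD = linear_mapD[OF j_linear, unfolded restrict_simps]

lemma bracket_j: "x \<in> carrier M \<Longrightarrow> y \<in> carrier M \<Longrightarrow> bracket MS (j x) (j y) = j (bracket M x y)"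
  using extend_bilinear_tensor[OF module_axioms module_axioms bracket] by (simp add: MS_simps)

lemmas MS_R_module = restrict_scalars_module[OF MS_module]
  and MSW_R_module = restrict_scalars_module[OF MS.W_module]

text \<open>The comparison map \<open>x \<and> y \<mapsto> (x \<otimes> 1) \<and> (y \<otimes> 1)\<close> between the exterior squares over \<open>R\<close> and
over \<open>S\<close>. The lemmas \<open>\<iota>_denominator\<close> and \<open>\<iota>_kernel\<close> show that it is again a localization,
in other words that exterior squares commute with localization.\<close>

definition \<iota> where
  "\<iota> = pres_lift R (restrict_scalars h MS.W) (\<lambda>xs. wedge S MS [j (xs ! 0), j (xs ! 1)])"

lemma \<iota>_linear: "linear_map R W (restrict_scalars h MS.W) \<iota>"
  and \<iota>_wedge: "x \<in> carrier M \<Longrightarrow> y \<in> carrier M \<Longrightarrow> \<iota> (wedge R M [x, y]) = wedge S MS [j x, j y]"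
proof -
  note b = wedge_alternating_bilinear[OF MS_module, unfolded alternating_bilinear_def]
  note bD = bilinear_mapD[OF conjunct1[OF b]]
  have "alternating_bilinear R M (restrict_scalars h MS.W) (\<lambda>x y. wedge S MS [j x, j y])"
    unfolding alternating_bilinear_def
    by (intro conjI bilinear_mapI) (use b in \<open>auto simp: restrict_simps jD bD\<close>)
  note mult = alternating_bilinear_imp_multilinear[OF this]
  show "linear_map R W (restrict_scalars h MS.W) \<iota>"
    unfolding \<iota>_def by (rule ext_lift_linear[OF module_axioms MSW_R_module mult])
  show "\<iota> (wedge R M [x, y]) = wedge S MS [j x, j y]" if "x \<in> carrier M" "y \<in> carrier M"
    unfolding \<iota>_def
    by (subst ext_lift_wedge[OF module_axioms MSW_R_module mult])
      (use that in \<open>auto simp: tuples_2\<close>)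
qed

lemmas \<iota>D = linear_mapD[OF \<iota>_linear, unfolded restrict_simps]

lemma wedge_denominator:
  assumes "y \<in> carrier MS" "z \<in> carrier MS"
  obtains r a b where "r \<in> nonzero" "a \<in> carrier M" "b \<in> carrier M"
    "h r \<odot>\<^bsub>MS.W\<^esub> wedge S MS [y, z] = \<iota> (wedge R M [a, b])"
    "h r \<odot>\<^bsub>MS\<^esub> bracket MS y z = j (bracket M a b)"
proof -
  obtain r a where a: "r \<in> nonzero" "a \<in> carrier M" "h r \<odot>\<^bsub>MS\<^esub> y = j a"
    using j_denominator assms(1) by blast
  obtain s b where b: "s \<in> nonzero" "b \<in> carrier M" "h s \<odot>\<^bsub>MS\<^esub> z = j b"
    using j_denominator assms(2) by blast
  have scale: "h (r \<otimes>\<^bsub>R\<^esub> s) \<odot>\<^bsub>N\<^esub> B y z = B (j a) (j b)"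
    if N: "module S N" and B: "alternating_bilinear S MS N B" for N :: "('c, 'y, 'z) module_scheme" and B
  proof -
    interpret N: module S N by fact
    note D = bilinear_mapD[OF alternating_bilinearD(1)[OF B]]
    have "h (r \<otimes>\<^bsub>R\<^esub> s) \<odot>\<^bsub>N\<^esub> B y z = h r \<odot>\<^bsub>N\<^esub> (h s \<odot>\<^bsub>N\<^esub> B y z)"
      using a b assms D by (simp add: N.smult_assoc1)
    also have "h s \<odot>\<^bsub>N\<^esub> B y z = B y (h s \<odot>\<^bsub>MS\<^esub> z)"
      by (rule D(5)[symmetric]) (use b(1) assms in auto)
    also have "h r \<odot>\<^bsub>N\<^esub> \<dots> = B (h r \<odot>\<^bsub>MS\<^esub> y) (h s \<odot>\<^bsub>MS\<^esub> z)"
      by (rule D(4)[symmetric]) (use a(1) b(1) assms in auto)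
    finally show ?thesis using a b by simp
  qed
  show thesis
  proof (rule that[OF R.nonzero_mult[OF a(1) b(1)] a(2) b(2)])
    show "h (r \<otimes>\<^bsub>R\<^esub> s) \<odot>\<^bsub>MS.W\<^esub> wedge S MS [y, z] = \<iota> (wedge R M [a, b])"
      using scale[OF MS.W_module wedge_alternating_bilinear[OF MS_module]] a b by (simp add: \<iota>_wedge)
    show "h (r \<otimes>\<^bsub>R\<^esub> s) \<odot>\<^bsub>MS\<^esub> bracket MS y z = j (bracket M a b)"
      using scale[OF MS_module MS.bracket] a b by (simp add: bracket_j)
  qed
qed

lemma \<iota>_denominator:
  assumes "\<eta> \<in> carrier MS.W"
  shows "\<exists>r\<in>nonzero. \<exists>\<xi>\<in>carrier W. h r \<odot>\<^bsub>MS.W\<^esub> \<eta> = \<iota> \<xi>"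
proof -
  let ?H = "{y \<in> carrier MS.W. \<exists>r\<in>nonzero. \<exists>x\<in>carrier W. h r \<odot>\<^bsub>MS.W\<^esub> y = \<iota> x}"
  have "submodule ?H S MS.W"
    by (rule saturation_submodule[OF W_module MS.W_module \<iota>_linear W.carrier_is_submodule])
  then have "?H = carrier MS.W"
  proof (rule ext_power_generated[OF MS_module])
    fix xs assume "xs \<in> tuples 2 MS"
    then obtain y z where yz: "y \<in> carrier MS" "z \<in> carrier MS" "xs = [y, z]" by (auto simp: tuples_2)
    obtain r a b where "r \<in> nonzero" "a \<in> carrier M" "b \<in> carrier M"
      "h r \<odot>\<^bsub>MS.W\<^esub> wedge S MS [y, z] = \<iota> (wedge R M [a, b])"
      by (rule wedge_denominator[OF yz(1,2)])
    then show "wedge S MS xs \<in> ?H"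
      using wedge_closed[of a b] MS.wedge_closed[OF yz(1,2)] yz(3) by blast
  qed
  then show ?thesis using assms by blast
qed

text \<open>The wedge product on \<open>M\<close> extends to an alternating map on the localization of \<open>M\<close> with values
in the localization of the exterior square. It induces a map \<open>\<tau>\<close> from the exterior square
over \<open>S\<close>, and \<open>\<tau> \<circ> \<iota>\<close> is \<open>\<xi> \<mapsto> \<xi> \<otimes> 1\<close>, which has only torsion in its kernel.\<close>

lemma \<iota>_kernel:
  assumes \<xi>: "\<xi> \<in> carrier W" and "\<iota> \<xi> = \<zero>\<^bsub>MS.W\<^esub>"
  shows "\<exists>r\<in>nonzero. r \<odot>\<^bsub>W\<^esub> \<xi> = \<zero>\<^bsub>W\<^esub>"
proof -
  let ?WS = "ext W"
  let ?jW = "\<lambda>x. tensor R W S' x \<one>\<^bsub>S\<^esub>"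
  let ?w = "\<lambda>x y. wedge R M [x, y]"
  let ?b = "extend_bilinear R S h W ?w"
  have WS: "module S ?WS" by (rule extend_scalars_module[OF W_module])
  note w = wedge_alternating_bilinear[OF module_axioms]
  note mult = alternating_bilinear_imp_multilinear[OF alternating_bilinear_MS[OF W_module w]]
  define \<tau> where "\<tau> = pres_lift S ?WS (\<lambda>xs. ?b (xs ! 0) (xs ! 1))"
  have \<tau>: "linear_map S MS.W ?WS \<tau>" unfolding \<tau>_def by (rule ext_lift_linear[OF MS_module WS mult])
  have \<tau>_wedge: "\<tau> (wedge S MS [y, z]) = ?b y z" if "y \<in> carrier MS" "z \<in> carrier MS" for y z
    unfolding \<tau>_def by (subst ext_lift_wedge[OF MS_module WS mult]) (use that in \<open>auto simp: tuples_2\<close>)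
  have loc: "localization_map W ?WS ?jW" by (rule extend_scalars_localization[OF W_module])
  have "\<tau> (\<iota> \<xi>) = ?jW \<xi>"
  proof (rule ext_power_maps_agree[OF module_axioms restrict_scalars_module[OF WS] _ _ _ \<xi>])
    show "linear_map R W (restrict_scalars h ?WS) (\<lambda>\<xi>. \<tau> (\<iota> \<xi>))"
      by (rule linear_map_comp[OF \<iota>_linear linear_map_restrict[OF \<tau>]])
    show "linear_map R W (restrict_scalars h ?WS) ?jW" using loc by (simp add: localization_map_def)
    fix xs assume "xs \<in> tuples 2 M"
    then show "\<tau> (\<iota> (wedge R M xs)) = ?jW (wedge R M xs)"
      using extend_bilinear_tensor[OF module_axioms W_module w]
      by (auto simp: tuples_2 \<iota>_wedge \<tau>_wedge jD)
  qed
  moreover have "\<tau> \<zero>\<^bsub>MS.W\<^esub> = \<zero>\<^bsub>?WS\<^esub>" by (rule linear_map_zero[OF MS.W_module WS \<tau>])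
  ultimately show ?thesis using loc assms by (simp add: localization_map_def)
qed

lemma bracket_map_\<iota>:
  assumes \<xi>: "\<xi> \<in> carrier W"
  shows "bracket_map S MS (\<iota> \<xi>) = j (bracket_map R M \<xi>)"
proof (rule ext_power_maps_agree[OF module_axioms MS_R_module _ _ _ \<xi>])
  show "linear_map R W (restrict_scalars h MS) (\<lambda>\<xi>. bracket_map S MS (\<iota> \<xi>))"
    by (rule linear_map_comp[OF \<iota>_linear linear_map_restrict[OF MS.bracket_map_linear]])
  show "linear_map R W (restrict_scalars h MS) (\<lambda>\<xi>. j (bracket_map R M \<xi>))"
    by (rule linear_map_comp[OF bracket_map_linear j_linear])
  fix xs assume "xs \<in> tuples 2 M"
  then show "bracket_map S MS (\<iota> (wedge R M xs)) = j (bracket_map R M (wedge R M xs))"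
    by (auto simp: tuples_2 \<iota>_wedge jD bracket_j)
qed

lemma jacobi_form_j:
  "x \<in> carrier M \<Longrightarrow> y \<in> carrier M \<Longrightarrow> z \<in> carrier M \<Longrightarrow>
    jacobi_form S MS (j x) (j y) (j z) = \<iota> (jacobi_form R M x y z)"
  by (simp add: jacobi_form_def bracket_j \<iota>D \<iota>_wedge)

lemma jacobi_form_denominator:
  assumes "x \<in> carrier MS" "y \<in> carrier MS" "z \<in> carrier MS"
  obtains r a b c where "r \<in> nonzero" "a \<in> carrier M" "b \<in> carrier M" "c \<in> carrier M"
    "h r \<odot>\<^bsub>MS.W\<^esub> jacobi_form S MS x y z = \<iota> (jacobi_form R M a b c)"
proof -
  obtain r a where a: "r \<in> nonzero" "a \<in> carrier M" "h r \<odot>\<^bsub>MS\<^esub> x = j a"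
    using j_denominator assms(1) by blast
  obtain s b where b: "s \<in> nonzero" "b \<in> carrier M" "h s \<odot>\<^bsub>MS\<^esub> y = j b"
    using j_denominator assms(2) by blast
  obtain t c where c: "t \<in> nonzero" "c \<in> carrier M" "h t \<odot>\<^bsub>MS\<^esub> z = j c"
    using j_denominator assms(3) by blast
  note mult = jacobi_form_multilinear[OF MS_module MS.bracket, unfolded alternating_multilinear_def]
  have lin: "linear_map S MS MS.W (\<lambda>u. jacobi_form S MS ([p, q, w][i := u] ! 0) ([p, q, w][i := u] ! 1) ([p, q, w][i := u] ! 2))"
    if "p \<in> carrier MS" "q \<in> carrier MS" "w \<in> carrier MS" "i < 3" for p q w i
  proof -
    have "[p, q, w] \<in> tuples 3 MS" using that by (auto simp: tuples_3)
    then show ?thesis using mult that(4) by blast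
  qed
  have l: "jacobi_form S MS p q w \<in> carrier MS.W"
    "u \<in> carrier S \<Longrightarrow> jacobi_form S MS (u \<odot>\<^bsub>MS\<^esub> p) q w = u \<odot>\<^bsub>MS.W\<^esub> jacobi_form S MS p q w"
    "u \<in> carrier S \<Longrightarrow> jacobi_form S MS p (u \<odot>\<^bsub>MS\<^esub> q) w = u \<odot>\<^bsub>MS.W\<^esub> jacobi_form S MS p q w"
    "u \<in> carrier S \<Longrightarrow> jacobi_form S MS p q (u \<odot>\<^bsub>MS\<^esub> w) = u \<odot>\<^bsub>MS.W\<^esub> jacobi_form S MS p q w"
    if "p \<in> carrier MS" "q \<in> carrier MS" "w \<in> carrier MS" for p q w u
    using linear_mapD(1)[OF lin[OF that, of 0]] linear_mapD(3)[OF lin[OF that, of 0]]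
      linear_mapD(3)[OF lin[OF that, of 1]] linear_mapD(3)[OF lin[OF that, of 2]] that by simp_all
  have "h (r \<otimes>\<^bsub>R\<^esub> s \<otimes>\<^bsub>R\<^esub> t) \<odot>\<^bsub>MS.W\<^esub> jacobi_form S MS x y z =
      h r \<odot>\<^bsub>MS.W\<^esub> (h s \<odot>\<^bsub>MS.W\<^esub> (h t \<odot>\<^bsub>MS.W\<^esub> jacobi_form S MS x y z))"
    using a b c assms l(1) by (simp add: MS.W.smult_assoc1)
  also have "h t \<odot>\<^bsub>MS.W\<^esub> jacobi_form S MS x y z = jacobi_form S MS x y (h t \<odot>\<^bsub>MS\<^esub> z)"
    by (rule l(4)[symmetric]) (use c(1) assms in auto)
  also have "h s \<odot>\<^bsub>MS.W\<^esub> \<dots> = jacobi_form S MS x (h s \<odot>\<^bsub>MS\<^esub> y) (h t \<odot>\<^bsub>MS\<^esub> z)"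
    by (rule l(3)[symmetric]) (use b(1) c(1) assms in auto)
  also have "h r \<odot>\<^bsub>MS.W\<^esub> \<dots> = jacobi_form S MS (h r \<odot>\<^bsub>MS\<^esub> x) (h s \<odot>\<^bsub>MS\<^esub> y) (h t \<odot>\<^bsub>MS\<^esub> z)"
    by (rule l(2)[symmetric]) (use a(1) b(1) c(1) assms in auto)
  also have "\<dots> = \<iota> (jacobi_form R M a b c)" using a b c by (simp add: jacobi_form_j)
  finally show thesis
    by (rule that[OF R.nonzero_mult[OF R.nonzero_mult[OF a(1) b(1)] c(1)] a(2) b(2) c(2)])
qed

text \<open>Up to nonzero scalars, the kernel of the bracket map and the relations over \<open>S\<close> are the images
under \<open>\<iota>\<close> of those over \<open>R\<close>. Hence \<open>SK\<^sub>1\<close> over \<open>S\<close> is the localization of \<open>SK\<^sub>1\<close> over \<open>R\<close>, and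
it vanishes exactly if \<open>SK\<^sub>1\<close> over \<open>R\<close> is a torsion module.\<close>

theorem SK1_localized_trivial_iff:
  "carrier (SK1 S MS) = {\<zero>\<^bsub>SK1 S MS\<^esub>} \<longleftrightarrow>
    (\<forall>\<xi>\<in>SK1_kernel R M. \<exists>r\<in>nonzero. r \<odot>\<^bsub>W\<^esub> \<xi> \<in> SK1_relations R M)"
proof -
  let ?J = "SK1_relations R M" and ?JS = "SK1_relations S MS"
  note J = W.submoduleD[OF relations_submodule]
  have zero\<iota>: "\<iota> \<zero>\<^bsub>W\<^esub> = \<zero>\<^bsub>MS.W\<^esub>"
    using linear_map_zero[OF W_module MSW_R_module \<iota>_linear] by (simp add: restrict_simps)
  show ?thesis
    unfolding MS.SK1_trivial_iff
  proof (intro iffI ballI subsetI)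
    fix \<xi> assume sub: "SK1_kernel S MS \<subseteq> ?JS" and \<xi>: "\<xi> \<in> SK1_kernel R M"
    let ?H = "{\<eta> \<in> carrier MS.W. \<exists>r\<in>nonzero. \<exists>x\<in>?J. h r \<odot>\<^bsub>MS.W\<^esub> \<eta> = \<iota> x}"
    have W\<xi>: "\<xi> \<in> carrier W" using \<xi> by (simp add: SK1_kernel_def)
    have "?JS \<subseteq> ?H"
    proof (rule MS.relations_least)
      show "submodule ?H S MS.W"
        by (rule saturation_submodule[OF W_module MS.W_module \<iota>_linear relations_submodule])
    next
      fix x y z assume xyz: "x \<in> carrier MS" "y \<in> carrier MS" "z \<in> carrier MS"
      obtain r a b c where *: "r \<in> nonzero" "a \<in> carrier M" "b \<in> carrier M" "c \<in> carrier M"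
        "h r \<odot>\<^bsub>MS.W\<^esub> jacobi_form S MS x y z = \<iota> (jacobi_form R M a b c)"
        by (rule jacobi_form_denominator[OF xyz])
      then show "jacobi_form S MS x y z \<in> ?H"
        using jacobi_form_in_relations[OF *(2-4)]
          MS.W.submoduleD(1)[OF MS.relations_submodule MS.jacobi_form_in_relations[OF xyz]] by blast
    next
      fix x y assume xy: "x \<in> carrier MS" "y \<in> carrier MS" "bracket MS x y = \<zero>\<^bsub>MS\<^esub>"
      obtain r a b where *: "r \<in> nonzero" "a \<in> carrier M" "b \<in> carrier M"
        "h r \<odot>\<^bsub>MS.W\<^esub> wedge S MS [x, y] = \<iota> (wedge R M [a, b])"
        "h r \<odot>\<^bsub>MS\<^esub> bracket MS x y = j (bracket M a b)"
        using wedge_denominator[OF xy(1,2)] by blast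
      then have "j (bracket M a b) = \<zero>\<^bsub>MS\<^esub>" using xy by simp
      then obtain s where s: "s \<in> nonzero" "s \<odot>\<^bsub>M\<^esub> bracket M a b = \<zero>\<^bsub>M\<^esub>"
        using j_kernel[of "bracket M a b"] * by auto
      note D = bilinear_mapD(4)[OF alternating_bilinearD(1)[OF bracket]]
        bilinear_mapD(4)[OF alternating_bilinearD(1)[OF wedge_alternating_bilinear[OF module_axioms]]]
      \<comment> \<open>Absorbing \<open>s\<close> into the first factor turns \<open>a \<and> b\<close> into the wedge of a commuting pair.\<close>
      have "wedge R M [s \<odot>\<^bsub>M\<^esub> a, b] \<in> ?J" using s * by (intro wedge_in_relations) (simp_all add: D)
      moreover have "h (s \<otimes>\<^bsub>R\<^esub> r) \<odot>\<^bsub>MS.W\<^esub> wedge S MS [x, y] = \<iota> (wedge R M [s \<odot>\<^bsub>M\<^esub> a, b])"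
        using s * xy by (simp add: MS.W.smult_assoc1 D \<iota>D)
      ultimately show "wedge S MS [x, y] \<in> ?H"
        using R.nonzero_mult[OF s(1) *(1)] MS.wedge_closed[OF xy(1,2)] by blast
    qed
    moreover have "\<iota> \<xi> \<in> SK1_kernel S MS"
      using \<xi> W\<xi> linear_map_zero[OF module_axioms MS_R_module j_linear]
      by (simp add: SK1_kernel_def bracket_map_\<iota> \<iota>D restrict_simps)
    ultimately obtain r x where r: "r \<in> nonzero" "x \<in> ?J" "h r \<odot>\<^bsub>MS.W\<^esub> \<iota> \<xi> = \<iota> x"
      using sub by blast
    then have "\<iota> (r \<odot>\<^bsub>W\<^esub> \<xi> \<ominus>\<^bsub>W\<^esub> x) = \<zero>\<^bsub>MS.W\<^esub>"
      using linear_map_minus[OF W_module MSW_R_module \<iota>_linear, of "r \<odot>\<^bsub>W\<^esub> \<xi>" x] W\<xi> J(1)[OF r(2)]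
        module.diff_eq_zero_iff[OF MSW_R_module, of "\<iota> x" "\<iota> x"]
      by (simp add: restrict_simps \<iota>D)
    then obtain s where s: "s \<in> nonzero" "s \<odot>\<^bsub>W\<^esub> (r \<odot>\<^bsub>W\<^esub> \<xi> \<ominus>\<^bsub>W\<^esub> x) = \<zero>\<^bsub>W\<^esub>"
      using \<iota>_kernel[of "r \<odot>\<^bsub>W\<^esub> \<xi> \<ominus>\<^bsub>W\<^esub> x"] r W\<xi> J(1) by auto
    have "r \<odot>\<^bsub>W\<^esub> \<xi> = (r \<odot>\<^bsub>W\<^esub> \<xi> \<ominus>\<^bsub>W\<^esub> x) \<oplus>\<^bsub>W\<^esub> x"
      using r W\<xi> J(1)[OF r(2)] by (simp add: a_minus_def W.M.add.m_assoc W.M.l_neg)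
    then have "(s \<otimes>\<^bsub>R\<^esub> r) \<odot>\<^bsub>W\<^esub> \<xi> = s \<odot>\<^bsub>W\<^esub> ((r \<odot>\<^bsub>W\<^esub> \<xi> \<ominus>\<^bsub>W\<^esub> x) \<oplus>\<^bsub>W\<^esub> x)"
      using s r W\<xi> by (simp add: W.smult_assoc1)
    also have "\<dots> = s \<odot>\<^bsub>W\<^esub> x"
      using s r W\<xi> J(1)[OF r(2)] by (simp add: W.smult_r_distr)
    finally have "(s \<otimes>\<^bsub>R\<^esub> r) \<odot>\<^bsub>W\<^esub> \<xi> \<in> ?J" using J(4) s r by simp
    then show "\<exists>r\<in>nonzero. r \<odot>\<^bsub>W\<^esub> \<xi> \<in> ?J" using R.nonzero_mult[OF s(1) r(1)] by blast
  next
    fix \<eta> assume tors: "\<forall>\<xi>\<in>SK1_kernel R M. \<exists>r\<in>nonzero. r \<odot>\<^bsub>W\<^esub> \<xi> \<in> ?J"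
      and \<eta>: "\<eta> \<in> SK1_kernel S MS"
    have W\<eta>: "\<eta> \<in> carrier MS.W" "bracket_map S MS \<eta> = \<zero>\<^bsub>MS\<^esub>" using \<eta> by (simp_all add: SK1_kernel_def)
    note JS = MS.W.submoduleD[OF MS.relations_submodule]
    have JS_R: "submodule {\<xi> \<in> carrier W. \<iota> \<xi> \<in> ?JS} R W"
    proof (rule W.submodule_vimage[OF MSW_R_module \<iota>_linear])
      interpret RW: module R "restrict_scalars h MS.W" by (rule MSW_R_module)
      show "submodule ?JS R (restrict_scalars h MS.W)"
        by (rule RW.submoduleI') (auto simp: restrict_simps JS)
    qed
    have "?J \<subseteq> {\<xi> \<in> carrier W. \<iota> \<xi> \<in> ?JS}"
    proof (rule relations_least[OF JS_R])
      fix x y z assume xyz: "x \<in> carrier M" "y \<in> carrier M" "z \<in> carrier M"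
      then have "jacobi_form S MS (j x) (j y) (j z) \<in> ?JS" by (intro MS.jacobi_form_in_relations jD)
      then show "jacobi_form R M x y z \<in> {\<xi> \<in> carrier W. \<iota> \<xi> \<in> ?JS}"
        using xyz J(1)[OF jacobi_form_in_relations[OF xyz]] by (simp add: jacobi_form_j)
    next
      fix x y assume xy: "x \<in> carrier M" "y \<in> carrier M" "bracket M x y = \<zero>\<^bsub>M\<^esub>"
      have "bracket MS (j x) (j y) = \<zero>\<^bsub>MS\<^esub>"
        using xy linear_map_zero[OF module_axioms MS_R_module j_linear]
        by (simp add: bracket_j restrict_simps)
      then have "wedge S MS [j x, j y] \<in> ?JS" using xy by (intro MS.wedge_in_relations jD)
      then show "wedge R M [x, y] \<in> {\<xi> \<in> carrier W. \<iota> \<xi> \<in> ?JS}" using xy by (simp add: \<iota>_wedge)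
    qed
    then have \<iota>J: "\<iota> \<xi> \<in> ?JS" if "\<xi> \<in> ?J" for \<xi> using that by blast
    obtain r \<xi> where r: "r \<in> nonzero" "\<xi> \<in> carrier W" "h r \<odot>\<^bsub>MS.W\<^esub> \<eta> = \<iota> \<xi>"
      using \<iota>_denominator[OF W\<eta>(1)] by blast
    have "j (bracket_map R M \<xi>) = \<zero>\<^bsub>MS\<^esub>"
      using r W\<eta> linear_mapD(3)[OF MS.bracket_map_linear, of "h r" \<eta>] by (simp flip: bracket_map_\<iota>)
    then obtain s where s: "s \<in> nonzero" "s \<odot>\<^bsub>M\<^esub> bracket_map R M \<xi> = \<zero>\<^bsub>M\<^esub>"
      using j_kernel[of "bracket_map R M \<xi>"] linear_mapD(1)[OF bracket_map_linear r(2)] by blast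
    then have "s \<odot>\<^bsub>W\<^esub> \<xi> \<in> SK1_kernel R M"
      using r by (simp add: SK1_kernel_def linear_mapD[OF bracket_map_linear])
    then obtain t where t: "t \<in> nonzero" "t \<odot>\<^bsub>W\<^esub> (s \<odot>\<^bsub>W\<^esub> \<xi>) \<in> ?J" using tors by blast
    have "h (t \<otimes>\<^bsub>R\<^esub> s \<otimes>\<^bsub>R\<^esub> r) \<odot>\<^bsub>MS.W\<^esub> \<eta> = \<iota> (t \<odot>\<^bsub>W\<^esub> (s \<odot>\<^bsub>W\<^esub> \<xi>))"
      using r s t W\<eta> by (simp add: MS.W.smult_assoc1 \<iota>D)
    then have "h (t \<otimes>\<^bsub>R\<^esub> s \<otimes>\<^bsub>R\<^esub> r) \<odot>\<^bsub>MS.W\<^esub> \<eta> \<in> ?JS" using \<iota>J[OF t(2)] by simp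
    then show "\<eta> \<in> ?JS"
      by (rule unscale[OF MS.W_module MS.relations_submodule R.nonzero_mult[OF R.nonzero_mult[OF t(1) s(1)] r(1)] W\<eta>(1)])
  qed
qed

end


section \<open>Finite generation and finite quotients\<close>

definition finitely_generated :: "('a, 'm) ring_scheme \<Rightarrow> ('a, 'b, 'n) module_scheme \<Rightarrow> bool" where
  "finitely_generated R M \<longleftrightarrow> (\<exists>B. finite B \<and> B \<subseteq> carrier M \<and> carrier M \<subseteq> mspan R M B)"

lemma fg_free_imp_finitely_generated:
  assumes "fg_free_module R M"
  shows "finitely_generated R M"
proof -
  obtain B where M: "module R M" and B: "finite B" "B \<subseteq> carrier M"
    and ex: "\<forall>x\<in>carrier M. \<exists>!c. c \<in> B \<rightarrow>\<^sub>E carrier R \<and> x = (\<Oplus>\<^bsub>M\<^esub>b\<in>B. c b \<odot>\<^bsub>M\<^esub> b)"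
    using assms unfolding fg_free_module_def by blast
  interpret M: module R M by fact
  note span = M.submoduleD[OF M.mspan_submodule[OF B(2)]]
  have sum: "(\<Oplus>\<^bsub>M\<^esub>b\<in>A. c b \<odot>\<^bsub>M\<^esub> b) \<in> mspan R M B" if "A \<subseteq> B" "c \<in> B \<rightarrow>\<^sub>E carrier R" for c A
    using finite_subset[OF that(1) B(1)] that(1)
  proof (induction A)
    case (insert a A)
    then have a: "a \<in> B" "c a \<in> carrier R" using that(2) by auto
    have "(\<lambda>b. c b \<odot>\<^bsub>M\<^esub> b) \<in> A \<rightarrow> carrier M"
      using insert.prems B(2) that(2) by auto
    then have "(\<Oplus>\<^bsub>M\<^esub>b\<in>insert a A. c b \<odot>\<^bsub>M\<^esub> b) = c a \<odot>\<^bsub>M\<^esub> a \<oplus>\<^bsub>M\<^esub> (\<Oplus>\<^bsub>M\<^esub>b\<in>A. c b \<odot>\<^bsub>M\<^esub> b)"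
      using insert.hyps a B(2) by (intro M.finsum_insert) auto
    moreover have "c a \<odot>\<^bsub>M\<^esub> a \<in> mspan R M B"
      using span(4)[OF a(2)] mspan_superset[of B R M] a(1) by blast
    ultimately show ?case using insert span(3) by auto
  qed (simp add: span(2))
  have "carrier M \<subseteq> mspan R M B"
  proof
    fix x assume "x \<in> carrier M"
    then obtain c where "c \<in> B \<rightarrow>\<^sub>E carrier R" "x = (\<Oplus>\<^bsub>M\<^esub>b\<in>B. c b \<odot>\<^bsub>M\<^esub> b)" using ex by blast
    then show "x \<in> mspan R M B" using sum by blast
  qed
  then show ?thesis using B unfolding finitely_generated_def by blast
qed

lemma finitely_generated_image:
  assumes M: "module R M" and N: "module R N" and f: "linear_map R M N f" and surj: "f ` carrier M = carrier N"
    and fg: "finitely_generated R M"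
  shows "finitely_generated R N"
proof -
  interpret M: module R M by fact
  interpret N: module R N by fact
  obtain B where B: "finite B" "B \<subseteq> carrier M" "carrier M \<subseteq> mspan R M B"
    using fg unfolding finitely_generated_def by blast
  have fB: "f ` B \<subseteq> carrier N" using B(2) surj by blast
  have "submodule {x \<in> carrier M. f x \<in> mspan R N (f ` B)} R M"
    by (rule M.submodule_vimage[OF N f N.mspan_submodule[OF fB]])
  then have "mspan R M B \<subseteq> {x \<in> carrier M. f x \<in> mspan R N (f ` B)}"
    by (rule mspan_least) (use B(2) mspan_superset[of "f ` B" R N] in auto)
  then have "f x \<in> mspan R N (f ` B)" if "x \<in> carrier M" for x using B(3) that by blast
  then have "carrier N \<subseteq> mspan R N (f ` B)" using surj by (metis image_subset_iff)
  then show ?thesis using B(1) fB unfolding finitely_generated_def by blast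
qed

text \<open>The wedges of pairs of generators suffice: fix one factor among the generators and let the
other one vary, then let the first one vary as well.\<close>

lemma finitely_generated_ext_square:
  assumes M: "module R M" and fg: "finitely_generated R M"
  shows "finitely_generated R (ext_power R 2 M)"
proof -
  let ?W = "ext_power R 2 M"
  interpret M: module R M by fact
  interpret W: module R ?W by (rule ext_power_module[OF M])
  obtain B where B: "finite B" "B \<subseteq> carrier M" "carrier M \<subseteq> mspan R M B"
    using fg unfolding finitely_generated_def by blast
  note w = alternating_bilinearD(1)[OF wedge_alternating_bilinear[OF M]]
  define G where "G = (\<lambda>(x, y). wedge R M [x, y]) ` (B \<times> B)"
  have G: "finite G" "G \<subseteq> carrier ?W" using B bilinear_mapD(1)[OF w] by (auto simp: G_def subset_eq)
  note span = W.mspan_submodule[OF G(2)]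
  have left: "wedge R M [x, y] \<in> mspan R ?W G" if y: "y \<in> carrier M" and x: "x \<in> B" for x y
  proof -
    have "linear_map R M ?W (\<lambda>y. wedge R M [x, y])" using w x B by (auto simp: bilinear_map_def)
    then have "submodule {y \<in> carrier M. wedge R M [x, y] \<in> mspan R ?W G} R M"
      by (rule M.submodule_vimage[OF W.module_axioms _ span])
    then have "mspan R M B \<subseteq> {y \<in> carrier M. wedge R M [x, y] \<in> mspan R ?W G}"
      by (rule mspan_least) (use x B(2) mspan_superset[of G R ?W] in \<open>auto simp: G_def\<close>)
    then show ?thesis using B(3) y by blast
  qed
  have "wedge R M [x, y] \<in> mspan R ?W G" if y: "y \<in> carrier M" and x: "x \<in> carrier M" for x y
  proof -
    have "linear_map R M ?W (\<lambda>x. wedge R M [x, y])" using w y by (auto simp: bilinear_map_def)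
    then have "submodule {x \<in> carrier M. wedge R M [x, y] \<in> mspan R ?W G} R M"
      by (rule M.submodule_vimage[OF W.module_axioms _ span])
    then have "mspan R M B \<subseteq> {x \<in> carrier M. wedge R M [x, y] \<in> mspan R ?W G}"
      by (rule mspan_least) (use left[OF y] B(2) in auto)
    then show ?thesis using B(3) x by blast
  qed
  then have "mspan R ?W G = carrier ?W"
    by (intro ext_power_generated[OF M span]) (auto simp: tuples_2)
  then show ?thesis using G unfolding finitely_generated_def by blast
qed

lemma (in module) mspan_insertD:
  assumes B: "B \<subseteq> carrier M" and b: "b \<in> carrier M" and x: "x \<in> mspan R M (insert b B)"
  shows "\<exists>c\<in>carrier R. \<exists>y\<in>mspan R M B. x = c \<odot>\<^bsub>M\<^esub> b \<oplus>\<^bsub>M\<^esub> y"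
proof -
  note span = submoduleD[OF mspan_submodule[OF B]]
  define H where "H = {c \<odot>\<^bsub>M\<^esub> b \<oplus>\<^bsub>M\<^esub> y | c y. c \<in> carrier R \<and> y \<in> mspan R M B}"
  have "submodule H R M"
  proof (rule submoduleI')
    show "H \<subseteq> carrier M" using b span(1) by (auto simp: H_def)
    show "\<zero>\<^bsub>M\<^esub> \<in> H" unfolding H_def using b span(2) by (intro CollectI exI[of _ "\<zero>\<^bsub>R\<^esub>"] exI[of _ "\<zero>\<^bsub>M\<^esub>"]) auto
  next
    fix u v assume "u \<in> H" "v \<in> H"
    then obtain c y d z where *: "c \<in> carrier R" "y \<in> mspan R M B" "u = c \<odot>\<^bsub>M\<^esub> b \<oplus>\<^bsub>M\<^esub> y"
      "d \<in> carrier R" "z \<in> mspan R M B" "v = d \<odot>\<^bsub>M\<^esub> b \<oplus>\<^bsub>M\<^esub> z" unfolding H_def by blast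
    then have "u \<oplus>\<^bsub>M\<^esub> v = (c \<oplus>\<^bsub>R\<^esub> d) \<odot>\<^bsub>M\<^esub> b \<oplus>\<^bsub>M\<^esub> (y \<oplus>\<^bsub>M\<^esub> z)"
      using b span(1) by (simp add: smult_l_distr M.add.m_ac)
    then show "u \<oplus>\<^bsub>M\<^esub> v \<in> H" unfolding H_def using * span(3) R.a_closed by blast
  next
    fix r u assume r: "r \<in> carrier R" and "u \<in> H"
    then obtain c y where *: "c \<in> carrier R" "y \<in> mspan R M B" "u = c \<odot>\<^bsub>M\<^esub> b \<oplus>\<^bsub>M\<^esub> y"
      unfolding H_def by blast
    then have "r \<odot>\<^bsub>M\<^esub> u = (r \<otimes>\<^bsub>R\<^esub> c) \<odot>\<^bsub>M\<^esub> b \<oplus>\<^bsub>M\<^esub> r \<odot>\<^bsub>M\<^esub> y"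
      using b r span(1) by (simp add: smult_r_distr smult_assoc1)
    then show "r \<odot>\<^bsub>M\<^esub> u \<in> H" unfolding H_def using * r span(4) R.m_closed by blast
  qed
  moreover have "b \<in> H" unfolding H_def using b span(2) by (intro CollectI exI[of _ "\<one>\<^bsub>R\<^esub>"] exI[of _ "\<zero>\<^bsub>M\<^esub>"]) auto
  moreover have "y \<in> H" if "y \<in> B" for y
    unfolding H_def using that B b mspan_superset[of B R M] by (intro CollectI exI[of _ "\<zero>\<^bsub>R\<^esub>"] exI[of _ y]) auto
  ultimately have "mspan R M (insert b B) \<subseteq> H" by (intro mspan_least) auto
  then show ?thesis using x unfolding H_def by blast
qed

text \<open>The two properties of the \<open>p\<close>-adic integers that make finite quotients of finitely generated
modules the same as torsion quotients.\<close>

locale finite_residue_domain = domain R for R (structure) +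
  assumes finite_residues: "r \<in> carrier R - {\<zero>} \<Longrightarrow>
      \<exists>D. finite D \<and> D \<subseteq> carrier R \<and> (\<forall>x\<in>carrier R. \<exists>d\<in>D. \<exists>q\<in>carrier R. x = r \<otimes> q \<oplus> d)"
    and infinite_carrier: "infinite (carrier R)"
begin

text \<open>Induction on the number of generators. Adding a generator \<open>b\<close>, consider the ideal of
coefficients of \<open>b\<close> in elements of \<open>K\<close>. If it is nonzero, choose \<open>k\<close> in \<open>K\<close> with
coefficient \<open>a \<noteq> 0\<close>. As \<open>R/aR\<close> is finite, finitely many elements \<open>rep d\<close> of \<open>K\<close> represent all
coefficients modulo \<open>a\<close>. Subtracting one of them and a multiple \<open>s k\<close> leads to an element whose
coefficient is \<open>0\<close>, to which the induction hypothesis applies. Finally \<open>r k \<in> J\<close> for some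
\<open>r \<noteq> 0\<close>, and \<open>R/rR\<close> is finite, so only finitely many multiples of \<open>k\<close> matter modulo \<open>J\<close>.\<close>

lemma torsion_quotient_finite_representatives:
  fixes M :: "('a, 'c, 'n) module_scheme"
  assumes M: "module R M" and K: "submodule K R M" and J: "submodule J R M"
    and tors: "\<And>x. x \<in> K \<Longrightarrow> \<exists>r\<in>carrier R - {\<zero>}. r \<odot>\<^bsub>M\<^esub> x \<in> J"
    and "finite B" "B \<subseteq> carrier M"
  shows "\<exists>F. finite F \<and> F \<subseteq> K \<and> (\<forall>x\<in>K \<inter> mspan R M B. \<exists>f\<in>F. x \<ominus>\<^bsub>M\<^esub> f \<in> J)"
  using \<open>finite B\<close> \<open>B \<subseteq> carrier M\<close>
proof (induction B)
  interpret M: module R M by fact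
  note KD = M.submoduleD[OF K] and JD = M.submoduleD[OF J]
  case empty
  have "submodule {\<zero>\<^bsub>M\<^esub>} R M" by (rule M.submoduleI') auto
  then have "mspan R M {} \<subseteq> {\<zero>\<^bsub>M\<^esub>}" by (rule mspan_least) auto
  moreover have "\<zero>\<^bsub>M\<^esub> \<ominus>\<^bsub>M\<^esub> \<zero>\<^bsub>M\<^esub> \<in> J" using JD(2,5) by blast
  ultimately show ?case using KD(2) by (intro exI[of _ "{\<zero>\<^bsub>M\<^esub>}"]) auto
next
  interpret M: module R M by fact
  note KD = M.submoduleD[OF K] and JD = M.submoduleD[OF J]
  case (insert b B)
  then have b: "b \<in> carrier M" and B: "B \<subseteq> carrier M" by auto
  note BD = M.submoduleD[OF M.mspan_submodule[OF B]]
  obtain F where F: "finite F" "F \<subseteq> K" "\<forall>x\<in>K \<inter> mspan R M B. \<exists>f\<in>F. x \<ominus>\<^bsub>M\<^esub> f \<in> J"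
    using insert.IH B by blast
  \<comment> \<open>\<open>c\<close> is a possible coefficient of \<open>b\<close> in \<open>x\<close>; it is not determined by \<open>x\<close>.\<close>
  define coef where "coef x c \<longleftrightarrow> x \<in> K \<and> c \<in> carrier R \<and> (\<exists>y\<in>mspan R M B. x = c \<odot>\<^bsub>M\<^esub> b \<oplus>\<^bsub>M\<^esub> y)" for x c
  have coef_ex: "\<exists>c. coef x c" if "x \<in> K \<inter> mspan R M (insert b B)" for x
    using M.mspan_insertD[OF B b, of x] that unfolding coef_def by blast
  have coef_comb: "coef (x \<ominus>\<^bsub>M\<^esub> r \<odot>\<^bsub>M\<^esub> x') (c \<ominus> r \<otimes> c')" if hyp: "coef x c" "coef x' c'" "r \<in> carrier R" for x c x' c' r
  proof -
    obtain y y' where y: "x \<in> K" "c \<in> carrier R" "y \<in> mspan R M B" "x = c \<odot>\<^bsub>M\<^esub> b \<oplus>\<^bsub>M\<^esub> y"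
      "x' \<in> K" "c' \<in> carrier R" "y' \<in> mspan R M B" "x' = c' \<odot>\<^bsub>M\<^esub> b \<oplus>\<^bsub>M\<^esub> y'"
      using hyp unfolding coef_def by blast
    have "x \<ominus>\<^bsub>M\<^esub> r \<odot>\<^bsub>M\<^esub> x' = (c \<ominus> r \<otimes> c') \<odot>\<^bsub>M\<^esub> b \<oplus>\<^bsub>M\<^esub> (y \<ominus>\<^bsub>M\<^esub> r \<odot>\<^bsub>M\<^esub> y')"
      unfolding y(4,8) a_minus_def using y(2,3,6,7) hyp(3) b BD(1)
      by (simp add: M.smult_l_distr M.smult_r_distr M.smult_l_minus M.smult_assoc1 M.minus_add M.M.add.m_ac)
    then show ?thesis unfolding coef_def using y hyp(3) KD BD by (metis minus_closed m_closed)
  qed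
  show ?case
  proof (cases "\<exists>x a. coef x a \<and> a \<noteq> \<zero>")
    case False
    have "x \<in> K \<inter> mspan R M B" if x: "x \<in> K \<inter> mspan R M (insert b B)" for x
    proof -
      obtain c where "coef x c" using coef_ex[OF x] by blast
      then have "coef x \<zero>" using False by metis
      then show ?thesis unfolding coef_def using b BD(1) by auto
    qed
    then show ?thesis using F by blast
  next
    case True
    then obtain k a where ka: "coef k a" "a \<noteq> \<zero>" by blast
    then have k: "k \<in> K" "k \<in> carrier M" and a: "a \<in> carrier R - {\<zero>}" using KD(1) by (auto simp: coef_def)
    obtain r where r: "r \<in> carrier R - {\<zero>}" "r \<odot>\<^bsub>M\<^esub> k \<in> J" using tors[OF k(1)] by blast
    obtain D where D: "finite D" "D \<subseteq> carrier R" "\<forall>x\<in>carrier R. \<exists>d\<in>D. \<exists>q\<in>carrier R. x = a \<otimes> q \<oplus> d"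
      using finite_residues[OF a] by blast
    obtain D' where D': "finite D'" "D' \<subseteq> carrier R" "\<forall>x\<in>carrier R. \<exists>d\<in>D'. \<exists>q\<in>carrier R. x = r \<otimes> q \<oplus> d"
      using finite_residues[OF r(1)] by blast
    \<comment> \<open>\<open>x\<close> has a coefficient that is congruent to \<open>d\<close> modulo \<open>a\<close>.\<close>
    define good where "good d x \<longleftrightarrow> (\<exists>q\<in>carrier R. coef x (a \<otimes> q \<oplus> d))" for d x
    define rep where "rep d = (if \<exists>x. good d x then SOME x. good d x else \<zero>\<^bsub>M\<^esub>)" for d
    have rep: "good d (rep d)" if "good d x" for d x
      unfolding rep_def using that someI[of "good d" x] by auto
    have repK: "rep d \<in> K" for d
    proof (cases "\<exists>x. good d x")
      case True
      then have "good d (rep d)" using rep by blast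
      then show ?thesis by (auto simp: good_def coef_def)
    qed (simp add: rep_def KD(2))
    define G where "G = (\<lambda>(d, e, f). rep d \<oplus>\<^bsub>M\<^esub> (e \<odot>\<^bsub>M\<^esub> k \<oplus>\<^bsub>M\<^esub> f)) ` (D \<times> D' \<times> F)"
    have "finite G" using D D' F by (simp add: G_def)
    moreover have "rep d \<oplus>\<^bsub>M\<^esub> (e \<odot>\<^bsub>M\<^esub> k \<oplus>\<^bsub>M\<^esub> f) \<in> K" if "e \<in> D'" "f \<in> F" for d e f
      using that D'(2) F(2) by (intro KD(3,4) repK k(1)) auto
    then have "G \<subseteq> K" unfolding G_def by auto
    moreover have "\<exists>g\<in>G. x \<ominus>\<^bsub>M\<^esub> g \<in> J" if x: "x \<in> K \<inter> mspan R M (insert b B)" for x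
    proof -
      obtain c where c: "coef x c" using coef_ex[OF x] by blast
      then have cR: "c \<in> carrier R" by (simp add: coef_def)
      obtain d q where d: "d \<in> D" "q \<in> carrier R" "c = a \<otimes> q \<oplus> d" using D(3) cR by blast
      have dR: "d \<in> carrier R" using d D by blast
      have "good d x" using c d unfolding good_def by blast
      then obtain q' where q': "q' \<in> carrier R" "coef (rep d) (a \<otimes> q' \<oplus> d)" using rep unfolding good_def by blast
      have "coef (x \<ominus>\<^bsub>M\<^esub> \<one> \<odot>\<^bsub>M\<^esub> rep d) (c \<ominus> \<one> \<otimes> (a \<otimes> q' \<oplus> d))" by (rule coef_comb[OF c q'(2)]) simp
      moreover define s where "s = q \<ominus> q'"
      ultimately have "coef (x \<ominus>\<^bsub>M\<^esub> rep d) (s \<otimes> a)"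
      proof -
        have "c \<ominus> \<one> \<otimes> (a \<otimes> q' \<oplus> d) = s \<otimes> a"
          unfolding s_def d(3) using d dR q' a by (simp add: a_minus_def l_minus r_minus minus_add r_distr l_distr m_comm[of a] a_ac r_neg1 r_neg2)
        moreover have "\<one> \<odot>\<^bsub>M\<^esub> rep d = rep d" using repK KD(1) by simp
        ultimately show ?thesis using \<open>coef (x \<ominus>\<^bsub>M\<^esub> \<one> \<odot>\<^bsub>M\<^esub> rep d) _\<close> by simp
      qed
      moreover have sR: "s \<in> carrier R" using d q' by (simp add: s_def)
      ultimately have "coef (x \<ominus>\<^bsub>M\<^esub> rep d \<ominus>\<^bsub>M\<^esub> s \<odot>\<^bsub>M\<^esub> k) (s \<otimes> a \<ominus> s \<otimes> a)" using coef_comb[OF _ ka(1)] by blast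
      then have "coef (x \<ominus>\<^bsub>M\<^esub> rep d \<ominus>\<^bsub>M\<^esub> s \<odot>\<^bsub>M\<^esub> k) \<zero>" using sR a by (simp add: a_minus_def r_neg)
      then have "x \<ominus>\<^bsub>M\<^esub> rep d \<ominus>\<^bsub>M\<^esub> s \<odot>\<^bsub>M\<^esub> k \<in> K \<inter> mspan R M B"
        unfolding coef_def using b BD(1) by auto
      then obtain f where f: "f \<in> F" "x \<ominus>\<^bsub>M\<^esub> rep d \<ominus>\<^bsub>M\<^esub> s \<odot>\<^bsub>M\<^esub> k \<ominus>\<^bsub>M\<^esub> f \<in> J" using F(3) by blast
      obtain e t where e: "e \<in> D'" "t \<in> carrier R" "s = r \<otimes> t \<oplus> e" using D'(3) sR by blast
      have eR: "e \<in> carrier R" using e D' by blast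
      have cM: "x \<in> carrier M" "rep d \<in> carrier M" "f \<in> carrier M" using x repK f F KD(1) by blast+
      have "s \<odot>\<^bsub>M\<^esub> k = t \<odot>\<^bsub>M\<^esub> (r \<odot>\<^bsub>M\<^esub> k) \<oplus>\<^bsub>M\<^esub> e \<odot>\<^bsub>M\<^esub> k"
        unfolding e(3) using e eR r k m_comm[of r t] by (simp add: M.smult_l_distr M.smult_assoc1)
      then have "x \<ominus>\<^bsub>M\<^esub> (rep d \<oplus>\<^bsub>M\<^esub> (e \<odot>\<^bsub>M\<^esub> k \<oplus>\<^bsub>M\<^esub> f)) =
          (x \<ominus>\<^bsub>M\<^esub> rep d \<ominus>\<^bsub>M\<^esub> s \<odot>\<^bsub>M\<^esub> k \<ominus>\<^bsub>M\<^esub> f) \<oplus>\<^bsub>M\<^esub> t \<odot>\<^bsub>M\<^esub> (r \<odot>\<^bsub>M\<^esub> k)"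
        using cM k e eR r by (simp add: a_minus_def M.minus_add M.M.add.m_ac M.M.r_neg M.r_neg1 M.r_neg2)
      then have "x \<ominus>\<^bsub>M\<^esub> (rep d \<oplus>\<^bsub>M\<^esub> (e \<odot>\<^bsub>M\<^esub> k \<oplus>\<^bsub>M\<^esub> f)) \<in> J" using f r e JD(3,4) by simp
      then show ?thesis using d(1) e(1) f(1) unfolding G_def by force
    qed
    ultimately show ?thesis by blast
  qed
qed

text \<open>If \<open>K\<close> meets only finitely many cosets of \<open>J\<close>, then \<open>r x\<close> and \<open>s x\<close> lie in the same coset for some
\<open>r \<noteq> s\<close>, as the ring is infinite, and \<open>(r - s) x \<in> J\<close>. The converse is the preceding lemma.\<close>

theorem finite_quotient_iff_torsion:
  fixes M :: "('a, 'c, 'n) module_scheme"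
  assumes M: "module R M" and fg: "finitely_generated R M" and K: "submodule K R M" and J: "submodule J R M"
  shows "finite ((\<lambda>x. J +>\<^bsub>M\<^esub> x) ` K) \<longleftrightarrow> (\<forall>x\<in>K. \<exists>r\<in>carrier R - {\<zero>}. r \<odot>\<^bsub>M\<^esub> x \<in> J)"
proof -
  interpret M: module R M by fact
  note KD = M.submoduleD[OF K]
  show ?thesis
  proof (intro iffI ballI)
    fix x assume fin: "finite ((\<lambda>x. J +>\<^bsub>M\<^esub> x) ` K)" and x: "x \<in> K"
    have "(\<lambda>r. J +>\<^bsub>M\<^esub> (r \<odot>\<^bsub>M\<^esub> x)) ` carrier R \<subseteq> (\<lambda>x. J +>\<^bsub>M\<^esub> x) ` K" using KD(4)[OF _ x] by blast
    note sub = this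
    have "\<not> inj_on (\<lambda>r. J +>\<^bsub>M\<^esub> (r \<odot>\<^bsub>M\<^esub> x)) (carrier R)"
      using infinite_carrier finite_imageD[OF finite_subset[OF sub fin]] by blast
    then obtain r s where rs: "r \<in> carrier R" "s \<in> carrier R" "r \<noteq> s"
      "J +>\<^bsub>M\<^esub> (r \<odot>\<^bsub>M\<^esub> x) = J +>\<^bsub>M\<^esub> (s \<odot>\<^bsub>M\<^esub> x)" unfolding inj_on_def by blast
    then have "r \<odot>\<^bsub>M\<^esub> x \<ominus>\<^bsub>M\<^esub> s \<odot>\<^bsub>M\<^esub> x \<in> J" using M.coset_eq_iff[OF J] KD(1)[OF x] by simp
    moreover have "r \<odot>\<^bsub>M\<^esub> x \<ominus>\<^bsub>M\<^esub> s \<odot>\<^bsub>M\<^esub> x = (r \<ominus> s) \<odot>\<^bsub>M\<^esub> x"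
      using rs KD(1)[OF x] by (simp add: a_minus_def M.smult_l_distr M.smult_l_minus)
    moreover have "r = (r \<ominus> s) \<oplus> s" using rs by (simp add: a_minus_def a_assoc l_neg)
    then have "r \<ominus> s \<noteq> \<zero>" using rs by auto
    then have "r \<ominus> s \<in> carrier R - {\<zero>}" using rs by simp
    ultimately show "\<exists>r\<in>carrier R - {\<zero>}. r \<odot>\<^bsub>M\<^esub> x \<in> J" by metis
  next
    assume tors: "\<forall>x\<in>K. \<exists>r\<in>carrier R - {\<zero>}. r \<odot>\<^bsub>M\<^esub> x \<in> J"
    obtain B where B: "finite B" "B \<subseteq> carrier M" "carrier M \<subseteq> mspan R M B"
      using fg unfolding finitely_generated_def by blast
    obtain F where F: "finite F" "F \<subseteq> K" "\<forall>x\<in>K \<inter> mspan R M B. \<exists>f\<in>F. x \<ominus>\<^bsub>M\<^esub> f \<in> J"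
      using torsion_quotient_finite_representatives[OF M K J bspec[OF tors] B(1,2)] by blast
    have "(\<lambda>x. J +>\<^bsub>M\<^esub> x) ` K \<subseteq> (\<lambda>x. J +>\<^bsub>M\<^esub> x) ` F"
    proof
      fix X assume "X \<in> (\<lambda>x. J +>\<^bsub>M\<^esub> x) ` K"
      then obtain x where x: "x \<in> K" "X = J +>\<^bsub>M\<^esub> x" by blast
      then have "x \<in> K \<inter> mspan R M B" using B(3) KD(1) by blast
      then obtain f where f: "f \<in> F" "x \<ominus>\<^bsub>M\<^esub> f \<in> J" using F(3) by blast
      then have "x \<in> carrier M" "f \<in> carrier M" using x F(2) KD(1) by blast+
      then have "X = J +>\<^bsub>M\<^esub> f" using M.coset_eq_iff[OF J, of x f] f x by simp
      then show "X \<in> (\<lambda>x. J +>\<^bsub>M\<^esub> x) ` F" using f(1) by blast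
    qed
    then show "finite ((\<lambda>x. J +>\<^bsub>M\<^esub> x) ` K)" using F(1) finite_surj by blast
  qed
qed

end

section \<open>The Lie algebra \<open>V \<oplus> W/L\<close>\<close>

lemma class2_simps:
  "carrier (class2_lie_alg R V L) = carrier V \<times> carrier (quot_module (ext_power R 2 V) L)"
  "\<zero>\<^bsub>class2_lie_alg R V L\<^esub> = (\<zero>\<^bsub>V\<^esub>, \<zero>\<^bsub>quot_module (ext_power R 2 V) L\<^esub>)"
  "(v, w) \<oplus>\<^bsub>class2_lie_alg R V L\<^esub> (v', w') = (v \<oplus>\<^bsub>V\<^esub> v', w \<oplus>\<^bsub>quot_module (ext_power R 2 V) L\<^esub> w')"
  "r \<odot>\<^bsub>class2_lie_alg R V L\<^esub> (v, w) = (r \<odot>\<^bsub>V\<^esub> v, r \<odot>\<^bsub>quot_module (ext_power R 2 V) L\<^esub> w)"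
  "bracket (class2_lie_alg R V L) (v, w) (v', w') = (\<zero>\<^bsub>V\<^esub>, L +>\<^bsub>ext_power R 2 V\<^esub> wedge R V [v, v'])"
  by (simp_all add: class2_lie_alg_def Let_def)

lemma class2_bracket_module:
  assumes V: "module R V" and L: "submodule L R (ext_power R 2 V)"
  shows "bracket_module R (class2_lie_alg R V L)"
proof -
  let ?W = "ext_power R 2 V" and ?A = "class2_lie_alg R V L"
  let ?U = "quot_module ?W L"
  interpret V: module R V by fact
  interpret W: module R ?W by (rule ext_power_module[OF V])
  interpret U: module R ?U by (rule W.quot_module_module[OF L])
  have "abelian_group ?A"
  proof (rule abelian_groupI)
    fix x assume "x \<in> carrier ?A"
    then obtain v w where "v \<in> carrier V" "w \<in> carrier ?U" "x = (v, w)" by (auto simp: class2_simps)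
    then show "\<exists>y\<in>carrier ?A. y \<oplus>\<^bsub>?A\<^esub> x = \<zero>\<^bsub>?A\<^esub>"
      by (auto simp: class2_simps V.l_neg U.l_neg intro!: bexI[of _ "\<ominus>\<^bsub>V\<^esub> v"] bexI[of _ "\<ominus>\<^bsub>?U\<^esub> w"])
  qed (auto simp: class2_simps V.M.a_ac U.M.a_ac)
  then have A: "module R ?A"
    by (rule moduleI[OF V.R.is_cring])
      (auto simp: class2_simps V.smult_l_distr V.smult_r_distr V.smult_assoc1
        U.smult_l_distr U.smult_r_distr U.smult_assoc1)
  note q = linear_mapD[OF W.quot_map_linear[OF L]] linear_map_zero[OF W.module_axioms U.module_axioms W.quot_map_linear[OF L]]
  note w = wedge_alternating_bilinear[OF V, unfolded alternating_bilinear_def]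
  note wD = bilinear_mapD[OF conjunct1[OF w]]
  have "alternating_bilinear R ?A ?A (bracket ?A)"
    unfolding alternating_bilinear_def
    by (intro conjI bilinear_mapI) (use w in \<open>auto simp: class2_simps wD q\<close>)
  then show ?thesis using A by (intro bracket_module.intro bracket_module_axioms.intro)
qed

text \<open>\<open>W/L\<close> is a quotient of the exterior square of \<open>V\<close>.\<close>

lemma class2_finitely_generated:
  assumes V: "module R V" and L: "submodule L R (ext_power R 2 V)" and fg: "finitely_generated R V"
  shows "finitely_generated R (class2_lie_alg R V L)"
proof -
  let ?W = "ext_power R 2 V" and ?A = "class2_lie_alg R V L"
  let ?U = "quot_module ?W L"
  interpret V: module R V by fact
  interpret W: module R ?W by (rule ext_power_module[OF V])
  interpret U: module R ?U by (rule W.quot_module_module[OF L])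
  interpret A: bracket_module R ?A by (rule class2_bracket_module[OF V L])
  have "finitely_generated R ?U"
    by (rule finitely_generated_image[OF W.module_axioms U.module_axioms W.quot_map_linear[OF L] _
          finitely_generated_ext_square[OF V fg]]) (simp add: quot_module_carrier)
  then obtain C where C: "finite C" "C \<subseteq> carrier ?U" "carrier ?U \<subseteq> mspan R ?U C"
    unfolding finitely_generated_def by blast
  obtain B where B: "finite B" "B \<subseteq> carrier V" "carrier V \<subseteq> mspan R V B"
    using fg unfolding finitely_generated_def by blast
  define G where "G = (\<lambda>v. (v, \<zero>\<^bsub>?U\<^esub>)) ` B \<union> (\<lambda>w. (\<zero>\<^bsub>V\<^esub>, w)) ` C"
  have G: "finite G" "G \<subseteq> carrier ?A" using B C by (auto simp: G_def class2_simps)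
  note span = A.mspan_submodule[OF G(2)]
  have "linear_map R V ?A (\<lambda>v. (v, \<zero>\<^bsub>?U\<^esub>))" by (rule linear_mapI) (auto simp: class2_simps)
  then have "submodule {v \<in> carrier V. (v, \<zero>\<^bsub>?U\<^esub>) \<in> mspan R ?A G} R V"
    by (rule V.submodule_vimage[OF A.module_axioms _ span])
  then have "mspan R V B \<subseteq> {v \<in> carrier V. (v, \<zero>\<^bsub>?U\<^esub>) \<in> mspan R ?A G}"
    by (rule mspan_least) (use B mspan_superset[of G R ?A] in \<open>auto simp: G_def\<close>)
  moreover have "linear_map R ?U ?A (\<lambda>w. (\<zero>\<^bsub>V\<^esub>, w))" by (rule linear_mapI) (auto simp: class2_simps)
  then have "submodule {w \<in> carrier ?U. (\<zero>\<^bsub>V\<^esub>, w) \<in> mspan R ?A G} R ?U"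
    by (rule U.submodule_vimage[OF A.module_axioms _ span])
  then have "mspan R ?U C \<subseteq> {w \<in> carrier ?U. (\<zero>\<^bsub>V\<^esub>, w) \<in> mspan R ?A G}"
    by (rule mspan_least) (use C mspan_superset[of G R ?A] in \<open>auto simp: G_def\<close>)
  ultimately have inG: "(v, \<zero>\<^bsub>?U\<^esub>) \<in> mspan R ?A G" "(\<zero>\<^bsub>V\<^esub>, w) \<in> mspan R ?A G"
    if "v \<in> carrier V" "w \<in> carrier ?U" for v w
    using B(3) C(3) that by blast+
  have "carrier ?A \<subseteq> mspan R ?A G"
  proof
    fix x assume "x \<in> carrier ?A"
    then obtain v w where x: "v \<in> carrier V" "w \<in> carrier ?U" "x = (v, w)" by (auto simp: class2_simps)
    then have "x = (v, \<zero>\<^bsub>?U\<^esub>) \<oplus>\<^bsub>?A\<^esub> (\<zero>\<^bsub>V\<^esub>, w)" by (simp add: class2_simps)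
    then show "x \<in> mspan R ?A G" using A.submoduleD(3)[OF span] inG x by simp
  qed
  then show ?thesis using G unfolding finitely_generated_def by blast
qed


section \<open>The field of fractions\<close>

context domain
begin

text \<open>Transitivity of the equality of fractions is where cancellation in the domain is used. The
operations of \<open>frac_field\<close> are unions over all representatives, and the next lemmas show that
all of them contribute the same fraction.\<close>

lemma fraction_eq_iff:
  assumes "a \<in> carrier R" "b \<in> carrier R - {\<zero>}" "c \<in> carrier R" "d \<in> carrier R - {\<zero>}"
  shows "fraction R a b = fraction R c d \<longleftrightarrow> a \<otimes> d = c \<otimes> b"
proof
  assume "fraction R a b = fraction R c d"
  moreover have "(c, d) \<in> fraction R c d" using assms by (simp add: fraction_def)
  ultimately show "a \<otimes> d = c \<otimes> b" by (auto simp: fraction_def)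
next
  assume eq: "a \<otimes> d = c \<otimes> b"
  have sub: "fraction R a b \<subseteq> fraction R c d"
    if eq: "a \<otimes> d = c \<otimes> b" and abcd: "a \<in> carrier R" "b \<in> carrier R - {\<zero>}" "c \<in> carrier R" "d \<in> carrier R - {\<zero>}"
    for a b c d
  proof (clarsimp simp: fraction_def)
    fix x y assume xy: "x \<in> carrier R" "y \<in> carrier R" "a \<otimes> y = x \<otimes> b"
    have "b \<otimes> (c \<otimes> y) = (c \<otimes> b) \<otimes> y" using abcd xy by (simp add: m_ac)
    also have "\<dots> = (a \<otimes> y) \<otimes> d" unfolding eq[symmetric] using abcd xy(1,2) by (simp add: m_ac)
    also have "\<dots> = b \<otimes> (x \<otimes> d)" unfolding xy(3) using abcd xy(1,2) by (simp add: m_ac)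
    finally show "c \<otimes> y = x \<otimes> d" using abcd xy m_lcancel[of b "c \<otimes> y" "x \<otimes> d"] by auto
  qed
  show "fraction R a b = fraction R c d" using sub[OF eq assms] sub[OF eq[symmetric] assms(3,4,1,2)] by blast
qed

lemma
  assumes "a \<in> carrier R" "b \<in> carrier R - {\<zero>}" "c \<in> carrier R" "d \<in> carrier R - {\<zero>}"
  shows frac_mult: "fraction R a b \<otimes>\<^bsub>frac_field R\<^esub> fraction R c d = fraction R (a \<otimes> c) (b \<otimes> d)"
    and frac_add: "fraction R a b \<oplus>\<^bsub>frac_field R\<^esub> fraction R c d = fraction R (a \<otimes> d \<oplus> c \<otimes> b) (b \<otimes> d)"
proof -
  have self: "(a, b) \<in> fraction R a b" "(c, d) \<in> fraction R c d" using assms by (auto simp: fraction_def)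
  have "fraction R (a' \<otimes> c') (b' \<otimes> d') = fraction R (a \<otimes> c) (b \<otimes> d)"
    "fraction R (a' \<otimes> d' \<oplus> c' \<otimes> b') (b' \<otimes> d') = fraction R (a \<otimes> d \<oplus> c \<otimes> b) (b \<otimes> d)"
    if in_ab: "(a', b') \<in> fraction R a b" and in_cd: "(c', d') \<in> fraction R c d" for a' b' c' d'
  proof -
    have *: "a' \<in> carrier R" "b' \<in> carrier R - {\<zero>}" "a \<otimes> b' = a' \<otimes> b"
      "c' \<in> carrier R" "d' \<in> carrier R - {\<zero>}" "c \<otimes> d' = c' \<otimes> d"
      using in_ab in_cd by (auto simp: fraction_def)
    have "(a' \<otimes> c') \<otimes> (b \<otimes> d) = (a' \<otimes> b) \<otimes> (c' \<otimes> d)" using * assms by (simp add: m_ac)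
    also have "\<dots> = (a \<otimes> c) \<otimes> (b' \<otimes> d')" unfolding *(3,6)[symmetric] using *(1,2,4,5) assms by (simp add: m_ac)
    finally show "fraction R (a' \<otimes> c') (b' \<otimes> d') = fraction R (a \<otimes> c) (b \<otimes> d)"
      using * assms nonzero_mult by (subst fraction_eq_iff) auto
    have "(a' \<otimes> d' \<oplus> c' \<otimes> b') \<otimes> (b \<otimes> d) = (a' \<otimes> b) \<otimes> (d' \<otimes> d) \<oplus> (c' \<otimes> d) \<otimes> (b' \<otimes> b)"
      using * assms by (simp add: l_distr r_distr m_ac)
    also have "\<dots> = (a \<otimes> d \<oplus> c \<otimes> b) \<otimes> (b' \<otimes> d')"
      unfolding *(3,6)[symmetric] using *(1,2,4,5) assms by (simp add: l_distr r_distr m_ac)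
    finally show "fraction R (a' \<otimes> d' \<oplus> c' \<otimes> b') (b' \<otimes> d') = fraction R (a \<otimes> d \<oplus> c \<otimes> b) (b \<otimes> d)"
      using * assms nonzero_mult by (subst fraction_eq_iff) auto
  qed
  note eq = this
  show "fraction R a b \<otimes>\<^bsub>frac_field R\<^esub> fraction R c d = fraction R (a \<otimes> c) (b \<otimes> d)"
  proof -
    have "(\<Union>(a', b')\<in>fraction R a b. \<Union>(c', d')\<in>fraction R c d. fraction R (a' \<otimes> c') (b' \<otimes> d')) = fraction R (a \<otimes> c) (b \<otimes> d)"
      using eq(1) self by fast
    then show ?thesis by (simp add: frac_field_def)
  qed
  have "(\<Union>(a', b')\<in>fraction R a b. \<Union>(c', d')\<in>fraction R c d. fraction R (a' \<otimes> d' \<oplus> c' \<otimes> b') (b' \<otimes> d')) =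
      fraction R (a \<otimes> d \<oplus> c \<otimes> b) (b \<otimes> d)"
    using eq(2) self by fast
  then show "fraction R a b \<oplus>\<^bsub>frac_field R\<^esub> fraction R c d = fraction R (a \<otimes> d \<oplus> c \<otimes> b) (b \<otimes> d)"
    by (simp add: frac_field_def)
qed

lemma frac_field_carrierE:
  assumes "X \<in> carrier (frac_field R)"
  obtains a b where "a \<in> carrier R" "b \<in> carrier R - {\<zero>}" "X = fraction R a b"
  using assms by (auto simp: frac_field_def)

lemma fraction_in_carrier: "a \<in> carrier R \<Longrightarrow> b \<in> carrier R - {\<zero>} \<Longrightarrow> fraction R a b \<in> carrier (frac_field R)"
  by (auto simp: frac_field_def)

lemma frac_zero: "\<zero>\<^bsub>frac_field R\<^esub> = fraction R \<zero> \<one>" and frac_one: "\<one>\<^bsub>frac_field R\<^esub> = fraction R \<one> \<one>"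
  by (simp_all add: frac_field_def)

lemma frac_field_cring: "cring (frac_field R)"
proof (rule cringI)
  let ?Q = "frac_field R"
  note ops = frac_mult frac_add frac_zero frac_one
  have one: "\<one> \<in> carrier R - {\<zero>}" by simp
  show "abelian_group ?Q"
  proof (rule abelian_groupI)
    fix X Y assume "X \<in> carrier ?Q" "Y \<in> carrier ?Q"
    then obtain a b c d where *: "a \<in> carrier R" "b \<in> carrier R - {\<zero>}" "X = fraction R a b"
      "c \<in> carrier R" "d \<in> carrier R - {\<zero>}" "Y = fraction R c d" by (metis frac_field_carrierE)
    have bd: "b \<otimes> d \<in> carrier R - {\<zero>}" by (rule nonzero_mult[OF *(2,5)])
    show "X \<oplus>\<^bsub>?Q\<^esub> Y \<in> carrier ?Q"
      unfolding *(3,6) using frac_add[OF *(1,2,4,5)] * bd by (auto intro!: fraction_in_carrier)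
    show "X \<oplus>\<^bsub>?Q\<^esub> Y = Y \<oplus>\<^bsub>?Q\<^esub> X"
      unfolding *(3,6) frac_add[OF *(1,2,4,5)] frac_add[OF *(4,5,1,2)] using *(1,2,4,5)
      by (simp add: a_comm m_comm[of b d])
    fix Z assume "Z \<in> carrier ?Q"
    then obtain e f where ef: "e \<in> carrier R" "f \<in> carrier R - {\<zero>}" "Z = fraction R e f" by (metis frac_field_carrierE)
    have df: "d \<otimes> f \<in> carrier R - {\<zero>}" by (rule nonzero_mult[OF *(5) ef(2)])
    have num: "a \<otimes> d \<oplus> c \<otimes> b \<in> carrier R" "c \<otimes> f \<oplus> e \<otimes> d \<in> carrier R" using * ef by auto
    show "X \<oplus>\<^bsub>?Q\<^esub> Y \<oplus>\<^bsub>?Q\<^esub> Z = X \<oplus>\<^bsub>?Q\<^esub> (Y \<oplus>\<^bsub>?Q\<^esub> Z)"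
      unfolding *(3,6) ef(3) frac_add[OF *(1,2,4,5)] frac_add[OF *(4,5) ef(1,2)]
        frac_add[OF num(1) bd ef(1,2)] frac_add[OF *(1,2) num(2) df]
      using *(1,2,4,5) ef(1,2) by (simp add: l_distr r_distr a_ac m_ac)
  next
    fix X assume "X \<in> carrier ?Q"
    then obtain a b where *: "a \<in> carrier R" "b \<in> carrier R - {\<zero>}" "X = fraction R a b" by (metis frac_field_carrierE)
    show "\<zero>\<^bsub>?Q\<^esub> \<oplus>\<^bsub>?Q\<^esub> X = X"
      unfolding *(3) frac_zero frac_add[OF zero_closed one *(1,2)] using *(1,2) by simp
    have "fraction R (\<ominus> a) b \<oplus>\<^bsub>?Q\<^esub> X = \<zero>\<^bsub>?Q\<^esub>"
      unfolding *(3) frac_zero frac_add[OF a_inv_closed[OF *(1)] *(2,1,2)]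
      using *(1,2) nonzero_mult[OF *(2,2)] by (subst fraction_eq_iff) (auto simp: l_minus l_neg)
    then show "\<exists>Y\<in>carrier ?Q. Y \<oplus>\<^bsub>?Q\<^esub> X = \<zero>\<^bsub>?Q\<^esub>"
      using fraction_in_carrier[OF a_inv_closed[OF *(1)] *(2)] by blast
  next
    show "\<zero>\<^bsub>?Q\<^esub> \<in> carrier ?Q" unfolding frac_zero by (rule fraction_in_carrier[OF zero_closed one])
  qed
  show "comm_monoid ?Q"
  proof (rule comm_monoidI)
    fix X Y assume "X \<in> carrier ?Q" "Y \<in> carrier ?Q"
    then obtain a b c d where *: "a \<in> carrier R" "b \<in> carrier R - {\<zero>}" "X = fraction R a b"
      "c \<in> carrier R" "d \<in> carrier R - {\<zero>}" "Y = fraction R c d" by (metis frac_field_carrierE)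
    have bd: "b \<otimes> d \<in> carrier R - {\<zero>}" by (rule nonzero_mult[OF *(2,5)])
    show "X \<otimes>\<^bsub>?Q\<^esub> Y \<in> carrier ?Q"
      unfolding *(3,6) using frac_mult[OF *(1,2,4,5)] * bd by (auto intro!: fraction_in_carrier)
    show "X \<otimes>\<^bsub>?Q\<^esub> Y = Y \<otimes>\<^bsub>?Q\<^esub> X"
      unfolding *(3,6) frac_mult[OF *(1,2,4,5)] frac_mult[OF *(4,5,1,2)] using *(1,2,4,5)
      by (simp add: m_comm)
    fix Z assume "Z \<in> carrier ?Q"
    then obtain e f where ef: "e \<in> carrier R" "f \<in> carrier R - {\<zero>}" "Z = fraction R e f" by (metis frac_field_carrierE)
    have df: "d \<otimes> f \<in> carrier R - {\<zero>}" by (rule nonzero_mult[OF *(5) ef(2)])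
    have num: "a \<otimes> c \<in> carrier R" "c \<otimes> e \<in> carrier R" using * ef by auto
    show "X \<otimes>\<^bsub>?Q\<^esub> Y \<otimes>\<^bsub>?Q\<^esub> Z = X \<otimes>\<^bsub>?Q\<^esub> (Y \<otimes>\<^bsub>?Q\<^esub> Z)"
      unfolding *(3,6) ef(3) frac_mult[OF *(1,2,4,5)] frac_mult[OF *(4,5) ef(1,2)]
        frac_mult[OF num(1) bd ef(1,2)] frac_mult[OF *(1,2) num(2) df]
      using *(1,2,4,5) ef(1,2) by (simp add: m_assoc)
  next
    fix X assume "X \<in> carrier ?Q"
    then obtain a b where *: "a \<in> carrier R" "b \<in> carrier R - {\<zero>}" "X = fraction R a b" by (metis frac_field_carrierE)
    show "\<one>\<^bsub>?Q\<^esub> \<otimes>\<^bsub>?Q\<^esub> X = X"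
      unfolding *(3) frac_one frac_mult[OF one_closed one *(1,2)] using *(1,2) by simp
  next
    show "\<one>\<^bsub>?Q\<^esub> \<in> carrier ?Q" unfolding frac_one by (rule fraction_in_carrier[OF one_closed one])
  qed
  fix X Y Z assume "X \<in> carrier ?Q" "Y \<in> carrier ?Q" "Z \<in> carrier ?Q"
  then obtain a b c d e f where *: "a \<in> carrier R" "b \<in> carrier R - {\<zero>}" "X = fraction R a b"
    "c \<in> carrier R" "d \<in> carrier R - {\<zero>}" "Y = fraction R c d"
    "e \<in> carrier R" "f \<in> carrier R - {\<zero>}" "Z = fraction R e f" by (metis frac_field_carrierE)
  have den: "b \<otimes> d \<in> carrier R - {\<zero>}" "b \<otimes> f \<in> carrier R - {\<zero>}" "d \<otimes> f \<in> carrier R - {\<zero>}"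
    using nonzero_mult * by blast+
  have num: "a \<otimes> d \<oplus> c \<otimes> b \<in> carrier R" "a \<otimes> e \<in> carrier R" "c \<otimes> e \<in> carrier R" using * by auto
  show "(X \<oplus>\<^bsub>?Q\<^esub> Y) \<otimes>\<^bsub>?Q\<^esub> Z = X \<otimes>\<^bsub>?Q\<^esub> Z \<oplus>\<^bsub>?Q\<^esub> Y \<otimes>\<^bsub>?Q\<^esub> Z"
    unfolding *(3,6,9) frac_add[OF *(1,2,4,5)] frac_mult[OF *(1,2,7,8)] frac_mult[OF *(4,5,7,8)]
      frac_mult[OF num(1) den(1) *(7,8)] frac_add[OF num(2) den(2) num(3) den(3)]
    by (subst fraction_eq_iff)
      (use num den * nonzero_mult in \<open>simp_all add: l_distr r_distr m_ac\<close>)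
qed

lemma frac_field_localization: "scalar_localization R (frac_field R) (frac_incl R)"
proof -
  let ?Q = "frac_field R"
  interpret Q: cring ?Q by (rule frac_field_cring)
  have one: "\<one> \<in> carrier R - {\<zero>}" by simp
  show ?thesis
  proof
    show "frac_incl R \<in> ring_hom R ?Q"
    proof (rule ring_hom_memI)
      fix a b assume ab: "a \<in> carrier R" "b \<in> carrier R"
      show "frac_incl R a \<in> carrier ?Q" using ab one by (simp add: frac_incl_def fraction_in_carrier)
      show "frac_incl R (a \<otimes> b) = frac_incl R a \<otimes>\<^bsub>?Q\<^esub> frac_incl R b"
        unfolding frac_incl_def frac_mult[OF ab(1) one ab(2) one] by simp
      show "frac_incl R (a \<oplus> b) = frac_incl R a \<oplus>\<^bsub>?Q\<^esub> frac_incl R b"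
        unfolding frac_incl_def frac_add[OF ab(1) one ab(2) one] using ab by simp
    qed (simp add: frac_incl_def frac_one)
    show "inj_on (frac_incl R) (carrier R)"
      by (rule inj_onI) (simp add: frac_incl_def fraction_eq_iff)
    fix r assume r: "r \<in> carrier R - {\<zero>}"
    have "frac_incl R r \<otimes>\<^bsub>?Q\<^esub> fraction R \<one> r = \<one>\<^bsub>?Q\<^esub>"
      unfolding frac_incl_def frac_one using r frac_mult[OF _ one one_closed r, of r]
      by (simp add: fraction_eq_iff)
    then show "\<exists>u\<in>carrier ?Q. frac_incl R r \<otimes>\<^bsub>?Q\<^esub> u = \<one>\<^bsub>?Q\<^esub>"
      using fraction_in_carrier[OF one_closed r] by blast
  next
    fix s assume "s \<in> carrier ?Q"
    then obtain a b where *: "a \<in> carrier R" "b \<in> carrier R - {\<zero>}" "s = fraction R a b" by (metis frac_field_carrierE)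
    have "frac_incl R b \<otimes>\<^bsub>?Q\<^esub> s = frac_incl R a"
      unfolding *(3) frac_incl_def using *(1,2) frac_mult[OF _ one *(1,2), of b]
      by (simp add: fraction_eq_iff m_comm)
    then show "\<exists>r\<in>carrier R - {\<zero>}. \<exists>a\<in>carrier R. frac_incl R r \<otimes>\<^bsub>?Q\<^esub> s = frac_incl R a" using * by blast
  qed
qed

end

section \<open>The \<open>p\<close>-adic integers\<close>

lemma Zp_carrier_iff:
  "f \<in> carrier (Zp p) \<longleftrightarrow> (\<forall>n. f n \<in> {0..<int p ^ n} \<and> f (Suc n) mod int p ^ n = f n)"
  by (simp add: Zp_def)

lemma Zp_ops:
  "f \<oplus>\<^bsub>Zp p\<^esub> g = (\<lambda>n. (f n + g n) mod int p ^ n)" "f \<otimes>\<^bsub>Zp p\<^esub> g = (\<lambda>n. (f n * g n) mod int p ^ n)"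
  "\<zero>\<^bsub>Zp p\<^esub> = (\<lambda>n. 0)" "\<one>\<^bsub>Zp p\<^esub> = (\<lambda>n. 1 mod int p ^ n)"
  by (simp_all add: Zp_def)

lemma Zp_residue:
  assumes "f \<in> carrier (Zp p)" "m \<le> n"
  shows "f n mod int p ^ m = f m"
  using \<open>m \<le> n\<close>
proof (induction n rule: dec_induct)
  case base
  then show ?case using assms(1) by (simp add: Zp_carrier_iff)
next
  case (step n)
  have "int p ^ m dvd int p ^ n" using step.hyps(1) by (rule le_imp_power_dvd)
  then have "f (Suc n) mod int p ^ m = (f (Suc n) mod int p ^ n) mod int p ^ m" by (simp add: mod_mod_cancel)
  then show ?case using assms(1) step.IH by (simp add: Zp_carrier_iff)
qed

text \<open>A sequence that is coherent only modulo the respective powers of \<open>p\<close> is normalized to the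
representatives in \<open>{0..<p ^ n}\<close>.\<close>

lemma Zp_memI:
  assumes "p > 0" and coh: "\<And>n. [g (Suc n) = g n] (mod int p ^ n)"
  shows "(\<lambda>n. g n mod int p ^ n) \<in> carrier (Zp p)"
proof -
  have "(g (Suc n) mod int p ^ Suc n) mod int p ^ n = g n mod int p ^ n" for n
    using coh[of n] by (simp add: mod_mod_cancel cong_def)
  then show ?thesis using assms(1) by (simp add: Zp_carrier_iff)
qed

lemma Zp_coherent: "f \<in> carrier (Zp p) \<Longrightarrow> [f (Suc n) = f n] (mod int p ^ n)"
  by (metis Zp_carrier_iff cong_def mod_mod_trivial)

lemma Zp_mod_self [simp]: "f \<in> carrier (Zp p) \<Longrightarrow> f n mod int p ^ n = f n"
  by (simp add: Zp_carrier_iff)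

lemma Zp_cring:
  assumes "prime p"
  shows "cring (Zp p)"
proof -
  have p: "p > 0" using assms by (simp add: prime_gt_0_nat)
  have add: "f \<oplus>\<^bsub>Zp p\<^esub> g \<in> carrier (Zp p)" and mult: "f \<otimes>\<^bsub>Zp p\<^esub> g \<in> carrier (Zp p)"
    if "f \<in> carrier (Zp p)" "g \<in> carrier (Zp p)" for f g
    unfolding Zp_ops by (rule Zp_memI[OF p]; intro cong_add cong_mult Zp_coherent that)+
  show ?thesis
  proof (rule cringI)
    show "abelian_group (Zp p)"
    proof (rule abelian_groupI)
      fix f assume f: "f \<in> carrier (Zp p)"
      have "(\<lambda>n. (- f n) mod int p ^ n) \<in> carrier (Zp p)"
        using Zp_coherent[OF f] by (intro Zp_memI p) (simp add: cong_minus_minus_iff)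
      moreover have "(\<lambda>n. (- f n) mod int p ^ n) \<oplus>\<^bsub>Zp p\<^esub> f = \<zero>\<^bsub>Zp p\<^esub>"
        by (auto simp: Zp_ops mod_simps)
      ultimately show "\<exists>g\<in>carrier (Zp p). g \<oplus>\<^bsub>Zp p\<^esub> f = \<zero>\<^bsub>Zp p\<^esub>" by blast
    qed (use add p in \<open>auto simp: Zp_ops mod_simps ac_simps Zp_carrier_iff\<close>)
    show "comm_monoid (Zp p)"
    proof (rule comm_monoidI)
      show "\<one>\<^bsub>Zp p\<^esub> \<in> carrier (Zp p)" unfolding Zp_ops by (rule Zp_memI[OF p]) simp
    qed (use mult in \<open>auto simp: Zp_ops mod_simps ac_simps\<close>)
  qed (auto simp: Zp_ops mod_simps algebra_simps)
qed

text \<open>Here \<open>v\<close> is the \<open>p\<close>-adic valuation of \<open>f\<close>.\<close>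

lemma Zp_nonzeroE:
  assumes "f \<in> carrier (Zp p)" "f \<noteq> \<zero>\<^bsub>Zp p\<^esub>"
  obtains v where "f v = 0" "f (Suc v) \<noteq> 0"
proof -
  have "\<exists>n. f n \<noteq> 0" using assms(2) by (auto simp: Zp_ops)
  moreover have "f 0 \<in> {0..<int p ^ 0}" using assms(1) unfolding Zp_carrier_iff by blast
  then have "f 0 = 0" by simp
  moreover have "f n = 0" if "f 0 = 0" "\<nexists>v. f v = 0 \<and> f (Suc v) \<noteq> 0" for n
    using that by (induction n) auto
  ultimately show thesis using that by blast
qed

lemma Zp_domain:
  assumes p: "prime p"
  shows "domain (Zp p)"
proof -
  interpret cring "Zp p" by (rule Zp_cring[OF p])
  have pi: "prime (int p)" using p by simp
  show ?thesis
  proof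
    have "\<one>\<^bsub>Zp p\<^esub> 1 \<noteq> \<zero>\<^bsub>Zp p\<^esub> 1" using prime_gt_1_nat[OF p] by (simp add: Zp_ops)
    then show "\<one>\<^bsub>Zp p\<^esub> \<noteq> \<zero>\<^bsub>Zp p\<^esub>" by metis
    fix f g assume fg: "f \<otimes>\<^bsub>Zp p\<^esub> g = \<zero>\<^bsub>Zp p\<^esub>" "f \<in> carrier (Zp p)" "g \<in> carrier (Zp p)"
    show "f = \<zero>\<^bsub>Zp p\<^esub> \<or> g = \<zero>\<^bsub>Zp p\<^esub>"
    proof (rule ccontr)
      assume "\<not> ?thesis"
      then obtain k l where kl: "f (Suc k) \<noteq> 0" "g (Suc l) \<noteq> 0" using Zp_nonzeroE fg(2,3) by metis
      let ?N = "k + Suc l"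
      have "(f ?N * g ?N) mod int p ^ ?N = 0" using fun_cong[OF fg(1), of ?N] by (simp add: Zp_ops)
      then have "int p ^ ?N dvd f ?N * g ?N" by auto
      then obtain m n where mn: "m + n = ?N" "int p ^ m dvd f ?N" "int p ^ n dvd g ?N"
        using prime_elem_power_dvd_prod[OF _ prime_imp_prime_elem[OF pi]] by blast
      \<comment> \<open>Otherwise \<open>m + n \<le> k + l\<close>.\<close>
      have "m \<ge> Suc k \<or> n \<ge> Suc l" using mn(1) by arith
      then show False
      proof
        assume "m \<ge> Suc k"
        then have "int p ^ Suc k dvd f ?N" by (rule dvd_trans[OF le_imp_power_dvd mn(2)])
        then have "f ?N mod int p ^ Suc k = 0" by (rule dvd_imp_mod_0)
        moreover have "f ?N mod int p ^ Suc k = f (Suc k)" by (rule Zp_residue[OF fg(2)]) simp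
        ultimately show False using kl(1) by metis
      next
        assume "n \<ge> Suc l"
        then have "int p ^ Suc l dvd g ?N" by (rule dvd_trans[OF le_imp_power_dvd mn(3)])
        then have "g ?N mod int p ^ Suc l = 0" by (rule dvd_imp_mod_0)
        moreover have "g ?N mod int p ^ Suc l = g (Suc l)" by (rule Zp_residue[OF fg(3)]) simp
        ultimately show False using kl(2) by metis
      qed
    qed
  qed
qed

text \<open>An element \<open>r\<close> of valuation \<open>v\<close> divides every multiple \<open>b\<close> of \<open>p ^ v\<close>. Writing \<open>r = p ^ v u\<close> and
\<open>b = p ^ v w\<close>, the components of \<open>u\<close> are prime to \<open>p\<close>, and \<open>u x = w\<close> is solved separately modulo
each \<open>p ^ n\<close>; the solutions are coherent since they are unique.\<close>

lemma Zp_dvd: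
  assumes p: "prime p" and r: "r \<in> carrier (Zp p)" "r v = 0" "r (Suc v) \<noteq> 0"
    and b: "b \<in> carrier (Zp p)" "b v = 0"
  shows "\<exists>x\<in>carrier (Zp p). r \<otimes>\<^bsub>Zp p\<^esub> x = b"
proof -
  have pi: "prime (int p)" and p0: "p > 0" using p by (auto simp: prime_gt_0_nat)
  \<comment> \<open>The components \<open>u n\<close> are taken from level \<open>n + Suc v\<close>: dividing by \<open>p ^ v\<close> loses \<open>v\<close> levels, and
  one more level shows that even \<open>u 0\<close> is prime to \<open>p\<close>.\<close>
  define u w where "u n = r (n + Suc v) div int p ^ v" and "w n = b (n + Suc v) div int p ^ v" for n
  have quot: "f (n + Suc v) = int p ^ v * (f (n + Suc v) div int p ^ v)"
    if "f \<in> carrier (Zp p)" "f v = 0" for f n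
    using Zp_residue[OF that(1), of v "n + Suc v"] that(2) by (auto simp: dvd_eq_mod_eq_0[symmetric])
  have coh: "[f (Suc n + Suc v) div int p ^ v = f (n + Suc v) div int p ^ v] (mod int p ^ n)"
    if f: "f \<in> carrier (Zp p)" "f v = 0" for f n
  proof -
    have "[f (Suc n + Suc v) = f (n + Suc v)] (mod int p ^ (n + Suc v))" using Zp_coherent[OF f(1), of "n + Suc v"] by simp
    then have "int p ^ (n + Suc v) dvd int p ^ v * (f (Suc n + Suc v) div int p ^ v) - int p ^ v * (f (n + Suc v) div int p ^ v)"
      unfolding cong_iff_dvd_diff using quot[OF f, of "Suc n"] quot[OF f, of n] by simp
    then have "int p ^ v * int p ^ Suc n dvd int p ^ v * (f (Suc n + Suc v) div int p ^ v - f (n + Suc v) div int p ^ v)"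
      by (simp add: power_add right_diff_distrib mult_ac)
    then have "int p ^ Suc n dvd f (Suc n + Suc v) div int p ^ v - f (n + Suc v) div int p ^ v"
      using p0 by (subst (asm) dvd_times_left_cancel_iff) auto
    then show ?thesis unfolding cong_iff_dvd_diff using dvd_trans le_imp_power_dvd[of n "Suc n" "int p"] by auto
  qed
  have ru: "r (n + Suc v) = int p ^ v * u n" for n unfolding u_def by (rule quot[OF r(1,2)])
  have bw: "b (n + Suc v) = int p ^ v * w n" for n unfolding w_def by (rule quot[OF b])
  have u_coh: "[u (Suc n) = u n] (mod int p ^ n)" for n unfolding u_def by (rule coh[OF r(1,2)])
  have w_coh: "[w (Suc n) = w n] (mod int p ^ n)" for n unfolding w_def by (rule coh[OF b])
  have cop: "coprime (u n) (int p ^ m)" for n m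
  proof -
    have "\<not> int p ^ Suc v dvd r (n + Suc v)" using Zp_residue[OF r(1), of "Suc v" "n + Suc v"] r(3) by (auto simp: dvd_eq_mod_eq_0)
    then have "\<not> int p dvd u n" unfolding ru using p0 by simp
    then show ?thesis using pi by (metis coprime_commute coprime_power_left_iff prime_imp_coprime)
  qed
  have "\<exists>i. [u n * i = 1] (mod int p ^ n)" for n by (rule cong_solve_coprime_int[OF cop])
  then obtain i where i: "\<And>n. [u n * i n = 1] (mod int p ^ n)" by metis
  define x where "x n = w n * i n" for n
  have ux: "[u n * x n = w n] (mod int p ^ n)" for n
    using cong_scalar_left[OF i[of n], of "w n"] by (simp add: x_def mult_ac)
  have "[x (Suc n) = x n] (mod int p ^ n)" for n
  proof -
    have "[u (Suc n) * x (Suc n) = w (Suc n)] (mod int p ^ n)"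
      by (rule cong_dvd_modulus[OF ux]) simp
    then have "[u n * x (Suc n) = w n] (mod int p ^ n)"
      by (meson cong_scalar_right cong_sym cong_trans u_coh w_coh)
    then have "[u n * x (Suc n) = u n * x n] (mod int p ^ n)"
      using ux cong_sym cong_trans by blast
    then show ?thesis using cop cong_mult_lcancel by blast
  qed
  then have x: "(\<lambda>n. x n mod int p ^ n) \<in> carrier (Zp p)" by (rule Zp_memI[OF p0])
  have "(r n * x n) mod int p ^ n = b n" for n
  proof -
    have "[r n * x n = int p ^ v * (u n * x n)] (mod int p ^ n)"
      using Zp_residue[OF r(1), of n "n + Suc v"] cong_scalar_right[of "r n" "r (n + Suc v)" "int p ^ n" "x n"]
      unfolding ru by (simp add: cong_def mult_ac) (metis mod_mult_left_eq mult.assoc mult.commute)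
    also have "[int p ^ v * (u n * x n) = int p ^ v * w n] (mod int p ^ n)" by (rule cong_scalar_left[OF ux])
    also have "[int p ^ v * w n = b n] (mod int p ^ n)"
      using Zp_residue[OF b(1), of n "n + Suc v"] unfolding bw by (simp add: cong_def b(1))
    finally show ?thesis using b(1) by (simp add: cong_def)
  qed
  then have "r \<otimes>\<^bsub>Zp p\<^esub> (\<lambda>n. x n mod int p ^ n) = b" by (simp add: Zp_ops mod_simps)
  then show ?thesis using x by blast
qed

text \<open>If \<open>r\<close> has valuation \<open>v\<close>, then \<open>x\<close> minus the integer \<open>x v\<close> is divisible by \<open>r\<close>, so that the
integers below \<open>p ^ v\<close> represent all residues modulo \<open>r\<close>.\<close>

lemma Zp_finite_residue_domain:
  assumes p: "prime p"
  shows "finite_residue_domain (Zp p)"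
proof -
  interpret domain "Zp p" by (rule Zp_domain[OF p])
  have p0: "p > 0" and p1: "Suc 0 < p" using p prime_gt_0_nat prime_gt_Suc_0_nat by blast+
  define c where "c k = (\<lambda>n. k mod int p ^ n)" for k
  have c: "c k \<in> carrier (Zp p)" for k unfolding c_def by (rule Zp_memI[OF p0]) simp
  show ?thesis
  proof
    fix r assume r: "r \<in> carrier (Zp p) - {\<zero>\<^bsub>Zp p\<^esub>}"
    then obtain v where v: "r v = 0" "r (Suc v) \<noteq> 0" using Zp_nonzeroE by blast
    let ?D = "c ` {0..<int p ^ v}"
    have "\<exists>d\<in>?D. \<exists>q\<in>carrier (Zp p). x = r \<otimes>\<^bsub>Zp p\<^esub> q \<oplus>\<^bsub>Zp p\<^esub> d" if x: "x \<in> carrier (Zp p)" for x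
    proof -
      have "x v \<in> {0..<int p ^ v}" using x by (simp add: Zp_carrier_iff)
      then have d: "c (x v) \<in> ?D" by blast
      define b where "b = x \<ominus>\<^bsub>Zp p\<^esub> c (x v)"
      have b: "b \<in> carrier (Zp p)" using x c by (simp add: b_def)
      have bx: "b \<oplus>\<^bsub>Zp p\<^esub> c (x v) = x" using x c by (simp add: b_def a_minus_def a_assoc l_neg)
      have "(b v + x v) mod int p ^ v = x v" using fun_cong[OF bx, of v] x by (simp add: Zp_ops c_def mod_simps)
      then have "[b v + x v = 0 + x v] (mod int p ^ v)" using x by (simp add: cong_def)
      then have "b v mod int p ^ v = 0" unfolding cong_add_rcancel by (simp add: cong_def)
      then have "b v = 0" using b by simp
      then obtain q where "q \<in> carrier (Zp p)" "r \<otimes>\<^bsub>Zp p\<^esub> q = b" using Zp_dvd[OF p _ v b] r by blast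
      then show ?thesis using d bx by (intro bexI[of _ "c (x v)"] bexI[of _ q]) simp_all
    qed
    moreover have "?D \<subseteq> carrier (Zp p)" using c by blast
    ultimately show "\<exists>D. finite D \<and> D \<subseteq> carrier (Zp p) \<and>
      (\<forall>x\<in>carrier (Zp p). \<exists>d\<in>D. \<exists>q\<in>carrier (Zp p). x = r \<otimes>\<^bsub>Zp p\<^esub> q \<oplus>\<^bsub>Zp p\<^esub> d)"
      by (intro exI[of _ ?D]) auto
  next
    have "inj (\<lambda>k::nat. c (int k))"
    proof (rule injI)
      fix k l assume eq: "c (int k) = c (int l)"
      obtain n where n: "k + l < p ^ n" using power_gt_expt[OF p1] less_trans by blast
      have "int k mod int p ^ n = int l mod int p ^ n" using fun_cong[OF eq, of n] by (simp add: c_def)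
      moreover have "int k < int p ^ n" "int l < int p ^ n" using n by (simp_all flip: of_nat_power)
      ultimately show "k = l" by simp
    qed
    then have "infinite (range (\<lambda>k::nat. c (int k)))" using finite_imageD infinite_UNIV_nat by blast
    then show "infinite (carrier (Zp p))" using infinite_super[of "range (\<lambda>k::nat. c (int k))"] c by blast
  qed
qed

theorem lemma3p11p1:
  fixes p :: nat
    and V :: "(nat \<Rightarrow> int, 'v) module"
    and L :: "('v list \<Rightarrow> nat \<Rightarrow> int) set set"
  assumes "prime p" and "p > 3"
    and "fg_free_module (Zp p) V"
    and "submodule L (Zp p) (ext_power (Zp p) 2 V)"
    and "torsion_free (Zp p) (quot_module (ext_power (Zp p) 2 V) L)"
  defines "\<L> \<equiv> class2_lie_alg (Zp p) V L"
  defines "\<L>Q \<equiv> base_change (Zp p) (Qp p) (frac_incl (Zp p)) \<L>"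
  shows "finite (carrier (SK1 (Zp p) \<L>)) \<longleftrightarrow>
         carrier (SK1 (Qp p) \<L>Q) = {\<zero>\<^bsub>SK1 (Qp p) \<L>Q\<^esub>}"
proof -
  interpret Z: finite_residue_domain "Zp p" by (rule Zp_finite_residue_domain) fact
  have V: "module (Zp p) V" using assms(3) by (simp add: fg_free_module_def)
  interpret localized_bracket_module "Zp p" "Qp p" "frac_incl (Zp p)" \<L>
    unfolding \<L>_def Qp_def
    by (intro localized_bracket_module.intro Z.frac_field_localization class2_bracket_module V assms(4))
  have "finitely_generated (Zp p) \<L>"
    unfolding \<L>_def
    by (rule class2_finitely_generated[OF V assms(4) fg_free_imp_finitely_generated[OF assms(3)]])
  note fg = finitely_generated_ext_square[OF module_axioms this]
  have "finite (carrier (SK1 (Zp p) \<L>)) \<longleftrightarrow>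
      (\<forall>\<xi>\<in>SK1_kernel (Zp p) \<L>. \<exists>r\<in>carrier (Zp p) - {\<zero>\<^bsub>Zp p\<^esub>}. r \<odot>\<^bsub>W\<^esub> \<xi> \<in> SK1_relations (Zp p) \<L>)"
    unfolding SK1_eq
    by (rule Z.finite_quotient_iff_torsion[OF W_module fg kernel_submodule relations_submodule])
  then show ?thesis unfolding \<L>Q_def SK1_localized_trivial_iff .
qed

end
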